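(* Suppose that $\mathsf{V}$ is a semigroup pseudovariety such that $\mathsf{Sl}\subseteq\mathsf{V}\subseteq\mathsf{DS}$. The following conditions are equivalent: (1) $\mathsf{V}$ is closed under bideterministic product; (2) $\mathsf{V}$ is multiregularly based in $\mathsf{DS}$; (3) $\mathsf{V}$ is multiregularly based.
   Context: All alphabets are finite. A semigroup pseudovariety is a class of finite semigroups closed under subsemigroups, homomorphic images and finite direct products; $\mathsf{S}$ is the pseudovariety of all finite semigroups, $\mathsf{Sl}$ that of all finite semilattices, and $\mathsf{DS}$ that of all finite semigroups whose regular $\mathcal{J}$-classes are subsemigroups. $\overline{\Omega}_A\mathsf{V}$ is the free pro-$\mathsf{V}$ semigroup on $A$ (elements of $\overline{\Omega}_A\mathsf{S}$ are pseudowords). For $u\in\overline{\Omega}_A\mathsf{S}$, $[u]_{\mathsf{V}}$ is its image under the continuous homomorphism $\overline{\Omega}_A\mathsf{S}\to\overline{\Omega}_A\mathsf{V}$ sending each letter to itself. A pseudoidentity over $A$ is a formal equality $u=v$ with $u,v\in\overline{\Omega}_A\mathsf{S}$; a finite semigroup $S$ satisfies it if every continuous homomorphism $\overline{\Omega}_A\mathsf{S}\to S$ identifies $u$ and $v$. A set $\Sigma$ of pseudoidentities is a basis of $\mathsf{V}$ if $\mathsf{V}$ is exactly the class of finite semigroups satisfying all members of $\Sigma$. An element $s$ of a semigroup $S$ is regular if $s\in sSs$. A pseudoword $\pi\in\overline{\Omega}_A\mathsf{S}$ is $\mathsf{W}$-multiregular if $[\pi]_{\mathsf{W}}$ is a finite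 product of regular elements of $\overline{\Omega}_A\mathsf{W}$. For semigroup pseudovarieties $\mathsf{V}\subseteq\mathsf{W}$, $\mathsf{V}$ is multiregularly based in $\mathsf{W}$ if it has a basis $\Sigma$ such that, for every $(\pi=\rho)\in\Sigma$, both $\pi$ and $\rho$ are $\mathsf{W}$-multiregular. "Multiregularly based" means multiregularly based in $\mathsf{S}$. Closure under bideterministic product. A language $L\subseteq A^*$ is a prefix code (resp. suffix code) if $uA^+\cap L=\emptyset$ (resp. $A^+u\cap L=\emptyset$) for all $u\in L$. A language $L\subseteq A^+$ is $\mathsf{V}$-recognizable if $L=\varphi^{-1}(\varphi(L))$ for some homomorphism $\varphi\colon A^+\to S$ with $S\in\mathsf{V}$. $\mathsf{V}$ is closed under bideterministic product if, for every alphabet $A$ and letter $a\in A$, $LaK$ is $\mathsf{V}$-recognizable whenever each of $L,K$ is either a $\mathsf{V}$-recognizable subset of $A^+$ or equal to $\{1\}$, $La$ is a prefix code and $aK$ is a suffix code. *)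

theory Defs
  imports "HOL-Analysis.Analysis"
begin

section \<open>Semigroups with explicit carrier\<close>

record 'a sgrp =
  carrier :: "'a set"
  smult :: "'a \<Rightarrow> 'a \<Rightarrow> 'a"

definition is_sgrp :: "'a sgrp \<Rightarrow> bool" where
  "is_sgrp S \<longleftrightarrow>
     carrier S \<noteq> {} \<and>
     (\<forall>x\<in>carrier S. \<forall>y\<in>carrier S. smult S x y \<in> carrier S) \<and>
     (\<forall>x\<in>carrier S. \<forall>y\<in>carrier S. \<forall>z\<in>carrier S.
        smult S (smult S x y) z = smult S x (smult S y z))"

definition subsemigroup :: "'a sgrp \<Rightarrow> 'a sgrp \<Rightarrow> bool" where
  "subsemigroup T S \<longleftrightarrow>
     is_sgrp T \<and> carrier T \<subseteq> carrier S \<and>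
     (\<forall>x\<in>carrier T. \<forall>y\<in>carrier T. smult T x y = smult S x y)"

text \<open>Homomorphisms are extensional, so that they are determined by their values on the carrier.\<close>

definition sg_hom :: "'a sgrp \<Rightarrow> 'b sgrp \<Rightarrow> ('a \<Rightarrow> 'b) set" where
  "sg_hom S T =
     {h \<in> carrier S \<rightarrow>\<^sub>E carrier T.
        \<forall>x\<in>carrier S. \<forall>y\<in>carrier S. h (smult S x y) = smult T (h x) (h y)}"

definition hom_image :: "'a sgrp \<Rightarrow> 'b sgrp \<Rightarrow> bool" where
  "hom_image S T \<longleftrightarrow> (\<exists>h\<in>sg_hom S T. h ` carrier S = carrier T)"

definition sg_iso :: "'a sgrp \<Rightarrow> 'b sgrp \<Rightarrow> bool" where
  "sg_iso S T \<longleftrightarrow> (\<exists>h\<in>sg_hom S T. bij_betw h (carrier S) (carrier T))"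

definition prod_sgrp :: "'i set \<Rightarrow> ('i \<Rightarrow> 'a sgrp) \<Rightarrow> ('i \<Rightarrow> 'a) sgrp" where
  "prod_sgrp I S =
     \<lparr>carrier = (\<Pi>\<^sub>E i\<in>I. carrier (S i)),
      smult = (\<lambda>f g. \<lambda>i\<in>I. smult (S i) (f i) (g i))\<rparr>"

inductive_set finite_products :: "'a sgrp \<Rightarrow> 'a set \<Rightarrow> 'a set"
  for S :: "'a sgrp" and X :: "'a set" where
  single: "x \<in> X \<Longrightarrow> x \<in> finite_products S X"
| times: "x \<in> X \<Longrightarrow> y \<in> finite_products S X \<Longrightarrow> smult S x y \<in> finite_products S X"

definition regular_elem :: "'a sgrp \<Rightarrow> 'a \<Rightarrow> bool" where
  "regular_elem S s \<longleftrightarrow>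
     s \<in> carrier S \<and> (\<exists>x\<in>carrier S. s = smult S (smult S s x) s)"

text \<open>The principal two-sided ideal of \<open>x\<close>, with an identity adjoined to the semigroup.\<close>

definition principal_ideal :: "'a sgrp \<Rightarrow> 'a \<Rightarrow> 'a set" where
  "principal_ideal S x =
     {x} \<union> {smult S s x |s. s \<in> carrier S} \<union> {smult S x t |t. t \<in> carrier S} \<union>
     {smult S (smult S s x) t |s t. s \<in> carrier S \<and> t \<in> carrier S}"

definition J_class :: "'a sgrp \<Rightarrow> 'a \<Rightarrow> 'a set" where
  "J_class S x = {y \<in> carrier S. principal_ideal S y = principal_ideal S x}"


section \<open>Pseudovarieties\<close>

text \<open>Every finite semigroup has an isomorphic copy carried by a set of natural numbers.
  A class of finite semigroups is rendered as a set of such copies.\<close>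

definition fin_sgrps :: "nat sgrp set" where
  "fin_sgrps = {S. is_sgrp S \<and> finite (carrier S)}"

text \<open>The empty family is allowed in the product clause, so a pseudovariety contains the
  trivial semigroups. Isomorphisms transport products back to the type \<^typ>\<open>nat\<close>.\<close>

definition pseudovariety :: "nat sgrp set \<Rightarrow> bool" where
  "pseudovariety V \<longleftrightarrow>
     V \<subseteq> fin_sgrps \<and>
     (\<forall>S\<in>V. \<forall>T. subsemigroup T S \<longrightarrow> T \<in> V) \<and>
     (\<forall>S\<in>V. \<forall>T\<in>fin_sgrps. hom_image S T \<longrightarrow> T \<in> V) \<and>
     (\<forall>(I :: nat set) S. \<forall>T\<in>fin_sgrps.
        finite I \<and> (\<forall>i\<in>I. S i \<in> V) \<and> sg_iso (prod_sgrp I S) T \<longrightarrow> T \<in> V)"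

definition Sl :: "nat sgrp set" where
  "Sl = {S \<in> fin_sgrps.
     (\<forall>x\<in>carrier S. smult S x x = x) \<and>
     (\<forall>x\<in>carrier S. \<forall>y\<in>carrier S. smult S x y = smult S y x)}"

definition DS :: "nat sgrp set" where
  "DS = {S \<in> fin_sgrps.
     \<forall>x\<in>carrier S. regular_elem S x \<longrightarrow>
       (\<forall>y\<in>J_class S x. \<forall>z\<in>J_class S x. smult S y z \<in> J_class S x)}"


section \<open>Free profinite semigroups\<close>

text \<open>The free pro-\<open>V\<close> semigroup on \<open>A\<close> is the projective limit, inside the product, of the
  \<open>A\<close>-generated members of \<open>V\<close> (discrete), with respect to the homomorphisms that respect the
  choice of generators.\<close>

definition gen_index :: "nat sgrp set \<Rightarrow> 'a set \<Rightarrow> (nat sgrp \<times> ('a \<Rightarrow> nat)) set" where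
  "gen_index V A =
     {(S, \<phi>). S \<in> V \<and> \<phi> \<in> A \<rightarrow>\<^sub>E carrier S \<and> carrier S = finite_products S (\<phi> ` A)}"

type_synonym 'a pseudoword = "nat sgrp \<times> ('a \<Rightarrow> nat) \<Rightarrow> nat"

definition free_pro :: "nat sgrp set \<Rightarrow> 'a set \<Rightarrow> 'a pseudoword sgrp" where
  "free_pro V A =
     \<lparr>carrier = {u \<in> carrier (prod_sgrp (gen_index V A) fst).
        \<forall>(S, \<phi>)\<in>gen_index V A. \<forall>(T, \<psi>)\<in>gen_index V A. \<forall>h\<in>sg_hom S T.
          (\<forall>a\<in>A. h (\<phi> a) = \<psi> a) \<longrightarrow> h (u (S, \<phi>)) = u (T, \<psi>)},
      smult = smult (prod_sgrp (gen_index V A) fst)\<rparr>"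

definition free_pro_topology :: "nat sgrp set \<Rightarrow> 'a set \<Rightarrow> 'a pseudoword topology" where
  "free_pro_topology V A =
     subtopology
       (product_topology (\<lambda>p. discrete_topology (carrier (fst p))) (gen_index V A))
       (carrier (free_pro V A))"

definition letter :: "nat sgrp set \<Rightarrow> 'a set \<Rightarrow> 'a \<Rightarrow> 'a pseudoword" where
  "letter V A a = (\<lambda>p\<in>gen_index V A. snd p a)"

definition cont_hom ::
    "'a sgrp \<Rightarrow> 'a topology \<Rightarrow> 'b sgrp \<Rightarrow> 'b topology \<Rightarrow> ('a \<Rightarrow> 'b) set" where
  "cont_hom S X T Y = {h \<in> sg_hom S T. continuous_map X Y h}"

text \<open>The value \<open>[u]\<^sub>V\<close> of a pseudoword \<open>u\<close> over \<open>A\<close>.\<close>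

definition canonical_proj :: "nat sgrp set \<Rightarrow> 'a set \<Rightarrow> 'a pseudoword \<Rightarrow> 'a pseudoword" where
  "canonical_proj V A =
     (THE h. h \<in> cont_hom (free_pro fin_sgrps A) (free_pro_topology fin_sgrps A)
                          (free_pro V A) (free_pro_topology V A) \<and>
             (\<forall>a\<in>A. h (letter fin_sgrps A a) = letter V A a))"


section \<open>Pseudoidentities and bases\<close>

text \<open>Alphabets are finite sets of natural numbers. The empty alphabet is excluded here since it
  carries no pseudowords (the projective limit over its empty index set would be a point).\<close>

type_synonym pseudoidentity = "nat set \<times> nat pseudoword \<times> nat pseudoword"

definition pseudoidentities :: "pseudoidentity set" where
  "pseudoidentities =
     {(A, u, v). finite A \<and> A \<noteq> {} \<and>
        u \<in> carrier (free_pro fin_sgrps A) \<and> v \<in> carrier (free_pro fin_sgrps A)}"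

fun satisfies :: "nat sgrp \<Rightarrow> pseudoidentity \<Rightarrow> bool" where
  "satisfies S (A, u, v) \<longleftrightarrow>
     (\<forall>h\<in>cont_hom (free_pro fin_sgrps A) (free_pro_topology fin_sgrps A)
                  S (discrete_topology (carrier S)). h u = h v)"

definition is_basis :: "pseudoidentity set \<Rightarrow> nat sgrp set \<Rightarrow> bool" where
  "is_basis \<Sigma> V \<longleftrightarrow>
     \<Sigma> \<subseteq> pseudoidentities \<and> V = {S \<in> fin_sgrps. \<forall>e\<in>\<Sigma>. satisfies S e}"

definition multiregular :: "nat sgrp set \<Rightarrow> 'a set \<Rightarrow> 'a pseudoword \<Rightarrow> bool" where
  "multiregular W A u \<longleftrightarrow>
     canonical_proj W A u
       \<in> finite_products (free_pro W A) {s. regular_elem (free_pro W A) s}"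

definition multiregularly_based_in :: "nat sgrp set \<Rightarrow> nat sgrp set \<Rightarrow> bool" where
  "multiregularly_based_in W V \<longleftrightarrow>
     (\<exists>\<Sigma>. is_basis \<Sigma> V \<and>
        (\<forall>(A, u, v)\<in>\<Sigma>. multiregular W A u \<and> multiregular W A v))"

abbreviation multiregularly_based :: "nat sgrp set \<Rightarrow> bool" where
  "multiregularly_based \<equiv> multiregularly_based_in fin_sgrps"


section \<open>Closure under bideterministic product\<close>

definition free_sgrp :: "'a set \<Rightarrow> 'a list sgrp" where
  "free_sgrp A = \<lparr>carrier = lists A - {[]}, smult = (@)\<rparr>"

definition prefix_code :: "'a set \<Rightarrow> 'a list set \<Rightarrow> bool" where
  "prefix_code A L \<longleftrightarrow>
     L \<subseteq> lists A \<and> (\<forall>u\<in>L. {u @ w |w. w \<in> lists A - {[]}} \<inter> L = {})"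

definition suffix_code :: "'a set \<Rightarrow> 'a list set \<Rightarrow> bool" where
  "suffix_code A L \<longleftrightarrow>
     L \<subseteq> lists A \<and> (\<forall>u\<in>L. {w @ u |w. w \<in> lists A - {[]}} \<inter> L = {})"

definition recognizable :: "nat sgrp set \<Rightarrow> 'a set \<Rightarrow> 'a list set \<Rightarrow> bool" where
  "recognizable V A L \<longleftrightarrow>
     L \<subseteq> lists A - {[]} \<and>
     (\<exists>S\<in>V. \<exists>\<phi>\<in>sg_hom (free_sgrp A) S. L = {w \<in> lists A - {[]}. \<phi> w \<in> \<phi> ` L})"

definition closed_under_bideterministic_product :: "nat sgrp set \<Rightarrow> bool" where
  "closed_under_bideterministic_product V \<longleftrightarrow>
     (\<forall>(A :: nat set) a L K.
        finite A \<and> a \<in> A \<and>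
        (recognizable V A L \<or> L = {[]}) \<and>
        (recognizable V A K \<or> K = {[]}) \<and>
        prefix_code A {u @ [a] |u. u \<in> L} \<and>
        suffix_code A {[a] @ v |v. v \<in> K} \<longrightarrow>
        recognizable V A {u @ [a] @ v |u v. u \<in> L \<and> v \<in> K})"

end

theory Submission
  imports Defs
begin

text \<open>Pseudowords are handled as limits of sequences of words along a free ultrafilter, so that
  \<open>\<omega>\<close>-powers and factorisations are performed on the words themselves. In \<open>DS\<close> every pseudoword is a
  finite product of letters and regular elements. Call \<open>\<Sigma>\<close> the set of multiregular pseudoidentities
  valid in \<open>V\<close>.

  If \<open>V\<close> is closed under bideterministic product, factorise two pseudowords that agree in \<open>V\<close>, with the
  least number of letters modulo \<open>\<Sigma>\<close>. A letter \<open>a\<close> of \<open>x a y\<close> with \<open>x = x a z\<close> in \<open>V\<close> could be absorbed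
  in a multiregular factor by a consequence of \<open>\<Sigma>\<close>, so every letter marks a bideterministic product
  in \<open>V\<close>. Hence both factorisations have the same letters, and multiregular factors that agree in \<open>V\<close>,
  so the two pseudowords agree modulo \<open>\<Sigma>\<close>. Conversely, the marked letter of a bideterministic
  product cannot occur inside a factor \<open>(r z)\<^sup>\<omega> r\<close> by pumping, so the syntactic semigroup of the
  product satisfies \<open>\<Sigma>\<close>. Finally, regular elements over \<open>DS\<close> lift to pseudowords \<open>(r z)\<^sup>\<omega> r\<close>, and \<open>DS\<close>
  itself is defined by a multiregular pseudoidentity.\<close>

section \<open>A free ultrafilter on the natural numbers\<close>

text \<open>All three conditions are compared with the single inclusion
  \<open>mreg_models V \<subseteq> V\<close>, where \<open>mreg_models V\<close> consists of the
  finite semigroups that satisfy every multiregular pseudoidentity valid in \<open>V\<close>. The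
  obstacle is that an equality x a y = x' b y' of pseudowords offers no positions to compare. For
  words the comparison is a finite case distinction, and an ultrafilter turns "one of finitely many
  cases at each n" into one case for almost all n. It also makes every sequence of words converge,
  so no subsequences have to be chosen. Sequences reach all pseudowords: the semigroups carried by
  subsets of \<open>{..<k}\<close> have finitely many multiplication tables, so one word per k
  approximates a pseudoword in all of them at once. The exponent n! at index n represents \<omega>:
  once n is large compared with a given semigroup, n! is a multiple of every period occurring there.
  Since n! also exceeds 2 n, a position inside a power of n! periods has at least n periods on one
  side, and this is what makes pumping work.\<close>

definition ultra :: "nat filter \<Rightarrow> bool" where
  "ultra F \<longleftrightarrow> F \<noteq> bot \<and> F \<le> sequentially \<and> (\<forall>P. eventually P F \<or> eventually (\<lambda>n. \<not> P n) F)"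

text \<open>Zorn's lemma for the order "finer than": a finest proper filter below
  \<open>sequentially\<close> decides every predicate, because adjoining an undecided one would
  refine it.\<close>

lemma ultra_exists: "\<exists>F. ultra F"
proof -
  define X where "X = {F. F \<noteq> bot \<and> F \<le> (sequentially :: nat filter)}"
  have "\<exists>m\<in>X. \<forall>a\<in>X. m \<ge> a \<longrightarrow> a = m"
  proof (rule predicate_Zorn)
    show "partial_order_on X (relation_of (\<ge>) X)"
      by (rule partial_order_on_relation_ofI) auto
    fix C assume C: "C \<in> Chains (relation_of (\<ge>) X)"
    have CX: "C \<subseteq> X" and tot: "\<And>a b. a \<in> C \<Longrightarrow> b \<in> C \<Longrightarrow> a \<le> b \<or> b \<le> a"
      using C by (auto simp: Chains_def relation_of_def)
    show "\<exists>u\<in>X. \<forall>a\<in>C. u \<le> a"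
    proof (cases "C = {}")
      case True
      have "sequentially \<in> X" by (simp add: X_def)
      then show ?thesis using True by blast
    next
      case False
      \<comment> \<open>As families of sets, the infimum of a chain of filters is their union; hence
        it is still proper.\<close>
      have *: "eventually P (Inf C) \<longleftrightarrow> (\<exists>b\<in>C. eventually P b)" for P
        using False tot by (intro eventually_Inf_base) (metis inf.absorb1 inf.absorb2 order_refl)+
      have "Inf C \<noteq> bot"
        unfolding trivial_limit_def * using CX by (auto simp: X_def trivial_limit_def)
      moreover have "Inf C \<le> sequentially"
        using False CX by (auto simp: X_def intro: Inf_lower2)
      ultimately show ?thesis by (auto simp: X_def intro!: bexI[of _ "Inf C"] Inf_lower)
    qed
  qed
  then obtain m where m: "m \<in> X" "\<And>a. a \<in> X \<Longrightarrow> a \<le> m \<Longrightarrow> a = m" by blast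
  have "eventually P m \<or> eventually (\<lambda>n. \<not> P n) m" for P
  proof (cases "inf m (principal {n. P n}) = bot")
    case True
    then show ?thesis
      by (auto simp: trivial_limit_def eventually_inf_principal)
  next
    case False
    then have "inf m (principal {n. P n}) = m"
      using m by (intro m(2)) (auto simp: X_def intro: le_infI1)
    then have "m \<le> principal {n. P n}" by (metis inf.cobounded2)
    then show ?thesis by (simp add: le_principal)
  qed
  then show ?thesis using m(1) by (auto simp: ultra_def X_def)
qed

definition uf :: "nat filter" where "uf = (SOME F. ultra F)"

lemma ultra_uf: "ultra uf"
  unfolding uf_def by (rule someI_ex[OF ultra_exists])

lemma uf_neq_bot [simp]: "uf \<noteq> bot"
  using ultra_uf by (simp add: ultra_def)

lemma ae_const [simp]: "(\<forall>\<^sub>F n in uf. P) \<longleftrightarrow> P"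
  by (cases P) auto

lemma ae_ge:
  assumes "\<And>n. n \<ge> N \<Longrightarrow> P n"
  shows "\<forall>\<^sub>F n in uf. P n"
proof -
  have "uf \<le> sequentially" using ultra_uf by (simp add: ultra_def)
  moreover have "eventually P sequentially" using assms by (auto simp: eventually_sequentially)
  ultimately show ?thesis by (simp add: le_filter_def)
qed

lemma ae_not: "(\<forall>\<^sub>F n in uf. \<not> P n) \<longleftrightarrow> \<not> (\<forall>\<^sub>F n in uf. P n)"
proof
  assume "\<forall>\<^sub>F n in uf. \<not> P n"
  show "\<not> (\<forall>\<^sub>F n in uf. P n)"
  proof
    assume "\<forall>\<^sub>F n in uf. P n"
    with \<open>\<forall>\<^sub>F n in uf. \<not> P n\<close> have "\<forall>\<^sub>F n in uf. False" by eventually_elim auto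
    then show False by simp
  qed
next
  assume "\<not> (\<forall>\<^sub>F n in uf. P n)"
  then show "\<forall>\<^sub>F n in uf. \<not> P n" using ultra_uf by (auto simp: ultra_def)
qed

text \<open>The only point where an ultrafilter beats a filter: case distinctions on words become
  case distinctions on whole sequences.\<close>

lemma ae_disj: "(\<forall>\<^sub>F n in uf. P n \<or> Q n) \<longleftrightarrow> (\<forall>\<^sub>F n in uf. P n) \<or> (\<forall>\<^sub>F n in uf. Q n)"
proof -
  have "(\<forall>\<^sub>F n in uf. \<not> (P n \<or> Q n)) \<longleftrightarrow> (\<forall>\<^sub>F n in uf. \<not> P n) \<and> (\<forall>\<^sub>F n in uf. \<not> Q n)"
    by (simp add: eventually_conj_iff)
  then show ?thesis unfolding ae_not by blast
qed

lemma ae_bex_finite: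
  assumes "finite X" "\<forall>\<^sub>F n in uf. \<exists>x\<in>X. P x n"
  shows "\<exists>x\<in>X. \<forall>\<^sub>F n in uf. P x n"
proof (rule ccontr)
  assume "\<not> ?thesis"
  then have "\<forall>x\<in>X. \<forall>\<^sub>F n in uf. \<not> P x n" by (simp add: ae_not)
  then have "\<forall>\<^sub>F n in uf. \<forall>x\<in>X. \<not> P x n" using assms(1) by (simp add: eventually_ball_finite)
  with assms(2) have "\<forall>\<^sub>F n in uf. False" by eventually_elim auto
  then show False by simp
qed

lemma ae_choice:
  assumes "\<forall>\<^sub>F n in uf. \<exists>x\<in>X. P x n" "x0 \<in> X"
  shows "\<exists>f. (\<forall>n. f n \<in> X) \<and> (\<forall>\<^sub>F n in uf. P (f n) n)"
proof -
  \<comment> \<open>The default \<open>x0\<close> at indices without a witness keeps all of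
    \<open>f\<close> inside \<open>X\<close>.\<close>
  define f where "f n = (if \<exists>x\<in>X. P x n then SOME x. x \<in> X \<and> P x n else x0)" for n
  have "f n \<in> X" for n
    using assms(2) someI_ex[of "\<lambda>x. x \<in> X \<and> P x n"] by (auto simp: f_def)
  moreover have "\<forall>\<^sub>F n in uf. P (f n) n"
    using assms(1)
  proof eventually_elim
    case (elim n)
    then show ?case using someI_ex[of "\<lambda>x. x \<in> X \<and> P x n"] by (auto simp: f_def)
  qed
  ultimately show ?thesis by blast
qed


section \<open>Evaluation of words in finite semigroups\<close>

text \<open>\<^term>\<open>None\<close> plays the role of an adjoined identity, the value of the empty word.\<close>

fun madd :: "'b sgrp \<Rightarrow> 'b option \<Rightarrow> 'b option \<Rightarrow> 'b option" where
  "madd T None y = y"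
| "madd T (Some a) None = Some a"
| "madd T (Some a) (Some b) = Some (smult T a b)"

primrec mev :: "'b sgrp \<Rightarrow> ('a \<Rightarrow> 'b) \<Rightarrow> 'a list \<Rightarrow> 'b option" where
  "mev T f [] = None"
| "mev T f (a # w) = madd T (Some (f a)) (mev T f w)"

definition mcar :: "'b sgrp \<Rightarrow> 'b option set" where
  "mcar T = insert None (Some ` carrier T)"

text \<open>Meaningful on nonempty words only; the empty word receives the arbitrary value
  \<open>the None\<close>.\<close>

definition ev :: "'b sgrp \<Rightarrow> ('a \<Rightarrow> 'b) \<Rightarrow> 'a list \<Rightarrow> 'b" where
  "ev T f w = the (mev T f w)"

lemma madd_None_right [simp]: "madd T x None = x"
  by (cases x) auto

lemma mev_None_iff [simp]: "mev T f w = None \<longleftrightarrow> w = []"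
proof (cases w)
  case (Cons a v)
  then show ?thesis by (cases "mev T f v") auto
qed simp

lemma mev_eq_Some: "w \<noteq> [] \<Longrightarrow> mev T f w = Some (ev T f w)"
  by (simp add: ev_def)

lemma sgrp_closed: "is_sgrp T \<Longrightarrow> x \<in> carrier T \<Longrightarrow> y \<in> carrier T \<Longrightarrow> smult T x y \<in> carrier T"
  by (simp add: is_sgrp_def)

lemma sgrp_assoc:
  "is_sgrp T \<Longrightarrow> x \<in> carrier T \<Longrightarrow> y \<in> carrier T \<Longrightarrow> z \<in> carrier T \<Longrightarrow>
   smult T (smult T x y) z = smult T x (smult T y z)"
  by (simp add: is_sgrp_def)

lemma madd_in: "is_sgrp T \<Longrightarrow> x \<in> mcar T \<Longrightarrow> y \<in> mcar T \<Longrightarrow> madd T x y \<in> mcar T"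
  by (auto simp: mcar_def sgrp_closed)

lemma madd_assoc:
  "is_sgrp T \<Longrightarrow> x \<in> mcar T \<Longrightarrow> y \<in> mcar T \<Longrightarrow> z \<in> mcar T \<Longrightarrow>
   madd T (madd T x y) z = madd T x (madd T y z)"
  by (auto simp: mcar_def sgrp_assoc)

lemma mev_in:
  "is_sgrp T \<Longrightarrow> f \<in> A \<rightarrow> carrier T \<Longrightarrow> w \<in> lists A \<Longrightarrow> mev T f w \<in> mcar T"
proof (induction w)
  case Nil
  then show ?case by (simp add: mcar_def)
next
  case (Cons a w)
  then have "Some (f a) \<in> mcar T" by (auto simp: mcar_def)
  with Cons show ?case by (auto intro!: madd_in)
qed

lemma ev_in:
  assumes "is_sgrp T" "f \<in> A \<rightarrow> carrier T" "w \<in> lists A" "w \<noteq> []"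
  shows "ev T f w \<in> carrier T"
  using mev_in[OF assms(1-3)] assms(4) by (auto simp: mcar_def ev_def)

lemma mev_append:
  "is_sgrp T \<Longrightarrow> f \<in> A \<rightarrow> carrier T \<Longrightarrow> x \<in> lists A \<Longrightarrow> y \<in> lists A \<Longrightarrow>
   mev T f (x @ y) = madd T (mev T f x) (mev T f y)"
proof (induction x)
  case (Cons a w)
  then have "Some (f a) \<in> mcar T" by (auto simp: mcar_def)
  with Cons show ?case by (simp add: madd_assoc mev_in)
qed simp

lemma ev_append:
  assumes "is_sgrp T" "f \<in> A \<rightarrow> carrier T" "x \<in> lists A" "y \<in> lists A" "x \<noteq> []" "y \<noteq> []"
  shows "ev T f (x @ y) = smult T (ev T f x) (ev T f y)"
  using mev_append[OF assms(1-4)] assms(5,6) by (simp add: mev_eq_Some)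

lemma ev_single [simp]: "ev T f [a] = f a"
  by (simp add: ev_def)

lemma mev_congr:
  assumes "is_sgrp T" "f \<in> A \<rightarrow> carrier T" "mev T f u = mev T f v"
    "x \<in> lists A" "u \<in> lists A" "v \<in> lists A" "y \<in> lists A"
  shows "mev T f (x @ u @ y) = mev T f (x @ v @ y)"
  using assms by (simp add: mev_append[of _ _ A])

lemma mev_cong_fun: "(\<And>a. a \<in> set w \<Longrightarrow> f a = g a) \<Longrightarrow> mev T f w = mev T g w"
  by (induction w) auto

lemma ev_cong_fun: "(\<And>a. a \<in> set w \<Longrightarrow> f a = g a) \<Longrightarrow> ev T f w = ev T g w"
  unfolding ev_def by (subst mev_cong_fun) auto

lemma mev_map: "mev T f (map g w) = mev T (\<lambda>a. f (g a)) w"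
  by (induction w) auto

lemma mev_eq_ev_iff:
  "mev T f u = mev T f v \<longleftrightarrow> (u = [] \<longleftrightarrow> v = []) \<and> (u \<noteq> [] \<longrightarrow> ev T f u = ev T f v)"
  by (metis mev_None_iff mev_eq_Some option.inject)

lemma mev_hom:
  assumes "is_sgrp S" "f \<in> A \<rightarrow> carrier S" "w \<in> lists A"
    "\<And>x y. x \<in> carrier S \<Longrightarrow> y \<in> carrier S \<Longrightarrow> h (smult S x y) = smult T (h x) (h y)"
  shows "mev T (\<lambda>a. h (f a)) w = map_option h (mev S f w)"
  using assms(3)
proof (induction w)
  case (Cons a w)
  then have "mev S f w \<in> mcar S" "f a \<in> carrier S" using assms mev_in by fastforce+
  then show ?case using Cons assms(4) by (auto simp: mcar_def)
qed simp

lemma ev_hom: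
  assumes "is_sgrp S" "f \<in> A \<rightarrow> carrier S" "w \<in> lists A" "w \<noteq> []"
    "\<And>x y. x \<in> carrier S \<Longrightarrow> y \<in> carrier S \<Longrightarrow> h (smult S x y) = smult T (h x) (h y)"
  shows "ev T (\<lambda>a. h (f a)) w = h (ev S f w)"
  using mev_hom[OF assms(1-3), of h T] assms(4,5) by (simp add: mev_eq_Some)

text \<open>Carries pseudoidentities from one alphabet to another: substituting words first and
  evaluating afterwards is evaluating at the values of these words.\<close>

lemma mev_concat_map:
  assumes "is_sgrp T" "f \<in> A \<rightarrow> carrier T" "\<And>b. b \<in> B \<Longrightarrow> \<sigma> b \<in> lists A - {[]}" "w \<in> lists B"
  shows "mev T f (concat (map \<sigma> w)) = mev T (\<lambda>b. ev T f (\<sigma> b)) w"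
  using assms(4)
proof (induction w)
  case (Cons b w)
  then have "\<sigma> b \<in> lists A" "\<sigma> b \<noteq> []" using assms(3) by auto
  moreover have "concat (map \<sigma> w) \<in> lists A" using Cons assms(3) by (fastforce simp: in_lists_conv_set)
  ultimately have "mev T f (\<sigma> b @ concat (map \<sigma> w)) = madd T (Some (ev T f (\<sigma> b))) (mev T f (concat (map \<sigma> w)))"
    using mev_append[OF assms(1,2)] mev_eq_Some by metis
  then show ?case using Cons by simp
qed simp

lemma finite_products_closed:
  assumes "is_sgrp S" "X \<subseteq> carrier S" "x \<in> finite_products S X"
  shows "x \<in> carrier S"
  using assms(3) by induction (use assms(1,2) in \<open>auto simp: sgrp_closed subsetD\<close>)

lemma finite_products_eq:
  assumes "is_sgrp S" "f \<in> A \<rightarrow> carrier S"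
  shows "finite_products S (f ` A) = {ev S f w |w. w \<in> lists A - {[]}}"
proof (intro equalityI subsetI)
  fix x assume "x \<in> finite_products S (f ` A)"
  then show "x \<in> {ev S f w |w. w \<in> lists A - {[]}}"
  proof induction
    case (single x)
    then obtain a where "a \<in> A" "x = f a" by auto
    then show ?case by (intro CollectI exI[of _ "[a]"]) auto
  next
    case (times x y)
    then obtain a w where a: "a \<in> A" "x = f a" and w: "y = ev S f w" "w \<in> lists A - {[]}" by auto
    then show ?case using assms ev_append[of S f A "[a]" w]
      by (intro CollectI exI[of _ "a # w"]) auto
  qed
next
  fix x assume "x \<in> {ev S f w |w. w \<in> lists A - {[]}}"
  then obtain w where w: "w \<in> lists A" "w \<noteq> []" "x = ev S f w" by auto
  have "w \<in> lists A \<Longrightarrow> w \<noteq> [] \<Longrightarrow> ev S f w \<in> finite_products S (f ` A)"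
  proof (induction w)
    case (Cons a w)
    show ?case
    proof (cases "w = []")
      case True
      then show ?thesis using Cons by (auto intro: finite_products.single)
    next
      case False
      then have "ev S f (a # w) = smult S (f a) (ev S f w)"
        using assms Cons ev_append[of S f A "[a]" w] by simp
      then show ?thesis using Cons False by (auto intro: finite_products.times)
    qed
  qed simp
  then show "x \<in> finite_products S (f ` A)" using w by simp
qed


section \<open>Powers of words\<close>

definition wpow :: "'a list \<Rightarrow> nat \<Rightarrow> 'a list" where
  "wpow w n = concat (replicate n w)"

lemma wpow_0 [simp]: "wpow w 0 = []"
  by (simp add: wpow_def)

lemma wpow_Suc: "wpow w (Suc n) = w @ wpow w n"
  by (simp add: wpow_def)

lemma wpow_1 [simp]: "wpow w (Suc 0) = w"
  by (simp add: wpow_def)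

lemma wpow_add: "wpow w (m + n) = wpow w m @ wpow w n"
  by (simp add: wpow_def replicate_add)

lemma wpow_Suc2: "wpow w (Suc n) = wpow w n @ w"
  using wpow_add[of w n 1] by simp

lemma set_wpow [simp]: "set (wpow w n) = (if n = 0 then {} else set w)"
  by (induction n) (auto simp: wpow_Suc)

lemma wpow_lists: "w \<in> lists A \<Longrightarrow> wpow w n \<in> lists A"
  by (cases "n = 0") auto

lemma wpow_eq_Nil [simp]: "wpow w n = [] \<longleftrightarrow> n = 0 \<or> w = []"
  by (induction n) (auto simp: wpow_Suc)

lemma wpow_conj: "wpow (x @ y) n @ x = x @ wpow (y @ x) n"
  by (induction n) (auto simp: wpow_Suc)

lemma wpow_fact: "wpow w (fact n) = w @ wpow w (fact n - 1)"
  using wpow_Suc[of w "fact n - 1"] by simp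

lemma wpow_fact2: "wpow w (fact n) = wpow w (fact n - 1) @ w"
  using wpow_Suc2[of w "fact n - 1"] by simp

lemma concat_map_wpow: "concat (map \<sigma> (wpow w n)) = wpow (concat (map \<sigma> w)) n"
  by (induction n) (auto simp: wpow_Suc)

text \<open>Bounds both index and period of the powers of every element: among the powers with
  exponents from 0 to \<open>card (mcar T)\<close> two coincide.\<close>

definition stab :: "'b sgrp \<Rightarrow> nat" where
  "stab T = Suc (card (mcar T))"

lemma mev_wpow_stable:
  assumes T: "is_sgrp T" "finite (carrier T)" and f: "f \<in> A \<rightarrow> carrier T" and s: "s \<in> lists A"
    and n: "n \<ge> stab T" and j: "j \<ge> stab T"
  shows "mev T f (wpow s (j + fact n)) = mev T f (wpow s j)"
proof -
  have fin: "finite (mcar T)" using T by (simp add: mcar_def)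
  let ?p = "\<lambda>i. mev T f (wpow s i)"
  have "\<not> inj_on ?p {0..card (mcar T)}"
  proof
    assume "inj_on ?p {0..card (mcar T)}"
    moreover have "?p ` {0..card (mcar T)} \<subseteq> mcar T" using mev_in[OF T(1) f wpow_lists[OF s]] by auto
    ultimately have "card {0..card (mcar T)} \<le> card (mcar T)" using fin by (metis card_inj_on_le)
    then show False by simp
  qed
  then obtain i i' where i: "i < i'" "i' \<le> card (mcar T)" "?p i = ?p i'"
    unfolding inj_on_def by (metis atLeastAtMost_iff linorder_neqE_nat)
  define d where "d = i' - i"
  have step: "?p (k + d) = ?p k" if "k \<ge> i" for k
  proof -
    have "wpow s k = wpow s i @ wpow s (k - i)" "wpow s (k + d) = wpow s i' @ wpow s (k - i)"
      using that i by (simp_all add: wpow_add[symmetric] d_def add.commute)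
    then show ?thesis using i(3) by (simp only: mev_append[OF T(1) f wpow_lists[OF s] wpow_lists[OF s]])
  qed
  have "?p (k + m * d) = ?p k" if "k \<ge> i" for k m
  proof (induction m)
    case (Suc m)
    have "?p (k + m * d + d) = ?p (k + m * d)" using that by (intro step) simp
    then show ?case using Suc by (simp add: add.commute add.left_commute)
  qed simp
  \<comment> \<open>The period \<open>d\<close> is at most \<open>card (mcar T)\<close>, hence at
    most \<open>n\<close>, and so it divides n!.\<close>
  moreover have "d dvd fact n"
    using i n by (intro dvd_fact) (auto simp: d_def stab_def)
  then obtain m where "fact n = m * d" by (metis dvd_def mult.commute)
  moreover have "j \<ge> i" using i j by (simp add: stab_def)
  ultimately show ?thesis by metis
qed


section \<open>Finite semigroups in \<open>DS\<close>\<close>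

locale finite_eval =
  fixes T :: "'b sgrp" and f :: "'a \<Rightarrow> 'b" and A :: "'a set"
  assumes sg: "is_sgrp T" and fin: "finite (carrier T)" and gens: "f \<in> A \<rightarrow> carrier T"
begin

abbreviation E :: "'a list \<Rightarrow> 'b option" where "E \<equiv> mev T f"

lemma rw:
  "E u = E v \<Longrightarrow> u \<in> lists A \<Longrightarrow> v \<in> lists A \<Longrightarrow> x \<in> lists A \<Longrightarrow> y \<in> lists A \<Longrightarrow>
   E (x @ u @ y) = E (x @ v @ y)"
  using mev_congr[OF sg gens] by blast

lemma rwl: "E u = E v \<Longrightarrow> u \<in> lists A \<Longrightarrow> v \<in> lists A \<Longrightarrow> y \<in> lists A \<Longrightarrow> E (u @ y) = E (v @ y)"
  using rw[of u v "[]" y] by simp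

lemma rwr: "E u = E v \<Longrightarrow> u \<in> lists A \<Longrightarrow> v \<in> lists A \<Longrightarrow> x \<in> lists A \<Longrightarrow> E (x @ u) = E (x @ v)"
  using rw[of u v x "[]"] by simp

lemma pow_stable:
  "s \<in> lists A \<Longrightarrow> n \<ge> stab T \<Longrightarrow> j \<ge> stab T \<Longrightarrow> E (wpow s (j + fact n)) = E (wpow s j)"
  using mev_wpow_stable[OF sg fin gens] .

lemma iterate:
  assumes "E u = E (p @ u @ q)" and [simp]: "u \<in> lists A" "p \<in> lists A" "q \<in> lists A"
  shows "E u = E (wpow p n @ u @ wpow q n)"
proof (induction n)
  case (Suc n)
  have "E u = E (p @ u @ q)" by fact
  also have "\<dots> = E (p @ (wpow p n @ u @ wpow q n) @ q)"
    by (rule rw[OF Suc]) (simp_all add: wpow_lists del: in_lists_conv_set)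
  finally show ?case by (simp only: wpow_Suc[of p] wpow_Suc2[of q] append_assoc)
qed simp

text \<open>By \<open>iterate\<close>, \<open>u\<close> carries \<open>stab T\<close> copies of
  \<open>p\<close> on its left and of \<open>q\<close> on its right. Beyond that threshold n!
  further copies leave the value unchanged.\<close>

lemma absorb:
  assumes "E u = E (p @ u @ q)" and l: "u \<in> lists A" "p \<in> lists A" "q \<in> lists A" and n: "n \<ge> stab T"
  shows "E (u @ wpow q (fact n)) = E u" "E (wpow p (fact n) @ u) = E u"
proof -
  note [simp] = l wpow_lists
  note [simp del] = in_lists_conv_set
  let ?k = "stab T"
  have it: "E u = E (wpow p ?k @ u @ wpow q ?k)" by (rule iterate[OF assms(1)]) simp_all
  have "E u = E ((wpow p ?k @ u) @ wpow q ?k)" using it by simp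
  also have "\<dots> = E ((wpow p ?k @ u) @ wpow q (?k + fact n))"
    using pow_stable[OF l(3) n, of ?k] by (intro rwr) simp_all
  also have "\<dots> = E ((wpow p ?k @ u @ wpow q ?k) @ wpow q (fact n))" by (simp add: wpow_add)
  also have "\<dots> = E (u @ wpow q (fact n))" using it by (intro rwl) simp_all
  finally show "E (u @ wpow q (fact n)) = E u" by simp
  have "E u = E (wpow p ?k @ (u @ wpow q ?k))" using it by simp
  also have "\<dots> = E (wpow p (fact n + ?k) @ (u @ wpow q ?k))"
    using pow_stable[OF l(2) n, of ?k] by (intro rwl) (simp_all add: add.commute)
  also have "\<dots> = E (wpow p (fact n) @ (wpow p ?k @ u @ wpow q ?k))" by (simp add: wpow_add)
  also have "\<dots> = E (wpow p (fact n) @ u)" using it by (intro rwr) simp_all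
  finally show "E (wpow p (fact n) @ u) = E u" by simp
qed

text \<open>Stability of finite semigroups: if s lies J-below s s, then it lies R-below it, say s =
  s s q'. Absorbing the left factor s then gives s^(\<omega>+1) = s, so s belongs to a
  subgroup.\<close>

lemma group_power:
  assumes "E s = E (p @ (s @ s) @ q)" and l: "s \<in> lists A" "p \<in> lists A" "q \<in> lists A"
    and n: "n \<ge> stab T"
  shows "E (wpow s (fact n) @ s) = E s"
proof -
  note [simp] = l wpow_lists
  note [simp del] = in_lists_conv_set
  define q' where "q' = q @ wpow (s @ q) (fact n - 1)"
  have q': "q' \<in> lists A" by (simp add: q'_def)
  have "E (s @ wpow (s @ q) (fact n)) = E s"
    by (rule absorb(1)[where p = p]) (use assms in simp_all)
  then have "E s = E (s @ s @ q')" by (simp add: wpow_fact q'_def)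
  then show ?thesis by (rule absorb(2)) (use q' n in simp_all)
qed

text \<open>Regularity is a property of the J-class. From y = p p' y q' q absorption shows that
  right multiplication of y by q' and left multiplication by p' can be undone, so an inverse of x,
  placed between q' and p', becomes an inverse of y.\<close>

lemma regular_transfer:
  assumes y: "E y = E (p @ x @ q)" and x: "E x = E (p' @ y @ q')" and r: "E x = E (x @ t @ x)"
    and l: "x \<in> lists A" "y \<in> lists A" "p \<in> lists A" "q \<in> lists A" "p' \<in> lists A" "q' \<in> lists A"
      "t \<in> lists A"
  shows "E y = E (y @ (q' @ t @ p') @ y)"
proof -
  note [simp] = l wpow_lists
  note [simp del] = in_lists_conv_set
  let ?n = "stab T"
  \<comment> \<open>\<open>g\<close> undoes the right multiplication of \<open>y\<close> by
    \<open>q'\<close>, and \<open>c\<close> the left multiplication by \<open>p'\<close>: y = y q' g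
    and y = c p' y.\<close>
  define g c where "g = q @ wpow (q' @ q) (fact ?n - 1)" and "c = wpow (p @ p') (fact ?n - 1) @ p"
  have gc [simp]: "g \<in> lists A" "c \<in> lists A" by (simp_all add: g_def c_def)
  have "E y = E (p @ (p' @ y @ q') @ q)"
    unfolding y by (rule rw[OF x]) simp_all
  then have *: "E y = E ((p @ p') @ y @ (q' @ q))" by simp
  have "E (y @ wpow (q' @ q) (fact ?n)) = E y" by (rule absorb(1)[OF *]) simp_all
  then have yg: "E y = E (y @ q' @ g)" by (simp add: wpow_fact g_def)
  have "E (wpow (p @ p') (fact ?n) @ y) = E y" by (rule absorb(2)[OF *]) simp_all
  then have yc: "E y = E (c @ p' @ y)" by (simp add: wpow_fact2 c_def)
  have "E (y @ q') = E ((c @ p' @ y) @ q')" by (rule rwl[OF yc]) simp_all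
  also have "\<dots> = E (c @ (p' @ y @ q'))" by simp
  also have "\<dots> = E (c @ x)" by (rule rwr[OF x[symmetric]]) simp_all
  finally have yq: "E (y @ q') = E (c @ x)" .
  have "E y = E ((y @ q') @ g)" using yg by simp
  also have "\<dots> = E ((c @ x) @ g)" by (rule rwl[OF yq]) simp_all
  also have "\<dots> = E (c @ x @ g)" by simp
  also have "\<dots> = E (c @ (x @ t @ x) @ g)" by (rule rw[OF r]) simp_all
  also have "\<dots> = E ((c @ x) @ t @ x @ g)" by simp
  also have "\<dots> = E ((y @ q') @ t @ x @ g)" by (rule rwl[OF yq[symmetric]]) simp_all
  also have "\<dots> = E ((y @ q' @ t) @ x @ g)" by simp
  also have "\<dots> = E ((y @ q' @ t) @ (p' @ y @ q') @ g)" by (rule rw[OF x]) simp_all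
  also have "\<dots> = E ((y @ q' @ t @ p') @ (y @ q' @ g))" by simp
  also have "\<dots> = E ((y @ q' @ t @ p') @ y)" by (rule rwr[OF yg[symmetric]]) simp_all
  finally show ?thesis by simp
qed

end

text \<open>The form in which membership in \<open>DS\<close> is used: regular values lie in
  subgroups. It is an assumption of a locale and not derived from \<open>DS\<close>, because
  \<open>DS_I\<close> has to argue from it before membership is known.\<close>

locale group_eval = finite_eval +
  assumes grp: "\<And>u t n. u \<in> lists A \<Longrightarrow> t \<in> lists A \<Longrightarrow> E u = E (u @ t @ u) \<Longrightarrow> n \<ge> stab T \<Longrightarrow>
    E (wpow u (fact n) @ u) = E u"
begin

text \<open>Let e = y^\<omega>. Then z has a right multiple b = z q e that is L-equivalent to e,
  with a b = e. As b = b a b is regular, it lies in a subgroup, so e = a b = a b b^\<omega> = e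
  b^\<omega>. Since b^\<omega> begins with z and e ends with y, the value y = e y has y z as a
  factor.\<close>

lemma product_above:
  assumes y: "E y = E (p @ z @ q)" and r: "E y = E (y @ t @ y)"
    and l: "y \<in> lists A" "z \<in> lists A" "p \<in> lists A" "q \<in> lists A" "t \<in> lists A"
  shows "\<exists>c\<in>lists A. \<exists>d\<in>lists A. E y = E (c @ (y @ z) @ d)"
proof -
  note [simp] = l wpow_lists
  note [simp del] = in_lists_conv_set
  let ?n = "stab T"
  let ?N = "fact ?n :: nat"
  define e where "e = wpow y ?N"
  define a where "a = wpow y (?N - 1) @ p"
  define b where "b = z @ q @ e"
  have [simp]: "e \<in> lists A" "a \<in> lists A" "b \<in> lists A" by (simp_all add: e_def a_def b_def)
  have ey: "E y = E (e @ y)" unfolding e_def by (rule grp[OF _ _ r, symmetric]) simp_all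
  have ee: "E (e @ e) = E e"
  proof -
    have "E (e @ e) = E ((e @ y) @ wpow y (?N - 1))" unfolding e_def by (simp add: wpow_fact)
    also have "\<dots> = E (y @ wpow y (?N - 1))" by (rule rwl[OF ey[symmetric]]) simp_all
    finally show ?thesis by (simp add: e_def wpow_fact)
  qed
  have eaq: "E e = E (a @ z @ q)"
  proof -
    have "E e = E (wpow y (?N - 1) @ y)" by (simp add: e_def wpow_fact2)
    also have "\<dots> = E (wpow y (?N - 1) @ (p @ z @ q))" by (rule rwr[OF y]) simp_all
    finally show ?thesis by (simp add: a_def)
  qed
  have ab: "E (a @ b) = E e"
  proof -
    have "E (a @ b) = E ((a @ z @ q) @ e)" by (simp add: b_def)
    also have "\<dots> = E (e @ e)" by (rule rwl[OF eaq[symmetric]]) simp_all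
    finally show ?thesis using ee by simp
  qed
  have "E (b @ a @ b) = E (b @ e)" by (rule rwr[OF ab]) simp_all
  also have "\<dots> = E ((z @ q) @ (e @ e))" by (simp add: b_def)
  also have "\<dots> = E ((z @ q) @ e)" by (rule rwr[OF ee]) simp_all
  finally have "E b = E (b @ a @ b)" by (simp add: b_def)
  then have bN: "E (wpow b ?N @ b) = E b" by (rule grp[rotated 2]) simp_all
  define h where "h = q @ e @ wpow b (?N - 1)"
  have [simp]: "h \<in> lists A" by (simp add: h_def)
  have "E (a @ b @ wpow b ?N) = E (a @ (wpow b ?N @ b))"
    by (simp flip: wpow_Suc wpow_Suc2)
  also have "\<dots> = E (a @ b)" by (rule rwr[OF bN]) simp_all
  finally have "E e = E ((a @ b) @ wpow b ?N)" using ab by simp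
  also have "\<dots> = E (e @ wpow b ?N)" by (rule rwl[OF ab]) simp_all
  also have "\<dots> = E (e @ z @ h)" by (simp add: wpow_fact b_def h_def)
  finally have ez: "E e = E (e @ z @ h)" .
  have "E y = E (e @ y)" by (fact ey)
  also have "\<dots> = E ((e @ z @ h) @ y)" by (rule rwl[OF ez]) simp_all
  also have "\<dots> = E (wpow y (?N - 1) @ (y @ z) @ (h @ y))"
    unfolding e_def wpow_fact2 by simp
  finally show ?thesis
    by - (rule bexI[of _ "wpow y (?N - 1)"], rule bexI[of _ "h @ y"], assumption, simp_all)
qed

text \<open>Elements J-above an idempotent e are closed under product. Complete u to y = q e p u and
  v to z = v q' e p'. Both lie in the J-class of e, y is idempotent, and u v is a factor of y z, so
  \<open>product_above\<close> applies to y and z.\<close>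

lemma idempotent_above:
  assumes ee: "E e = E (e @ e)" and u: "E e = E (p @ u @ q)" and v: "E e = E (p' @ v @ q')"
    and l: "e \<in> lists A" "u \<in> lists A" "v \<in> lists A" "p \<in> lists A" "q \<in> lists A" "p' \<in> lists A"
      "q' \<in> lists A"
  shows "\<exists>c\<in>lists A. \<exists>d\<in>lists A. E e = E (c @ (u @ v) @ d)"
proof -
  note [simp] = l wpow_lists
  note [simp del] = in_lists_conv_set
  define y where "y = q @ e @ p @ u"
  define z where "z = v @ q' @ e @ p'"
  have [simp]: "y \<in> lists A" "z \<in> lists A" by (simp_all add: y_def z_def)
  have e3: "E e = E (e @ e @ e)"
    using rwr[OF ee, of e] ee by simp
  have "E (y @ [] @ y) = E ((q @ e) @ (p @ u @ q) @ (e @ p @ u))" by (simp add: y_def)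
  also have "\<dots> = E ((q @ e) @ e @ (e @ p @ u))" by (rule rw[OF u[symmetric]]) simp_all
  also have "\<dots> = E (q @ (e @ e @ e) @ (p @ u))" by simp
  also have "\<dots> = E (q @ e @ (p @ u))" by (rule rw[OF e3[symmetric]]) simp_all
  finally have yy: "E y = E (y @ [] @ y)" by (simp add: y_def)
  have ey: "E e = E ((p @ u) @ y @ q)"
  proof -
    have "E e = E (e @ e @ e)" by fact
    also have "\<dots> = E ((p @ u @ q) @ e @ e)" by (rule rwl[OF u]) simp_all
    also have "\<dots> = E ((p @ u @ q @ e) @ e)" by simp
    also have "\<dots> = E ((p @ u @ q @ e) @ (p @ u @ q))" by (rule rwr[OF u]) simp_all
    finally show ?thesis by (simp add: y_def)
  qed
  have ez: "E e = E (p' @ z @ (v @ q'))"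
  proof -
    have "E e = E (e @ e @ e)" by fact
    also have "\<dots> = E ((p' @ v @ q') @ e @ e)" by (rule rwl[OF v]) simp_all
    also have "\<dots> = E ((p' @ v @ q' @ e) @ e)" by simp
    also have "\<dots> = E ((p' @ v @ q' @ e) @ (p' @ v @ q'))" by (rule rwr[OF v]) simp_all
    finally show ?thesis by (simp add: z_def)
  qed
  have "E y = E (q @ e @ (p @ u))" by (simp add: y_def)
  also have "\<dots> = E (q @ (p' @ z @ (v @ q')) @ (p @ u))" by (rule rw[OF ez]) simp_all
  finally have "E y = E ((q @ p') @ z @ (v @ q' @ p @ u))" by simp
  from product_above[OF this yy]
  obtain c d where cd: "c \<in> lists A" "d \<in> lists A" "E y = E (c @ (y @ z) @ d)" by auto
  note [simp] = cd(1,2)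
  have "E e = E ((p @ u) @ y @ q)" by fact
  also have "\<dots> = E ((p @ u) @ (c @ (y @ z) @ d) @ q)" by (rule rw[OF cd(3)]) simp_all
  also have "\<dots> = E ((p @ u @ c @ q @ e @ p) @ (u @ v) @ (q' @ e @ p' @ d @ q))"
    by (simp add: y_def z_def)
  finally show ?thesis
    by - (rule bexI[of _ "p @ u @ c @ q @ e @ p"], rule bexI[of _ "q' @ e @ p' @ d @ q"],
      assumption, simp_all)
qed

text \<open>Whether a word lies J-above an idempotent is thus decided by its letters alone, which is
  why content governs the factorisation over \<open>DS\<close>.\<close>

lemma idempotent_above_word:
  assumes ee: "E e = E (e @ e)" and e: "e \<in> lists A"
    and "\<And>a. a \<in> set w \<Longrightarrow> \<exists>p\<in>lists A. \<exists>q\<in>lists A. E e = E (p @ [a] @ q)"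
    and "w \<in> lists A"
  shows "\<exists>p\<in>lists A. \<exists>q\<in>lists A. E e = E (p @ w @ q)"
  using assms(3,4)
proof (induction w)
  case Nil
  then show ?case using e by (intro bexI[of _ e] bexI[of _ "[]"]) auto
next
  case (Cons a w)
  obtain p q where 1: "p \<in> lists A" "q \<in> lists A" "E e = E (p @ w @ q)" using Cons by auto
  obtain p' q' where 2: "p' \<in> lists A" "q' \<in> lists A" "E e = E (p' @ [a] @ q')"
    using Cons.prems(1)[of a] by auto
  from idempotent_above[OF ee 2(3) 1(3)] show ?case using 1 2 Cons e by simp
qed

text \<open>A word with more full-content blocks than the semigroup has elements is regular: the prefix
  values stabilise, which produces an idempotent that is \<open>J\<close>-equivalent to the whole word.\<close>

lemma many_blocks_regular:
  assumes xs: "length xs \<ge> stab T" "\<And>x. x \<in> set xs \<Longrightarrow> set x = C" and y: "set y \<subseteq> C"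
    and C: "C \<subseteq> A" and n: "n \<ge> stab T"
  shows "E (wpow (concat xs @ y) (fact n) @ (concat xs @ y)) = E (concat xs @ y)"
proof (cases "C = {}")
  case True
  then have "concat xs @ y = []" using xs y by auto
  then show ?thesis by (simp only: append_Nil2) (simp add: wpow_def)
next
  case False
  note [simp del] = in_lists_conv_set
  have inA: "w \<in> lists A" if "set w \<subseteq> C" for w using that C by (auto simp: in_lists_conv_set)
  have setk: "set (concat (take k xs)) \<subseteq> C" "set (concat (drop k xs)) \<subseteq> C" for k
    using xs(2) by (auto dest: in_set_takeD in_set_dropD)
  let ?p = "\<lambda>i. E (concat (take i xs))"
  have "\<not> inj_on ?p {0..length xs}"
  proof
    assume "inj_on ?p {0..length xs}"
    moreover have "?p ` {0..length xs} \<subseteq> mcar T" using mev_in[OF sg gens inA] setk by auto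
    moreover have "finite (mcar T)" using fin by (simp add: mcar_def)
    ultimately have "card {0..length xs} \<le> card (mcar T)" by (metis card_inj_on_le)
    then show False using xs(1) by (simp add: stab_def)
  qed
  then obtain i j where ij: "i < j" "j \<le> length xs" "?p i = ?p j"
    unfolding inj_on_def by (metis atLeastAtMost_iff linorder_neqE_nat)
  define X t r where "X = concat (take i xs)" and "t = concat (take (j - i) (drop i xs))"
    and "r = concat (drop j xs) @ y"
  define w where "w = concat xs @ y"
  have tj: "take j xs = take i xs @ take (j - i) (drop i xs)"
    using ij take_add[of i "j - i" xs] by simp
  have w: "w = X @ t @ r"
    unfolding w_def X_def t_def r_def
    by (metis append.assoc append_take_drop_id concat_append tj)
  have t: "set t = C"
  proof -
    have "xs ! i \<in> set (take (j - i) (drop i xs))"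
      using ij by (auto simp: in_set_conv_nth intro!: exI[of _ 0])
    moreover have "set (take (j - i) (drop i xs)) \<subseteq> set xs"
      by (auto dest: in_set_takeD in_set_dropD)
    ultimately show ?thesis using xs(2) by (auto simp: t_def)
  qed
  have setw: "set X \<subseteq> C" "set r \<subseteq> C" "set w \<subseteq> C"
    using setk(1)[of i] setk(2)[of j] setk(2)[of 0] y unfolding X_def r_def w_def by auto
  have [simp]: "X \<in> lists A" "t \<in> lists A" "r \<in> lists A" "w \<in> lists A"
    by (intro inA setw; simp add: t)+
  note [simp] = wpow_lists
  have XX: "E X = E ([] @ X @ t)" using ij(3) tj by (simp add: X_def t_def)
  let ?n = "stab T"
  define e where "e = wpow t (fact ?n)"
  have [simp]: "e \<in> lists A" by (simp add: e_def)
  have ee: "E e = E (e @ e)"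
    unfolding e_def using pow_stable[of t ?n "fact ?n"] fact_ge_self[of ?n]
    by (simp add: wpow_add)
  have "E (X @ e) = E X" unfolding e_def by (rule absorb(1)[OF XX]) simp_all
  then have we: "E w = E (X @ e @ (t @ r))" using rwl[of "X @ e" X "t @ r"] by (simp add: w)
  \<comment> \<open>The segment \<open>t\<close> between the two prefixes of equal value already
    contains every letter of \<open>w\<close>, so each of these letters lies J-above the power
    \<open>e\<close> of \<open>t\<close>.\<close>
  have "\<exists>p\<in>lists A. \<exists>q\<in>lists A. E e = E (p @ [a] @ q)" if "a \<in> set w" for a
  proof -
    have "a \<in> set t" using that t setw by auto
    then obtain t1 t2 where "t = t1 @ a # t2" by (auto simp: in_set_conv_decomp)
    then have "e = t1 @ [a] @ (t2 @ wpow t (fact ?n - 1))" "t1 \<in> lists A" "t2 \<in> lists A"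
      using \<open>t \<in> lists A\<close> by (simp_all add: e_def wpow_fact)
    then show ?thesis
      by - (rule bexI[of _ t1], rule bexI[of _ "t2 @ wpow t (fact ?n - 1)"], simp_all)
  qed
  then obtain p q where pq: "p \<in> lists A" "q \<in> lists A" "E e = E (p @ w @ q)"
    using idempotent_above_word[OF ee, of w] by auto
  have e3: "E e = E (e @ [] @ e)" using ee by simp
  \<comment> \<open>\<open>w\<close> lies J-below \<open>e\<close> by \<open>we\<close> and J-above
    it by \<open>pq\<close>, so the idempotent passes its regularity on to \<open>w\<close>.\<close>
  have "E w = E (w @ (q @ [] @ p) @ w)"
    by (rule regular_transfer[OF we pq(3) e3]) (use pq in simp_all)
  from grp[OF _ _ this n] show ?thesis using pq by (simp add: w_def[symmetric])
qed

end

section \<open>Green's relation J and membership in \<open>DS\<close>\<close>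

lemma principal_ideal_iff:
  assumes S: "is_sgrp S" and x: "x \<in> carrier S"
  shows "y \<in> principal_ideal S x \<longleftrightarrow>
    (\<exists>p\<in>lists (carrier S). \<exists>q\<in>lists (carrier S). Some y = mev S (\<lambda>x. x) (p @ [x] @ q))"
proof
  assume "y \<in> principal_ideal S x"
  then consider "y = x" | s where "s \<in> carrier S" "y = smult S s x"
    | s where "s \<in> carrier S" "y = smult S x s"
    | s t where "s \<in> carrier S" "t \<in> carrier S" "y = smult S (smult S s x) t"
    unfolding principal_ideal_def by blast
  then show "\<exists>p\<in>lists (carrier S). \<exists>q\<in>lists (carrier S). Some y = mev S (\<lambda>x. x) (p @ [x] @ q)"
  proof cases
    case 1
    then show ?thesis by (intro bexI[of _ "[]"]) auto
  next
    case (2 s)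
    then show ?thesis by (intro bexI[of _ "[s]"] bexI[of _ "[]"]) auto
  next
    case (3 s)
    then show ?thesis by (intro bexI[of _ "[]"] bexI[of _ "[s]"]) auto
  next
    case (4 s t)
    then show ?thesis using S x
      by (intro bexI[of _ "[s]"] bexI[of _ "[t]"]) (auto simp: sgrp_assoc)
  qed
next
  have id: "(\<lambda>x. x) \<in> carrier S \<rightarrow> carrier S" by simp
  assume "\<exists>p\<in>lists (carrier S). \<exists>q\<in>lists (carrier S). Some y = mev S (\<lambda>x. x) (p @ [x] @ q)"
  then obtain p q where pq: "p \<in> lists (carrier S)" "q \<in> lists (carrier S)"
    "Some y = mev S (\<lambda>x. x) (p @ [x] @ q)" by blast
  have "Some y = madd S (mev S (\<lambda>x. x) p) (madd S (Some x) (mev S (\<lambda>x. x) q))"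
    using pq x by (simp add: mev_append[OF S id])
  moreover have "mev S (\<lambda>x. x) p \<in> mcar S" "mev S (\<lambda>x. x) q \<in> mcar S"
    using mev_in[OF S id] pq by auto
  ultimately consider "y = x" | s where "s \<in> carrier S" "y = smult S s x"
    | s where "s \<in> carrier S" "y = smult S x s"
    | s t where "s \<in> carrier S" "t \<in> carrier S" "y = smult S (smult S s x) t"
    using S x by (auto simp: mcar_def sgrp_assoc)
  then show "y \<in> principal_ideal S x"
    unfolding principal_ideal_def by cases blast+
qed

lemma principal_ideal_mono:
  assumes S: "is_sgrp S" and x: "x \<in> carrier S" and y: "y \<in> carrier S" "y \<in> principal_ideal S x"
  shows "principal_ideal S y \<subseteq> principal_ideal S x"
proof
  have id: "(\<lambda>x. x) \<in> carrier S \<rightarrow> carrier S" by simp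
  fix z assume "z \<in> principal_ideal S y"
  then obtain p q where pq: "p \<in> lists (carrier S)" "q \<in> lists (carrier S)"
    "Some z = mev S (\<lambda>x. x) (p @ [y] @ q)" using principal_ideal_iff[OF S y(1)] by blast
  obtain p' q' where pq': "p' \<in> lists (carrier S)" "q' \<in> lists (carrier S)"
    "Some y = mev S (\<lambda>x. x) (p' @ [x] @ q')" using principal_ideal_iff[OF S x] y(2) by blast
  have "mev S (\<lambda>x. x) (p @ [y] @ q) = mev S (\<lambda>x. x) (p @ (p' @ [x] @ q') @ q)"
    by (rule mev_congr[OF S id]) (use pq pq' x y in auto)
  then have "Some z = mev S (\<lambda>x. x) ((p @ p') @ [x] @ (q' @ q))" using pq by simp
  then show "z \<in> principal_ideal S x"
    unfolding principal_ideal_iff[OF S x] using pq pq' by fastforce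
qed

lemma regular_elem_iff:
  "regular_elem S s \<longleftrightarrow> s \<in> carrier S \<and>
    (\<exists>t\<in>carrier S. mev S (\<lambda>x. x) [s] = mev S (\<lambda>x. x) ([s] @ [t] @ [s])) " if "is_sgrp S"
  using that by (auto simp: regular_elem_def sgrp_assoc)

lemma J_classD:
  assumes "is_sgrp S" "x \<in> carrier S" "y \<in> J_class S x"
  shows "y \<in> carrier S" "y \<in> principal_ideal S x" "x \<in> principal_ideal S y"
proof -
  have "principal_ideal S y = principal_ideal S x" "y \<in> carrier S"
    using assms(3) unfolding J_class_def by blast+
  moreover have "y \<in> principal_ideal S y" "x \<in> principal_ideal S x"
    by (simp_all add: principal_ideal_def)
  ultimately show "y \<in> carrier S" "y \<in> principal_ideal S x" "x \<in> principal_ideal S y"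
    by simp_all
qed

lemma J_classI:
  assumes "is_sgrp S" "x \<in> carrier S" "y \<in> carrier S" "y \<in> principal_ideal S x"
    "x \<in> principal_ideal S y"
  shows "y \<in> J_class S x"
  using assms principal_ideal_mono[of S x y] principal_ideal_mono[of S y x]
  by (auto simp: J_class_def)

text \<open>\<open>DS\<close> keeps s s in the J-class of a regular s, and then
  \<open>group_power\<close> applies. The elements themselves serve as the alphabet, so the fact can
  be moved to any evaluation.\<close>

lemma DS_group_eval_id:
  assumes "T \<in> DS" "s \<in> carrier T" "t \<in> carrier T" "smult T (smult T s t) s = s" "n \<ge> stab T"
  shows "mev T (\<lambda>x. x) (wpow [s] (fact n) @ [s]) = Some s"
proof -
  have T: "is_sgrp T" "finite (carrier T)" using assms(1) by (auto simp: DS_def fin_sgrps_def)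
  interpret finite_eval T "\<lambda>x. x" "carrier T" by unfold_locales (use T in auto)
  have r: "regular_elem T s" using assms unfolding regular_elem_def by metis
  have "s \<in> J_class T s" using assms by (simp add: J_class_def)
  then have "smult T s s \<in> J_class T s" using assms(1,2) r by (auto simp: DS_def)
  then have "s \<in> principal_ideal T (smult T s s)" "smult T s s \<in> carrier T"
    using J_classD[OF T(1) assms(2)] by auto
  then obtain p q where pq: "p \<in> lists (carrier T)" "q \<in> lists (carrier T)"
    "Some s = E (p @ [smult T s s] @ q)" using principal_ideal_iff[OF T(1)] by blast
  have "E (p @ [smult T s s] @ q) = E (p @ ([s] @ [s]) @ q)"
    by (rule rw) (use pq(1,2) assms(2) T in \<open>simp_all add: sgrp_closed\<close>)
  then have "E (wpow [s] (fact n) @ [s]) = E [s]"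
    by (intro group_power[where p = p and q = q]) (use pq assms in auto)
  then show ?thesis by simp
qed

lemma group_evalI:
  assumes T: "is_sgrp T" "finite (carrier T)" and f: "f \<in> A \<rightarrow> carrier T"
    and grp: "\<And>s t n. s \<in> carrier T \<Longrightarrow> t \<in> carrier T \<Longrightarrow> smult T (smult T s t) s = s \<Longrightarrow> n \<ge> stab T \<Longrightarrow>
      mev T (\<lambda>x. x) (wpow [s] (fact n) @ [s]) = Some s"
  shows "group_eval T f A"
proof -
  interpret finite_eval T f A by unfold_locales (use assms in auto)
  show ?thesis
  proof
    fix u t n
    assume u: "u \<in> lists A" and t: "t \<in> lists A" and E: "E u = E (u @ t @ u)" and n: "n \<ge> stab T"
    show "E (wpow u (fact n) @ u) = E u"
    proof (cases "u = []")
      case False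
      \<comment> \<open>The word \<open>t\<close> may be empty and then has no value in
        \<open>T\<close>; t u t is an inverse that is never empty.\<close>
      have "E u = E (u @ (t @ u @ t) @ u)"
        using E rwl[OF E, of "t @ u"] u t by simp
      moreover define t' where "t' = t @ u @ t"
      ultimately have t': "E u = E (u @ t' @ u)" "t' \<in> lists A" "t' \<noteq> []" using u t False by auto
      have 1: "ev T f u \<in> carrier T" "ev T f t' \<in> carrier T" using ev_in[OF T(1) f] u t' False by auto
      have "Some (ev T f u) = madd T (Some (ev T f u)) (madd T (Some (ev T f t')) (Some (ev T f u)))"
        using mev_append[OF T(1) f] u t' False mev_eq_Some append_in_lists_conv by metis
      then have "smult T (smult T (ev T f u) (ev T f t')) (ev T f u) = ev T f u"
        using 1 T by (simp add: sgrp_assoc)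
      then have "mev T (\<lambda>x. x) (wpow [ev T f u] (fact n) @ [ev T f u]) = Some (ev T f u)"
        using 1 n by (intro grp) auto
      \<comment> \<open>The one-letter alphabet \<open>unit\<close> turns powers of the word
        \<open>u\<close> into powers of its value.\<close>
      moreover have "E (concat (map (\<lambda>b. u) w)) = mev T (\<lambda>b. ev T f u) w" for w :: "unit list"
        by (rule mev_concat_map[OF T(1) f, of UNIV]) (use u False in auto)
      from this[of "wpow [()] (fact n) @ [()]"]
      have "E (wpow u (fact n) @ u) = mev T (\<lambda>x. x) (map (\<lambda>b. ev T f u) (wpow [()] (fact n) @ [()]))"
        unfolding mev_map by (simp add: concat_map_wpow)
      moreover have "map (\<lambda>b::unit. ev T f u) (wpow [()] (fact n) @ [()]) = wpow [ev T f u] (fact n) @ [ev T f u]"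
        by (simp add: wpow_def map_concat)
      ultimately show ?thesis using False by (simp add: mev_eq_Some)
    qed simp
  qed
qed

lemma DS_group_eval:
  assumes "T \<in> DS" "f \<in> A \<rightarrow> carrier T"
  shows "group_eval T f A"
  using assms DS_group_eval_id[OF assms(1)] by (intro group_evalI) (auto simp: DS_def fin_sgrps_def)

text \<open>Converse of \<open>DS_group_eval_id\<close>: if all regular elements lie in subgroups,
  \<open>product_above\<close> shows that a regular J-class is closed under products. The threshold
  \<open>N\<close> may depend on \<open>s\<close>, which suits semigroups known only through their
  images; \<open>group_power\<close> replaces it by \<open>stab T\<close>.\<close>

lemma DS_I:
  assumes "T \<in> fin_sgrps"
    and "\<And>s t. s \<in> carrier T \<Longrightarrow> t \<in> carrier T \<Longrightarrow> smult T (smult T s t) s = s \<Longrightarrow>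
      \<exists>N. \<forall>n\<ge>N. mev T (\<lambda>x. x) (wpow [s] (fact n) @ [s]) = Some s"
  shows "T \<in> DS"
proof -
  have T: "is_sgrp T" "finite (carrier T)" using assms(1) by (auto simp: fin_sgrps_def)
  interpret group_eval T "\<lambda>x. x" "carrier T"
  proof (rule group_evalI[OF T])
    interpret finite_eval T "\<lambda>x. x" "carrier T" by unfold_locales (use T in auto)
    fix s t n assume s: "s \<in> carrier T" and t: "t \<in> carrier T" "smult T (smult T s t) s = s"
      and n: "n \<ge> stab T"
    obtain N where N: "\<And>n. n \<ge> N \<Longrightarrow> mev T (\<lambda>x. x) (wpow [s] (fact n) @ [s]) = Some s"
      using assms(2)[OF s t] by blast
    define k where "k = max N (stab T)"
    \<comment> \<open>One equation s^(k!) s = s exhibits s s as a factor of s, and that is all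
      \<open>group_power\<close> asks for.\<close>
    have *: "E [s] = E (wpow [s] (fact k) @ [s] @ [])" using N[of k] by (simp add: k_def)
    have "E (wpow (wpow [s] (fact k - 1)) 1 @ [s,s]) = E [s]"
      using * by (simp add: wpow_fact2)
    then have "E [s] = E (wpow [s] (fact k - 1) @ ([s] @ [s]) @ [])" by simp
    from group_power[OF this _ _ _ n] s show "E (wpow [s] (fact n) @ [s]) = Some s"
      using wpow_lists[of "[s]" "carrier T"] by auto
  qed auto
  have reg: "\<exists>t\<in>lists (carrier T). E [y] = E ([y] @ t @ [y])"
    if x: "regular_elem T x" and y: "y \<in> J_class T x" for x y
  proof -
    have xc: "x \<in> carrier T" using x by (simp add: regular_elem_def)
    obtain t where t: "t \<in> carrier T" "E [x] = E ([x] @ [t] @ [x])"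
      using x regular_elem_iff[OF T(1)] by blast
    obtain p q where pq: "p \<in> lists (carrier T)" "q \<in> lists (carrier T)" "E [y] = E (p @ [x] @ q)"
      using J_classD[OF T(1) xc y] principal_ideal_iff[OF T(1) xc] by auto
    obtain p' q' where pq': "p' \<in> lists (carrier T)" "q' \<in> lists (carrier T)" "E [x] = E (p' @ [y] @ q')"
      using J_classD[OF T(1) xc y] principal_ideal_iff[OF T(1), of y] by auto
    have "E [y] = E ([y] @ (q' @ [t] @ p') @ [y])"
      by (rule regular_transfer[OF pq(3) pq'(3) t(2)]) (use pq pq' t xc J_classD[OF T(1) xc y] in auto)
    then show ?thesis using pq' t by (intro bexI[of _ "q' @ [t] @ p'"]) auto
  qed
  have "smult T y z \<in> J_class T x"
    if x: "x \<in> carrier T" "regular_elem T x" and y: "y \<in> J_class T x" and z: "z \<in> J_class T x" for x y z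
  proof -
    have yc: "y \<in> carrier T" and zc: "z \<in> carrier T"
      using y z J_classD[OF T(1) x(1)] by auto
    have yz: "y \<in> principal_ideal T z" "x \<in> principal_ideal T y" "y \<in> principal_ideal T x"
    proof -
      have "principal_ideal T y = principal_ideal T x" "principal_ideal T z = principal_ideal T x"
        using y z unfolding J_class_def by blast+
      moreover have "y \<in> principal_ideal T y" "x \<in> principal_ideal T x"
        by (simp_all add: principal_ideal_def)
      ultimately show "y \<in> principal_ideal T z" "x \<in> principal_ideal T y" "y \<in> principal_ideal T x"
        by simp_all
    qed
    obtain p q where pq: "p \<in> lists (carrier T)" "q \<in> lists (carrier T)" "E [y] = E (p @ [z] @ q)"
      using yz principal_ideal_iff[OF T(1) zc] by auto
    obtain t where t: "t\<in>lists (carrier T)" "E [y] = E ([y] @ t @ [y])"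
      using reg[OF x(2) y] by blast
    obtain c d where cd: "c \<in> lists (carrier T)" "d \<in> lists (carrier T)"
      "E [y] = E (c @ ([y] @ [z]) @ d)"
      using product_above[OF pq(3) t(2)] pq t yc zc by auto
    have w: "smult T y z \<in> carrier T" using T yc zc by (simp add: sgrp_closed)
    have "E (c @ ([y] @ [z]) @ d) = E (c @ [smult T y z] @ d)"
      by (rule rw) (use cd(1,2) yc zc w in simp_all)
    then have "y \<in> principal_ideal T (smult T y z)"
      unfolding principal_ideal_iff[OF T(1) w] using cd by auto
    moreover have "smult T y z \<in> principal_ideal T y"
      using zc by (auto simp: principal_ideal_def)
    ultimately have "smult T y z \<in> J_class T y" using J_classI[OF T(1) yc w] by simp
    then show ?thesis using y by (auto simp: J_class_def)
  qed
  then show ?thesis using assms(1) by (auto simp: DS_def)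
qed


section \<open>Sequences of words as pseudowords\<close>

text \<open>A pseudoword is represented by a sequence of words: its value in a finite semigroup is the
  value that the words of the sequence take almost everywhere with respect to the ultrafilter.\<close>

definition seqs :: "'a set \<Rightarrow> (nat \<Rightarrow> 'a list) set" where
  "seqs A = {u. \<forall>n. u n \<in> lists A}"

text \<open>Equality of the represented elements in the free pro-\<open>W\<close> monoid; for
  sequences of nonempty words over a finite nonempty alphabet this is
  \<open>limw_eq_iff\<close>.\<close>

definition weq :: "'b sgrp set \<Rightarrow> 'a set \<Rightarrow> (nat \<Rightarrow> 'a list) \<Rightarrow> (nat \<Rightarrow> 'a list) \<Rightarrow> bool" where
  "weq W A u v \<longleftrightarrow>
     (\<forall>T\<in>W. \<forall>f\<in>A \<rightarrow> carrier T. \<forall>\<^sub>F n in uf. mev T f (u n) = mev T f (v n))"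

lemma seqsD [dest]: "u \<in> seqs A \<Longrightarrow> u n \<in> lists A"
  by (simp add: seqs_def)

lemma seqsI [intro?]: "(\<And>n. u n \<in> lists A) \<Longrightarrow> u \<in> seqs A"
  by (simp add: seqs_def)

lemma seqs_append [simp]: "(\<lambda>n. u n @ v n) \<in> seqs A \<longleftrightarrow> u \<in> seqs A \<and> v \<in> seqs A"
  by (auto simp: seqs_def)

lemma seqs_Cons [simp]: "(\<lambda>n. a # v n) \<in> seqs A \<longleftrightarrow> a \<in> A \<and> v \<in> seqs A"
  by (auto simp: seqs_def)

lemma seqs_Nil [simp]: "(\<lambda>n. []) \<in> seqs A"
  by (auto simp: seqs_def)

lemma seqs_wpow [simp]: "u \<in> seqs A \<Longrightarrow> (\<lambda>n. wpow (u n) (k n)) \<in> seqs A"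
  by (auto simp: seqs_def intro!: wpow_lists simp del: in_lists_conv_set)

lemma fin_sgrpsD: "T \<in> fin_sgrps \<Longrightarrow> is_sgrp T" "T \<in> fin_sgrps \<Longrightarrow> finite (carrier T)"
  by (auto simp: fin_sgrps_def)

lemma finite_eval_fin: "T \<in> fin_sgrps \<Longrightarrow> f \<in> A \<rightarrow> carrier T \<Longrightarrow> finite_eval T f A"
  by unfold_locales (auto simp: fin_sgrps_def)

lemma weq_refl [simp]: "weq W A u u"
  by (simp add: weq_def)

lemma weq_sym: "weq W A u v \<Longrightarrow> weq W A v u"
  by (simp add: weq_def eq_commute)

lemma weq_trans [trans]:
  assumes "weq W A u v" "weq W A v w"
  shows "weq W A u w"
  unfolding weq_def
proof (intro ballI)
  fix T f assume "T \<in> W" "f \<in> A \<rightarrow> carrier T"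
  then have "\<forall>\<^sub>F n in uf. mev T f (u n) = mev T f (v n)" "\<forall>\<^sub>F n in uf. mev T f (v n) = mev T f (w n)"
    using assms by (auto simp: weq_def)
  then show "\<forall>\<^sub>F n in uf. mev T f (u n) = mev T f (w n)" by eventually_elim simp
qed

lemma weq_mono: "weq W A u v \<Longrightarrow> W' \<subseteq> W \<Longrightarrow> weq W' A u v"
  by (auto simp: weq_def)

lemma weq_ae: "\<forall>\<^sub>F n in uf. u n = v n \<Longrightarrow> weq W A u v"
  unfolding weq_def by (auto elim: eventually_mono)

lemma weq_cong:
  assumes "W \<subseteq> fin_sgrps" "weq W A u v" "u \<in> seqs A" "v \<in> seqs A" "x \<in> seqs A" "y \<in> seqs A"
  shows "weq W A (\<lambda>n. x n @ u n @ y n) (\<lambda>n. x n @ v n @ y n)"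
  unfolding weq_def
proof (intro ballI)
  fix T f assume T: "T \<in> W" and f: "f \<in> A \<rightarrow> carrier T"
  then have "\<forall>\<^sub>F n in uf. mev T f (u n) = mev T f (v n)" using assms by (auto simp: weq_def)
  then show "\<forall>\<^sub>F n in uf. mev T f (x n @ u n @ y n) = mev T f (x n @ v n @ y n)"
  proof eventually_elim
    case (elim n)
    show ?case by (rule mev_congr[OF _ f elim]) (use assms T fin_sgrpsD in blast)+
  qed
qed

lemma weq_congl:
  assumes "W \<subseteq> fin_sgrps" "weq W A u v" "u \<in> seqs A" "v \<in> seqs A" "y \<in> seqs A"
  shows "weq W A (\<lambda>n. u n @ y n) (\<lambda>n. v n @ y n)"
  using weq_cong[OF assms(1-4), of "\<lambda>n. []" y] assms(5) by simp

lemma weq_congr: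
  assumes "W \<subseteq> fin_sgrps" "weq W A u v" "u \<in> seqs A" "v \<in> seqs A" "x \<in> seqs A"
  shows "weq W A (\<lambda>n. x n @ u n) (\<lambda>n. x n @ v n)"
  using weq_cong[OF assms(1-4), of x "\<lambda>n. []"] assms(5) by simp

lemma weq_cong2:
  assumes "W \<subseteq> fin_sgrps" "weq W A u v" "weq W A u' v'" "u \<in> seqs A" "v \<in> seqs A" "u' \<in> seqs A"
    "v' \<in> seqs A"
  shows "weq W A (\<lambda>n. u n @ u' n) (\<lambda>n. v n @ v' n)"
  using weq_trans[OF weq_congl[OF assms(1,2,4,5,6)] weq_congr[OF assms(1,3,6,7,5)]] .

lemma ae_seqs:
  assumes "\<forall>\<^sub>F n in uf. \<exists>w\<in>lists A. P w n"
  shows "\<exists>s\<in>seqs A. \<forall>\<^sub>F n in uf. P (s n) n"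
  using ae_choice[OF assms, of "[]"] by (auto simp: seqs_def)

lemma append_eq_append_Cons:
  "m @ w = x @ a # y \<longleftrightarrow> (\<exists>s. m = x @ a # s \<and> y = s @ w) \<or> (\<exists>s. x = m @ s \<and> w = s @ a # y)"
  by (auto simp: append_eq_append_conv2 append_eq_Cons_conv Cons_eq_append_conv)

lemma append_Cons_eq_append_Cons:
  "x @ a # y = x' @ b # y' \<longleftrightarrow> (x = x' \<and> a = b \<and> y = y') \<or>
    (\<exists>s. x' = x @ a # s \<and> y = s @ b # y') \<or> (\<exists>s. x = x' @ b # s \<and> y' = s @ a # y)"
  by (auto simp: append_eq_append_conv2 append_eq_Cons_conv Cons_eq_append_conv)

text \<open>Equidivisibility of the free monoid for sequences: at every n the marked letter lies on
  one side of the cut, and the ultrafilter selects the side. \<open>ae_compare\<close> does the same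
  for two marked letters.\<close>

lemma ae_split:
  assumes eq: "\<forall>\<^sub>F n in uf. m n @ w n = x n @ a # y n" and l: "m \<in> seqs A" "w \<in> seqs A"
  obtains (left) s where "s \<in> seqs A" "\<forall>\<^sub>F n in uf. m n = x n @ a # s n" "\<forall>\<^sub>F n in uf. y n = s n @ w n"
  | (right) s where "s \<in> seqs A" "\<forall>\<^sub>F n in uf. x n = m n @ s n" "\<forall>\<^sub>F n in uf. w n = s n @ a # y n"
proof -
  have "\<forall>\<^sub>F n in uf. (\<exists>s\<in>lists A. m n = x n @ a # s \<and> y n = s @ w n) \<or>
      (\<exists>s\<in>lists A. x n = m n @ s \<and> w n = s @ a # y n)"
    using eq
  proof eventually_elim
    case (elim n)
    have "m n \<in> lists A" "w n \<in> lists A" using l by auto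
    moreover from elim have "(\<exists>s. m n = x n @ a # s \<and> y n = s @ w n) \<or>
      (\<exists>s. x n = m n @ s \<and> w n = s @ a # y n)" unfolding append_eq_append_Cons .
    ultimately show ?case by (metis append_in_lists_conv Cons_in_lists_iff)
  qed
  then show thesis
    unfolding ae_disj
    using ae_seqs[of A "\<lambda>s n. m n = x n @ a # s \<and> y n = s @ w n"]
      ae_seqs[of A "\<lambda>s n. x n = m n @ s \<and> w n = s @ a # y n"] left right
    by (auto simp: eventually_conj_iff)
qed

lemma ae_compare:
  assumes eq: "\<forall>\<^sub>F n in uf. x n @ a # y n = x' n @ b # y' n"
    and l: "x \<in> seqs A" "y \<in> seqs A" "x' \<in> seqs A" "y' \<in> seqs A"
  obtains (same) "a = b" "\<forall>\<^sub>F n in uf. x n = x' n" "\<forall>\<^sub>F n in uf. y n = y' n"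
  | (less) s where "s \<in> seqs A" "\<forall>\<^sub>F n in uf. x' n = x n @ a # s n" "\<forall>\<^sub>F n in uf. y n = s n @ b # y' n"
  | (greater) s where "s \<in> seqs A" "\<forall>\<^sub>F n in uf. x n = x' n @ b # s n" "\<forall>\<^sub>F n in uf. y' n = s n @ a # y n"
proof -
  have "\<forall>\<^sub>F n in uf. (x n = x' n \<and> a = b \<and> y n = y' n) \<or>
      (\<exists>s\<in>lists A. x' n = x n @ a # s \<and> y n = s @ b # y' n) \<or>
      (\<exists>s\<in>lists A. x n = x' n @ b # s \<and> y' n = s @ a # y n)"
    using eq
  proof eventually_elim
    case (elim n)
    have "x n \<in> lists A" "y n \<in> lists A" "x' n \<in> lists A" "y' n \<in> lists A" using l by auto
    with elim[unfolded append_Cons_eq_append_Cons] show ?case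
      by (metis append_in_lists_conv Cons_in_lists_iff)
  qed
  then show thesis
    unfolding ae_disj
    using ae_seqs[of A "\<lambda>s n. x' n = x n @ a # s \<and> y n = s @ b # y' n"]
      ae_seqs[of A "\<lambda>s n. x n = x' n @ b # s \<and> y' n = s @ a # y n"] same less greater
    by (auto simp: eventually_conj_iff)
qed


section \<open>Multiregular sequences\<close>

text \<open>Products of elements \<open>(r z)\<^sup>\<omega> r\<close>: these represent exactly the finite products of
  regular pseudowords, together with the empty word.\<close>

inductive_set mreg :: "'a set \<Rightarrow> (nat \<Rightarrow> 'a list) set" for A where
  Nil: "(\<lambda>n. []) \<in> mreg A"
| Cons: "r \<in> seqs A \<Longrightarrow> (\<forall>n. r n \<noteq> []) \<Longrightarrow> z \<in> seqs A \<Longrightarrow> m \<in> mreg A \<Longrightarrow>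
    (\<lambda>n. (wpow (r n @ z n) (fact n) @ r n) @ m n) \<in> mreg A"

lemma mreg_seqs: "m \<in> mreg A \<Longrightarrow> m \<in> seqs A"
  by (induction rule: mreg.induct) auto

lemma mreg_append: "m \<in> mreg A \<Longrightarrow> m' \<in> mreg A \<Longrightarrow> (\<lambda>n. m n @ m' n) \<in> mreg A"
proof (induction rule: mreg.induct)
  case (Cons r z m)
  then have "(\<lambda>n. (wpow (r n @ z n) (fact n) @ r n) @ (m n @ m' n)) \<in> mreg A"
    by (intro mreg.Cons) auto
  then show ?case by simp
qed simp

lemma mreg_single:
  "r \<in> seqs A \<Longrightarrow> (\<forall>n. r n \<noteq> []) \<Longrightarrow> z \<in> seqs A \<Longrightarrow> (\<lambda>n. wpow (r n @ z n) (fact n) @ r n) \<in> mreg A"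
  using mreg.Cons[OF _ _ _ mreg.Nil, of r A z] by simp

lemma mreg_cases: "m \<in> mreg A \<Longrightarrow> m = (\<lambda>n. []) \<or> (\<forall>n. m n \<noteq> [])"
  by (induction rule: mreg.induct) auto

text \<open>In Green's terms: x a is R-equivalent to x in the free pro-\<open>W\<close> monoid.
  \<open>Labsorb\<close> is the dual for L.\<close>

definition Rabsorb :: "'b sgrp set \<Rightarrow> 'a set \<Rightarrow> (nat \<Rightarrow> 'a list) \<Rightarrow> 'a \<Rightarrow> bool" where
  "Rabsorb W A x a \<longleftrightarrow> (\<exists>z\<in>seqs A. weq W A x (\<lambda>n. x n @ a # z n))"

definition Labsorb :: "'b sgrp set \<Rightarrow> 'a set \<Rightarrow> 'a \<Rightarrow> (nat \<Rightarrow> 'a list) \<Rightarrow> bool" where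
  "Labsorb W A a y \<longleftrightarrow> (\<exists>z\<in>seqs A. weq W A y (\<lambda>n. z n @ a # y n))"

lemma Rabsorb_mono: "Rabsorb W A x a \<Longrightarrow> W' \<subseteq> W \<Longrightarrow> Rabsorb W' A x a"
  unfolding Rabsorb_def by (blast intro: weq_mono)

lemma Labsorb_mono: "Labsorb W A a x \<Longrightarrow> W' \<subseteq> W \<Longrightarrow> Labsorb W' A a x"
  unfolding Labsorb_def by (blast intro: weq_mono)

lemma Rabsorb_prepend:
  assumes W: "W \<subseteq> fin_sgrps" and R: "Rabsorb W A t a" and x: "weq W A x (\<lambda>n. b n @ t n)"
    and l: "t \<in> seqs A" "b \<in> seqs A" "x \<in> seqs A" "a \<in> A"
  shows "Rabsorb W A x a"
proof -
  obtain z where z: "z \<in> seqs A" "weq W A t (\<lambda>n. t n @ a # z n)" using R by (auto simp: Rabsorb_def)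
  have "weq W A x (\<lambda>n. b n @ t n)" by fact
  also have "weq W A \<dots> (\<lambda>n. b n @ t n @ a # z n)"
    by (rule weq_congr[OF W z(2)]) (use l z in auto)
  also have "weq W A \<dots> (\<lambda>n. x n @ a # z n)"
    using weq_congl[OF W weq_sym[OF x], of "\<lambda>n. a # z n"] l z by simp
  finally show ?thesis using z by (auto simp: Rabsorb_def)
qed

lemma Labsorb_append:
  assumes W: "W \<subseteq> fin_sgrps" and L: "Labsorb W A a t" and x: "weq W A x (\<lambda>n. t n @ b n)"
    and l: "t \<in> seqs A" "b \<in> seqs A" "x \<in> seqs A" "a \<in> A"
  shows "Labsorb W A a x"
proof -
  obtain z where z: "z \<in> seqs A" "weq W A t (\<lambda>n. z n @ a # t n)" using L by (auto simp: Labsorb_def)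
  have "weq W A x (\<lambda>n. t n @ b n)" by fact
  also have "weq W A \<dots> (\<lambda>n. (z n @ a # t n) @ b n)"
    by (rule weq_congl[OF W z(2)]) (use l z in auto)
  also have "weq W A \<dots> (\<lambda>n. z n @ a # x n)"
    using weq_congr[OF W weq_sym[OF x], of "\<lambda>n. z n @ [a]"] l z by (simp add: seqs_def)
  finally show ?thesis using z by (auto simp: Labsorb_def)
qed

text \<open>\<open>j\<close> counts the whole periods before the marked letter. As r is a prefix of
  s = r z, the letter has a place in a period even when it lies in the final r; such an occurrence
  gets j = N, and nothing is claimed about y.\<close>

lemma position_in_power:
  assumes "wpow s N @ r = x @ a # y" "s = r @ z"
  shows "\<exists>j p q. x = wpow s j @ p \<and> s = p @ a # q \<and> (j < N \<longrightarrow> y = q @ wpow s (N - 1 - j) @ r)"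
  using assms(1)
proof (induction N arbitrary: x)
  case 0
  then show ?case using assms(2) by (intro exI[of _ 0] exI[of _ x] exI[of _ "y @ z"]) simp
next
  case (Suc N)
  then have "s @ (wpow s N @ r) = x @ a # y" by (simp add: wpow_Suc)
  then consider q where "s = x @ a # q" "y = q @ wpow s N @ r"
    | x' where "x = s @ x'" "wpow s N @ r = x' @ a # y"
    unfolding append_eq_append_Cons by blast
  then show ?case
  proof cases
    case 1
    then show ?thesis by (intro exI[of _ 0]) auto
  next
    case (2 x')
    from Suc.IH[OF 2(2)] obtain j p q where
      "x' = wpow s j @ p" "s = p @ a # q" "j < N \<longrightarrow> y = q @ wpow s (N - 1 - j) @ r" by blast
    then have "x = wpow s (Suc j) @ p \<and> s = p @ a # q \<and> (Suc j < Suc N \<longrightarrow> y = q @ wpow s (Suc N - 1 - Suc j) @ r)"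
      using 2 by (simp add: wpow_Suc)
    then show ?thesis by blast
  qed
qed

text \<open>If fewer than n of the n! periods precede a position, this leaves at least n complete
  periods after it.\<close>

lemma fact_ge_double: "n \<ge> 3 \<Longrightarrow> 2 * n \<le> (fact n :: nat)"
proof (induction n rule: dec_induct)
  case (step n)
  then have "2 * Suc n \<le> fact n * Suc n" by (intro mult_right_mono) auto
  then show ?case by (simp add: algebra_simps)
qed (simp add: fact_numeral)

text \<open>Almost everywhere at least n periods precede the marked letter, or almost everywhere at
  least n complete ones follow it. On that side n! more periods can be inserted unnoticed by any
  fixed finite semigroup, and the inserted part repeats the marked letter.\<close>

lemma position_in_block:
  assumes eq: "\<forall>\<^sub>F n in uf. wpow (r n @ z n) (fact n) @ r n = x n @ a # y n"
    and l: "r \<in> seqs A" "z \<in> seqs A" "x \<in> seqs A" "y \<in> seqs A" "a \<in> A"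
  shows "Rabsorb fin_sgrps A x a \<or> Labsorb fin_sgrps A a y"
proof -
  define s where "s n = r n @ z n" for n
  have s: "s \<in> seqs A" using l by (simp add: s_def[abs_def])
  let ?P = "\<lambda>t n. case t of (j, p, q) \<Rightarrow> x n = wpow (s n) j @ p \<and> s n = p @ a # q \<and>
    (j < fact n \<longrightarrow> y n = q @ wpow (s n) (fact n - 1 - j) @ r n)"
  have "\<forall>\<^sub>F n in uf. \<exists>t\<in>UNIV \<times> lists A \<times> lists A. ?P t n"
    using eq
  proof eventually_elim
    case (elim n)
    obtain j p q where jpq: "?P (j, p, q) n"
      using position_in_power[OF elim refl] by (auto simp: s_def)
    then have "s n = p @ a # q" by simp
    moreover have "s n \<in> lists A" using s by auto
    ultimately have "p \<in> lists A" "q \<in> lists A" by auto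
    then show ?case using jpq by (intro bexI[of _ "(j, p, q)"]) auto
  qed
  from ae_choice[OF this, of "(0, [], [])"] obtain t where
    t: "\<And>n. t n \<in> UNIV \<times> lists A \<times> lists A" "\<forall>\<^sub>F n in uf. ?P (t n) n" by auto
  define j p q where "j n = fst (t n)" and "p n = fst (snd (t n))" and "q n = snd (snd (t n))" for n
  have pq: "p \<in> seqs A" "q \<in> seqs A" using t(1) by (auto simp: p_def q_def seqs_def mem_Times_iff)
  have jpq: "\<forall>\<^sub>F n in uf. ?P (j n, p n, q n) n" using t(2) by (simp add: j_def p_def q_def)
  \<comment> \<open>\<open>c\<close> is the text between a marked letter and its copy n! periods
    further on.\<close>
  define c where "c n = q n @ wpow (s n) (fact n - 1) @ p n" for n
  have c: "c \<in> seqs A" unfolding c_def[abs_def] using pq s by simp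
  have sl: "s n \<in> lists A" "p n \<in> lists A" "q n \<in> lists A" "r n \<in> lists A" for n
    using s pq l by auto
  have "(\<forall>\<^sub>F n in uf. n \<le> j n) \<or> (\<forall>\<^sub>F n in uf. j n < n)"
    unfolding ae_disj[symmetric] by (rule always_eventually) auto
  then show ?thesis
  proof
    assume j: "\<forall>\<^sub>F n in uf. n \<le> j n"
    have "weq fin_sgrps A x (\<lambda>n. x n @ a # c n)"
      unfolding weq_def
    proof (intro ballI)
      fix T :: "nat sgrp" and f assume T: "T \<in> fin_sgrps" and f: "f \<in> A \<rightarrow> carrier T"
      interpret finite_eval T f A using T f by (rule finite_eval_fin)
      have "\<forall>\<^sub>F n in uf. n \<ge> stab T" by (rule ae_ge)
      with jpq j show "\<forall>\<^sub>F n in uf. E (x n) = E (x n @ a # c n)"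
      proof eventually_elim
        case (elim n)
        have "x n @ a # c n = wpow (s n) (j n) @ (p n @ a # q n) @ wpow (s n) (fact n - 1) @ p n"
          using elim by (simp add: c_def)
        also have "\<dots> = wpow (s n) (j n + fact n) @ p n"
          using elim wpow_fact[of "s n" n] by (simp add: wpow_add)
        finally have *: "x n @ a # c n = wpow (s n) (j n + fact n) @ p n" .
        have "E (wpow (s n) (j n + fact n) @ p n) = E (wpow (s n) (j n) @ p n)"
          by (rule rwl[OF pow_stable]) (intro sl wpow_lists | use elim in simp)+
        then show ?case using elim * by simp
      qed
    qed
    then show ?thesis using c by (auto simp: Rabsorb_def)
  next
    assume j: "\<forall>\<^sub>F n in uf. j n < n"
    have "weq fin_sgrps A y (\<lambda>n. c n @ a # y n)"
      unfolding weq_def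
    proof (intro ballI)
      fix T :: "nat sgrp" and f assume T: "T \<in> fin_sgrps" and f: "f \<in> A \<rightarrow> carrier T"
      interpret finite_eval T f A using T f by (rule finite_eval_fin)
      have "\<forall>\<^sub>F n in uf. n \<ge> stab T + 3" by (rule ae_ge)
      with jpq j show "\<forall>\<^sub>F n in uf. E (y n) = E (c n @ a # y n)"
      proof eventually_elim
        case (elim n)
        define k where "k = fact n - 1 - j n"
        have "2 * n \<le> fact n" using elim by (intro fact_ge_double) simp
        then have k: "j n < fact n" "k \<ge> stab T" using elim by (simp_all add: k_def)
        then have y: "y n = q n @ wpow (s n) k @ r n" using elim by (simp add: k_def)
        have "c n @ a # y n = q n @ wpow (s n) (fact n - 1) @ (p n @ a # q n) @ wpow (s n) k @ r n"
          using y by (simp add: c_def)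
        also have "\<dots> = q n @ wpow (s n) (k + fact n) @ r n"
          using elim wpow_fact2[of "s n" n] by (simp add: add.commute[of k] wpow_add)
        finally have *: "c n @ a # y n = q n @ wpow (s n) (k + fact n) @ r n" .
        have "E (q n @ wpow (s n) (k + fact n) @ r n) = E (q n @ wpow (s n) k @ r n)"
          by (rule rw[OF pow_stable]) (intro sl wpow_lists | use elim k in simp)+
        then show ?case unfolding * by (simp only: y)
      qed
    qed
    then show ?thesis using c by (auto simp: Labsorb_def)
  qed
qed

text \<open>Proved over all finite semigroups, so it holds modulo every \<open>V\<close>. Both
  directions of the theorem rest on it: it keeps the marked letter of a bideterministic product out
  of multiregular factors.\<close>

lemma position_in_mreg:
  assumes "m \<in> mreg A" "\<forall>\<^sub>F n in uf. m n = x n @ a # y n" "x \<in> seqs A" "y \<in> seqs A" "a \<in> A"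
  shows "Rabsorb fin_sgrps A x a \<or> Labsorb fin_sgrps A a y"
  using assms
proof (induction arbitrary: x y rule: mreg.induct)
  case Nil
  then have "\<forall>\<^sub>F n in uf. False" by (auto elim: eventually_mono)
  then show ?case by simp
next
  case (Cons r z m)
  let ?B = "\<lambda>n. wpow (r n @ z n) (fact n) @ r n"
  have B: "?B \<in> seqs A" and m: "m \<in> seqs A" using Cons mreg_seqs by auto
  from Cons.prems(1) B m show ?case
  proof (cases rule: ae_split)
    case (left s)
    have "Rabsorb fin_sgrps A x a \<or> Labsorb fin_sgrps A a s"
      by (rule position_in_block[OF left(2)]) (use Cons left in auto)
    then show ?thesis
      using Labsorb_append[OF order_refl _ weq_ae[OF left(3)] left(1) m] Cons.prems by blast
  next
    case (right s)
    have "Rabsorb fin_sgrps A s a \<or> Labsorb fin_sgrps A a y"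
      by (rule Cons.IH[OF right(3)]) (use Cons right in auto)
    then show ?thesis
      using Rabsorb_prepend[OF order_refl _ weq_ae[OF right(2)] right(1) B] Cons.prems by blast
  qed
qed

lemma mreg_subst:
  assumes "m \<in> mreg B" "\<And>b. b \<in> B \<Longrightarrow> \<sigma> b \<in> lists A - {[]}"
  shows "(\<lambda>n. concat (map \<sigma> (m n))) \<in> mreg A"
  using assms(1)
proof (induction rule: mreg.induct)
  case Nil
  then show ?case by (simp add: mreg.Nil)
next
  case (Cons r z m)
  have l: "(\<lambda>n. concat (map \<sigma> (u n))) \<in> seqs A" if u: "u \<in> seqs B" for u
  proof
    fix n
    have "set (u n) \<subseteq> B" using u by (auto simp: seqs_def)
    then show "concat (map \<sigma> (u n)) \<in> lists A" using assms(2) by (fastforce simp: in_lists_conv_set)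
  qed
  have "\<forall>n. concat (map \<sigma> (r n)) \<noteq> []"
  proof
    fix n
    obtain b w where "r n = b # w" using Cons(2) by (metis neq_Nil_conv)
    moreover have "b \<in> B" using Cons(1) \<open>r n = b # w\<close> by (metis seqsD Cons_in_lists_iff)
    ultimately show "concat (map \<sigma> (r n)) \<noteq> []" using assms(2) by auto
  qed
  from mreg.Cons[OF l[OF Cons(1)] this l[OF Cons(3)] Cons.IH]
  show ?case by (simp add: concat_map_wpow)
qed


section \<open>Factorisations into letters and multiregular sequences\<close>

text \<open>Since \<open>mreg\<close> contains the empty sequence and is closed under products,
  letters and multiregular factors can alternate strictly, and \<open>k\<close>, the number of
  letters, alone measures the factorisation.\<close>

inductive Fac :: "'a set \<Rightarrow> nat \<Rightarrow> (nat \<Rightarrow> 'a list) \<Rightarrow> bool" for A where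
  zero: "m \<in> mreg A \<Longrightarrow> Fac A 0 m"
| Suc: "m \<in> mreg A \<Longrightarrow> a \<in> A \<Longrightarrow> Fac A k x \<Longrightarrow> Fac A (Suc k) (\<lambda>n. m n @ a # x n)"

lemma Fac_seqs: "Fac A k u \<Longrightarrow> u \<in> seqs A"
  by (induction rule: Fac.induct) (auto dest: mreg_seqs)

lemma Fac_prepend: "Fac A k u \<Longrightarrow> m \<in> mreg A \<Longrightarrow> Fac A k (\<lambda>n. m n @ u n)"
proof (induction rule: Fac.induct)
  case (zero m')
  then show ?case by (auto intro: Fac.zero mreg_append)
next
  case (Suc m' a k x)
  then show ?case using Fac.Suc[OF mreg_append[of m A m']] by simp
qed

lemma Fac_join: "Fac A i x \<Longrightarrow> a \<in> A \<Longrightarrow> Fac A j y \<Longrightarrow> Fac A (Suc (i + j)) (\<lambda>n. x n @ a # y n)"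
proof (induction rule: Fac.induct)
  case (zero m)
  then show ?case by (auto intro: Fac.Suc)
next
  case (Suc m b k x)
  then show ?case using Fac.Suc[of m A b "Suc (k + j)" "\<lambda>n. x n @ a # y n"] by simp
qed

lemma Fac_append: "Fac A k u \<Longrightarrow> m \<in> mreg A \<Longrightarrow> Fac A k (\<lambda>n. u n @ m n)"
proof (induction rule: Fac.induct)
  case (zero m')
  then show ?case by (auto intro: Fac.zero mreg_append)
next
  case (Suc m' a k x)
  then show ?case using Fac.Suc[of m' A a k "\<lambda>n. x n @ m n"] by simp
qed

lemma Fac_snoc:
  "Fac A k u \<Longrightarrow> k = Suc i \<Longrightarrow>
   \<exists>x a m. Fac A i x \<and> a \<in> A \<and> m \<in> mreg A \<and> u = (\<lambda>n. x n @ a # m n)"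
proof (induction arbitrary: i rule: Fac.induct)
  case (Suc m a k x)
  show ?case
  proof (cases k)
    case 0
    then have "x \<in> mreg A" using Suc.hyps(3) by (auto elim: Fac.cases)
    then show ?thesis using Suc 0 by (auto intro: Fac.zero)
  next
    case (Suc k')
    then obtain x' b m' where *: "Fac A k' x'" "b \<in> A" "m' \<in> mreg A" "x = (\<lambda>n. x' n @ b # m' n)"
      using Suc.IH by blast
    have "Fac A (Suc k') (\<lambda>n. m n @ a # x' n)" using Suc.hyps(1,2) *(1) by (rule Fac.Suc)
    then show ?thesis
      using * Suc Suc.prems by (intro exI[of _ "\<lambda>n. m n @ a # x' n"] exI[of _ b] exI[of _ m']) simp
  qed
qed simp

text \<open>\<open>N\<close> bounds the number of letters needed to cut the word into pieces each of
  which misses a letter of \<open>C\<close>.\<close>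

primrec short :: "'a set \<Rightarrow> nat \<Rightarrow> 'a list \<Rightarrow> bool" where
  "short C 0 w \<longleftrightarrow> set w \<subset> C"
| "short C (Suc N) w \<longleftrightarrow> set w \<subset> C \<or> (\<exists>a\<in>C. \<exists>p\<in>lists C. \<exists>v\<in>lists C. w = p @ a # v \<and> set p \<subset> C \<and> short C N v)"

lemma first_full_prefix:
  "w \<noteq> [] \<Longrightarrow> \<exists>p a v. w = p @ a # v \<and> set p \<subset> set w \<and> insert a (set p) = set w"
proof (induction w rule: rev_induct)
  case (snoc b w)
  show ?case
  proof (cases "set w = insert b (set w)")
    case True
    then have "w \<noteq> []" by auto
    with snoc.IH obtain p a v where "w = p @ a # v" "set p \<subset> set w" "insert a (set p) = set w" by blast
    then show ?thesis using True by (intro exI[of _ p] exI[of _ a] exI[of _ "v @ [b]"]) auto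
  next
    case False
    then show ?thesis by (intro exI[of _ w] exI[of _ b] exI[of _ "[]"]) auto
  qed
qed simp

text \<open>Greedy cutting: repeatedly split off the shortest prefix of full content. Either this
  succeeds \<open>N\<close> times, or the last letters of the prefixes found so far witness
  \<open>short\<close>.\<close>

lemma blocks_or_short:
  assumes "set w \<subseteq> C"
  shows "(\<exists>xs y. w = concat xs @ y \<and> length xs = N \<and> (\<forall>x\<in>set xs. set x = C) \<and> set y \<subseteq> C) \<or> short C N w"
  using assms
proof (induction N arbitrary: w)
  case 0
  then show ?case by - (rule disjI1, rule exI[of _ "[]"], rule exI[of _ w], simp)
next
  case (Suc N)
  consider "set w \<subset> C" | "C = {}" "w = []" | "w \<noteq> []" "set w = C"
    using Suc.prems by (cases "set w = C"; cases "w = []") auto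
  then show ?case
  proof cases
    case 1
    then show ?thesis by simp
  next
    case 2
    then show ?thesis
      \<comment> \<open>For empty \<open>C\<close> no word is \<open>short\<close>, but empty blocks
        have full content.\<close>
      by - (rule disjI1, rule exI[of _ "replicate (Suc N) []"], rule exI[of _ "[]"], simp)
  next
    case 3
    then obtain p a v where p: "w = p @ a # v" "set p \<subset> C" "insert a (set p) = C"
      using first_full_prefix[OF 3(1)] unfolding 3(2) by metis
    then have "set v \<subseteq> C" using Suc.prems by auto
    from Suc.IH[OF this] show ?thesis
    proof
      assume "\<exists>xs y. v = concat xs @ y \<and> length xs = N \<and> (\<forall>x\<in>set xs. set x = C) \<and> set y \<subseteq> C"
      then obtain xs y where xy: "v = concat xs @ y \<and> length xs = N \<and> (\<forall>x\<in>set xs. set x = C) \<and> set y \<subseteq> C"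
        by (elim exE)
      then have "w = concat ((p @ [a]) # xs) @ y" "length ((p @ [a]) # xs) = Suc N"
        "\<forall>x\<in>set ((p @ [a]) # xs). set x = C" using p by auto
      then show ?thesis using xy by metis
    next
      assume "short C N v"
      moreover have "a \<in> C" "p \<in> lists C" "v \<in> lists C" using p \<open>set v \<subseteq> C\<close> by auto
      ultimately have "short C (Suc N) w" using p(1,2) unfolding short.simps by blast
      then show ?thesis ..
    qed
  qed
qed

text \<open>Either almost all words have unboundedly many factors of full content, and then the
  sequence is regular modulo \<open>DS\<close>, or a bounded number of letters cuts it into factors of smaller
  content.\<close>

lemma DS_factorization:
  assumes "finite C" "C \<subseteq> A" "u \<in> seqs C"
  shows "\<exists>k v. Fac A k v \<and> weq DS A u v"
  using assms
proof (induction C arbitrary: u rule: finite_psubset_induct)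
  case (psubset C)
  have DSf: "DS \<subseteq> fin_sgrps" by (auto simp: DS_def)
  have CA: "w \<in> seqs A" if "w \<in> seqs C" for w
    using that psubset.prems(1) by (auto simp: seqs_def)
  have small: "\<exists>k v. Fac A k v \<and> weq DS A w v" if w: "\<forall>\<^sub>F n in uf. set (w n) \<subset> C" for w
  proof -
    have "\<forall>\<^sub>F n in uf. \<exists>D\<in>{D. D \<subset> C}. set (w n) \<subseteq> D" using w by eventually_elim auto
    \<comment> \<open>There are finitely many proper subsets of \<open>C\<close>, so a single one
      bounds the content almost everywhere, and the induction hypothesis applies to it.\<close>
    then obtain D where D: "D \<subset> C" "\<forall>\<^sub>F n in uf. set (w n) \<subseteq> D"
      using ae_bex_finite[of "{D. D \<subset> C}" "\<lambda>D n. set (w n) \<subseteq> D"] psubset.hyps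
        finite_subset[of "{D. D \<subset> C}" "Pow C"] by auto
    define w' where "w' n = (if set (w n) \<subseteq> D then w n else [])" for n
    have "w' \<in> seqs D" by (auto simp: w'_def seqs_def)
    with psubset.IH[OF D(1)] D psubset.prems obtain k v where "Fac A k v" "weq DS A w' v" by blast
    moreover have "\<forall>\<^sub>F n in uf. w n = w' n" using D(2) by eventually_elim (auto simp: w'_def)
    ultimately show ?thesis using weq_ae weq_trans by blast
  qed
  have shorts: "\<exists>k v. Fac A k v \<and> weq DS A w v" if "\<forall>\<^sub>F n in uf. short C N (w n)" for w N
    using that
  proof (induction N arbitrary: w)
    case 0
    then show ?case using small by simp
  next
    case (Suc N)
    then consider "\<forall>\<^sub>F n in uf. set (w n) \<subset> C"
      | "\<forall>\<^sub>F n in uf. \<exists>a\<in>C. \<exists>p\<in>lists C. \<exists>v\<in>lists C. w n = p @ a # v \<and> set p \<subset> C \<and> short C N v"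
      by (auto simp: ae_disj)
    then show ?case
    proof cases
      case 1
      then show ?thesis by (rule small)
    next
      case 2
      then obtain a where a: "a \<in> C"
        "\<forall>\<^sub>F n in uf. \<exists>p\<in>lists C. \<exists>v\<in>lists C. w n = p @ a # v \<and> set p \<subset> C \<and> short C N v"
        using ae_bex_finite[OF psubset.hyps(1), of "\<lambda>a n. \<exists>p\<in>lists C. \<exists>v\<in>lists C. w n = p @ a # v \<and> set p \<subset> C \<and> short C N v"]
        by blast
      from ae_seqs[OF a(2)] obtain p where p: "p \<in> seqs C"
        "\<forall>\<^sub>F n in uf. \<exists>v\<in>lists C. w n = p n @ a # v \<and> set (p n) \<subset> C \<and> short C N v" by blast
      from ae_seqs[OF p(2)] obtain v where v: "v \<in> seqs C"
        "\<forall>\<^sub>F n in uf. w n = p n @ a # v n \<and> set (p n) \<subset> C \<and> short C N (v n)" by blast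
      obtain i x where x: "Fac A i x" "weq DS A p x"
        using small[of p] v(2) by (auto simp: eventually_conj_iff)
      obtain j y where y: "Fac A j y" "weq DS A v y"
        using Suc.IH[of v] v(2) by (auto simp: eventually_conj_iff)
      have aA: "a \<in> A" using a psubset.prems by auto
      have s: "p \<in> seqs A" "v \<in> seqs A" "x \<in> seqs A" "y \<in> seqs A"
        using CA p v x y Fac_seqs by auto
      have "weq DS A w (\<lambda>n. p n @ a # v n)" using v(2) by (intro weq_ae) (auto simp: eventually_conj_iff)
      also have "weq DS A \<dots> (\<lambda>n. x n @ a # v n)"
        using weq_congl[OF DSf x(2), of "\<lambda>n. a # v n"] s aA by simp
      also have "weq DS A \<dots> (\<lambda>n. x n @ a # y n)"
        using weq_congr[OF DSf y(2), of "\<lambda>n. x n @ [a]"] s aA by (simp add: seqs_def)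
      finally show ?thesis using Fac_join[OF x(1) aA y(1)] by blast
    qed
  qed
  show ?case
  proof (cases "\<exists>N. \<forall>\<^sub>F n in uf. short C N (u n)")
    case True
    then show ?thesis using shorts by blast
  next
    case False
    then have blocks: "\<forall>\<^sub>F n in uf. \<exists>xs y. u n = concat xs @ y \<and> length xs = N \<and> (\<forall>x\<in>set xs. set x = C) \<and> set y \<subseteq> C" for N
    proof -
      have "\<forall>\<^sub>F n in uf. \<not> short C N (u n)" using False ae_not by blast
      then show ?thesis
      proof eventually_elim
        case (elim n)
        have "set (u n) \<subseteq> C" using psubset.prems by (auto simp: seqs_def)
        with elim show ?case using blocks_or_short by blast
      qed
    qed
    have reg: "weq DS A u (\<lambda>n. wpow (u n) (fact n) @ u n)"
      unfolding weq_def
    proof (intro ballI)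
      fix T :: "nat sgrp" and f assume T: "T \<in> DS" and f: "f \<in> A \<rightarrow> carrier T"
      interpret group_eval T f A using T f by (rule DS_group_eval)
      have "\<forall>\<^sub>F n in uf. n \<ge> stab T" by (rule ae_ge)
      with blocks[of "stab T"] show "\<forall>\<^sub>F n in uf. E (u n) = E (wpow (u n) (fact n) @ u n)"
      proof eventually_elim
        case (elim n)
        then obtain xs y where *: "u n = concat xs @ y \<and> length xs = stab T \<and> (\<forall>x\<in>set xs. set x = C) \<and> set y \<subseteq> C"
          by (elim exE)
        then have "stab T \<le> length xs" "\<And>x. x \<in> set xs \<Longrightarrow> set x = C" "set y \<subseteq> C" by auto
        from many_blocks_regular[OF this psubset.prems(1)] elim(2) * show ?case by simp
      qed
    qed
    show ?thesis
    proof (cases "\<forall>\<^sub>F n in uf. u n = []")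
      case True
      then show ?thesis using weq_ae[OF True] Fac.zero[OF mreg.Nil] by blast
    next
      case False
      then have ne: "\<forall>\<^sub>F n in uf. u n \<noteq> []" by (simp add: ae_not)
      then obtain n0 where "u n0 \<noteq> []" using eventually_happens' uf_neq_bot by blast
      \<comment> \<open>\<open>mreg\<close> demands nonempty words at every index, so the negligible
        empty ones are replaced.\<close>
      define r where "r n = (if u n = [] then u n0 else u n)" for n
      have "r \<in> seqs C" "\<forall>n. r n \<noteq> []" using psubset.prems \<open>u n0 \<noteq> []\<close> by (auto simp: r_def seqs_def)
      then have "(\<lambda>n. wpow (r n @ []) (fact n) @ r n) \<in> mreg A"
        by (intro mreg_single) (auto simp: CA)
      moreover have "weq DS A u (\<lambda>n. wpow (r n @ []) (fact n) @ r n)"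
        using ne by (intro weq_trans[OF reg] weq_ae) (auto simp: r_def elim: eventually_mono)
      ultimately show ?thesis using Fac.zero by blast
    qed
  qed
qed


section \<open>Quotients of free semigroups and subdirect products\<close>

abbreviation plus_words :: "'a set \<Rightarrow> 'a list set" where
  "plus_words A \<equiv> lists A - {[]}"

text \<open>Presenting a congruence of finite index as the kernel of \<open>F\<close> avoids a
  quotient type. It serves twice: for the approximating congruences \<open>teq\<close> and for a
  syntactic congruence.\<close>

lemma quotient_sgrp:
  fixes F :: "'a list \<Rightarrow> 'c"
  assumes A: "A \<noteq> {}" and fin: "finite (F ` plus_words A)"
    and cong: "\<And>u v x y. u \<in> plus_words A \<Longrightarrow> v \<in> plus_words A \<Longrightarrow> F u = F v \<Longrightarrow> x \<in> lists A \<Longrightarrow>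
      y \<in> lists A \<Longrightarrow> F (x @ u @ y) = F (x @ v @ y)"
  obtains Q :: "nat sgrp" and \<psi> where "Q \<in> fin_sgrps" "\<psi> \<in> A \<rightarrow>\<^sub>E carrier Q"
    "carrier Q = finite_products Q (\<psi> ` A)"
    "\<forall>u\<in>plus_words A. \<forall>v\<in>plus_words A. ev Q \<psi> u = ev Q \<psi> v \<longleftrightarrow> F u = F v"
proof -
  let ?L = "plus_words A"
  obtain c :: "'c \<Rightarrow> nat" where c: "inj_on c (F ` ?L)"
    using finite_imp_inj_to_nat_seg[OF fin] by blast
  define rep where "rep k = (SOME w. w \<in> ?L \<and> c (F w) = k)" for k
  have rep: "rep (c (F w)) \<in> ?L" "c (F (rep (c (F w)))) = c (F w)" if "w \<in> ?L" for w
    using someI[of "\<lambda>v. v \<in> ?L \<and> c (F v) = c (F w)" w] that by (auto simp: rep_def)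
  have repF: "F (rep (c (F w))) = F w" if "w \<in> ?L" for w
    using rep[OF that] c that by (auto dest: inj_onD)
  define Q where "Q = \<lparr>carrier = (\<lambda>w. c (F w)) ` ?L, smult = (\<lambda>i j. c (F (rep i @ rep j)))\<rparr>"
  have cQ: "carrier Q = (\<lambda>w. c (F w)) ` ?L" by (simp add: Q_def)
  have mult: "smult Q (c (F u)) (c (F v)) = c (F (u @ v))" if u: "u \<in> ?L" and v: "v \<in> ?L" for u v
  proof -
    have "F (rep (c (F u)) @ rep (c (F v))) = F ([] @ u @ rep (c (F v)))"
      using cong[OF rep(1)[OF u] u repF[OF u], of "[]" "rep (c (F v))"] rep(1)[OF v] by auto
    also have "\<dots> = F (u @ v @ [])"
      using cong[OF rep(1)[OF v] v repF[OF v], of u "[]"] u by auto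
    finally show ?thesis by (simp add: Q_def)
  qed
  have closed: "u @ v \<in> ?L" if "u \<in> ?L" "v \<in> ?L" for u v :: "'a list"
    using that by auto
  have sg: "is_sgrp Q"
    unfolding is_sgrp_def
  proof (intro conjI ballI)
    obtain a where "a \<in> A" using A by blast
    then have "[a] \<in> ?L" by simp
    then show "carrier Q \<noteq> {}" unfolding cQ by blast
  next
    fix x y assume "x \<in> carrier Q" "y \<in> carrier Q"
    then obtain u v where "u \<in> ?L" "v \<in> ?L" "x = c (F u)" "y = c (F v)" unfolding cQ by blast
    then show "smult Q x y \<in> carrier Q" using mult closed[of u v] unfolding cQ by auto
  next
    fix x y z assume "x \<in> carrier Q" "y \<in> carrier Q" "z \<in> carrier Q"
    then obtain u v w where "u \<in> ?L" "v \<in> ?L" "w \<in> ?L" "x = c (F u)" "y = c (F v)" "z = c (F w)"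
      unfolding cQ by blast
    then show "smult Q (smult Q x y) z = smult Q x (smult Q y z)"
      using mult closed[of u v] closed[of v w] by simp
  qed
  define \<psi> where "\<psi> = (\<lambda>a\<in>A. c (F [a]))"
  have \<psi>: "\<psi> \<in> A \<rightarrow>\<^sub>E carrier Q" unfolding \<psi>_def cQ by auto
  then have \<psi>': "\<psi> \<in> A \<rightarrow> carrier Q" by (rule PiE_mono[THEN subsetD, THEN PiE_mem[THEN funcsetI]] | auto)
  have \<psi>1: "\<psi> a = c (F [a])" if "a \<in> A" for a using that by (simp add: \<psi>_def)
  have ev: "ev Q \<psi> w = c (F w)" if "w \<in> ?L" for w
    using that
  proof (induction w)
    case (Cons a w)
    show ?case
    proof (cases "w = []")
      case True
      then show ?thesis using Cons \<psi>1 by simp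
    next
      case False
      then have w: "w \<in> ?L" "[a] \<in> ?L" using Cons by auto
      have "ev Q \<psi> (a # w) = smult Q (\<psi> a) (ev Q \<psi> w)"
        using ev_append[OF sg \<psi>', of "[a]" w] w by auto
      also have "\<dots> = c (F (a # w))" using Cons.IH[OF w(1)] mult[OF w(2,1)] \<psi>1 Cons.prems by simp
      finally show ?thesis .
    qed
  qed simp
  show thesis
  proof
    have "carrier Q = c ` F ` ?L" by (simp add: cQ image_image)
    then show "Q \<in> fin_sgrps" using sg fin by (simp add: fin_sgrps_def)
    show "carrier Q = finite_products Q (\<psi> ` A)"
      unfolding finite_products_eq[OF sg \<psi>'] cQ using ev by force
    show "\<forall>u\<in>?L. \<forall>v\<in>?L. ev Q \<psi> u = ev Q \<psi> v \<longleftrightarrow> F u = F v"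
      using ev c by (metis imageI inj_onD)
  qed (rule \<psi>)
qed

lemma hom_from_kernel:
  assumes Q: "is_sgrp Q" "\<psi> \<in> A \<rightarrow> carrier Q" "carrier Q = finite_products Q (\<psi> ` A)"
    and T: "is_sgrp T" "\<phi> \<in> A \<rightarrow> carrier T"
    and ker: "\<And>u v. u \<in> plus_words A \<Longrightarrow> v \<in> plus_words A \<Longrightarrow> ev Q \<psi> u = ev Q \<psi> v \<Longrightarrow>
      ev T \<phi> u = ev T \<phi> v"
  obtains h where "h \<in> sg_hom Q T" "\<And>w. w \<in> plus_words A \<Longrightarrow> h (ev Q \<psi> w) = ev T \<phi> w"
proof -
  let ?L = "plus_words A"
  have cQ: "carrier Q = {ev Q \<psi> w |w. w \<in> ?L}"
    using Q(3) finite_products_eq[OF Q(1,2)] by simp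
  define rep where "rep q = (SOME w. w \<in> ?L \<and> ev Q \<psi> w = q)" for q
  define h where "h = (\<lambda>q\<in>carrier Q. ev T \<phi> (rep q))"
  have h: "h (ev Q \<psi> w) = ev T \<phi> w" if "w \<in> ?L" for w
  proof -
    have "rep (ev Q \<psi> w) \<in> ?L \<and> ev Q \<psi> (rep (ev Q \<psi> w)) = ev Q \<psi> w"
      unfolding rep_def by (rule someI[of _ w]) (use that in simp)
    moreover have "ev Q \<psi> w \<in> carrier Q" unfolding cQ using that by blast
    ultimately show ?thesis using ker[of "rep (ev Q \<psi> w)" w] that by (simp add: h_def)
  qed
  have "h \<in> sg_hom Q T"
    unfolding sg_hom_def
  proof (intro CollectI conjI ballI)
    show "h \<in> carrier Q \<rightarrow>\<^sub>E carrier T"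
    proof (rule PiE_I)
      fix q assume "q \<in> carrier Q"
      then obtain w where "q = ev Q \<psi> w" "w \<in> ?L" unfolding cQ by blast
      then show "h q \<in> carrier T" using h ev_in[OF T] by auto
    qed (simp add: h_def)
    fix x y assume "x \<in> carrier Q" "y \<in> carrier Q"
    then obtain u v where uv: "u \<in> ?L" "v \<in> ?L" "x = ev Q \<psi> u" "y = ev Q \<psi> v" unfolding cQ by blast
    then have "smult Q x y = ev Q \<psi> (u @ v)" "u @ v \<in> ?L"
      using ev_append[OF Q(1,2), of u v] by auto
    then show "h (smult Q x y) = smult T (h x) (h y)"
      using uv h ev_append[OF T, of u v] by simp
  qed
  then show thesis using h that by blast
qed

section \<open>Subdirect products\<close>

lemma transport_to_nat:
  assumes "is_sgrp P" "finite (carrier P)"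
  obtains T where "T \<in> fin_sgrps" "sg_iso P T"
proof -
  obtain g :: "'a \<Rightarrow> nat" where g: "inj_on g (carrier P)"
    using finite_imp_inj_to_nat_seg[OF assms(2)] by blast
  define g' where "g' = inv_into (carrier P) g"
  have g': "g' (g x) = x" if "x \<in> carrier P" for x using g that by (simp add: g'_def)
  define T where "T = \<lparr>carrier = g ` carrier P, smult = (\<lambda>x y. g (smult P (g' x) (g' y)))\<rparr>"
  have "T \<in> fin_sgrps"
    using assms g' by (auto simp: T_def fin_sgrps_def is_sgrp_def)
  moreover have "restrict g (carrier P) \<in> sg_hom P T"
    using assms g' by (auto simp: T_def sg_hom_def sgrp_closed)
  moreover have "bij_betw (restrict g (carrier P)) (carrier P) (carrier T)"
    using g by (simp add: T_def bij_betw_def inj_on_def)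
  ultimately have "T \<in> fin_sgrps" "sg_iso P T" unfolding sg_iso_def by blast+
  then show thesis by (rule that)
qed

text \<open>Homomorphisms without the extensionality built into \<open>sg_hom\<close>, so that the
  identity on a larger type qualifies.\<close>

definition mult_map :: "'b sgrp \<Rightarrow> 'c sgrp \<Rightarrow> ('b \<Rightarrow> 'c) \<Rightarrow> bool" where
  "mult_map Q T h \<longleftrightarrow> h \<in> carrier Q \<rightarrow> carrier T \<and>
     (\<forall>x\<in>carrier Q. \<forall>y\<in>carrier Q. h (smult Q x y) = smult T (h x) (h y))"

lemma sg_hom_mult_map: "h \<in> sg_hom Q T \<Longrightarrow> mult_map Q T h"
  by (auto simp: sg_hom_def mult_map_def)

text \<open>The closure property shared by \<open>V\<close>, \<open>DS\<close> and
  \<open>fin_sgrps\<close> that lets the whole theory of limits be developed once for all three. An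
  empty \<open>H\<close> yields the one-element semigroups.\<close>

definition subdirect_closed :: "nat sgrp set \<Rightarrow> bool" where
  "subdirect_closed W \<longleftrightarrow> W \<subseteq> fin_sgrps \<and>
     (\<forall>Q\<in>fin_sgrps. \<forall>H. finite H \<and> (\<forall>(T, h)\<in>H. T \<in> W \<and> mult_map Q T h) \<and>
        (\<forall>x\<in>carrier Q. \<forall>y\<in>carrier Q. (\<forall>(T, h)\<in>H. h x = h y) \<longrightarrow> x = y) \<longrightarrow> Q \<in> W)"

lemma subdirect_closedD:
  assumes "subdirect_closed W" "Q \<in> fin_sgrps" "finite H"
    "\<And>T h. (T, h) \<in> H \<Longrightarrow> T \<in> W \<and> mult_map Q T h"
    "\<And>x y. x \<in> carrier Q \<Longrightarrow> y \<in> carrier Q \<Longrightarrow> (\<And>T h. (T, h) \<in> H \<Longrightarrow> h x = h y) \<Longrightarrow> x = y"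
  shows "Q \<in> W"
proof -
  have "finite H \<and> (\<forall>(T, h)\<in>H. T \<in> W \<and> mult_map Q T h) \<and>
      (\<forall>x\<in>carrier Q. \<forall>y\<in>carrier Q. (\<forall>(T, h)\<in>H. h x = h y) \<longrightarrow> x = y)"
    using assms(3-5) by (intro conjI) (assumption | fast)+
  then show ?thesis using assms(1,2) unfolding subdirect_closed_def by blast
qed

lemma subdirect_closed_fin [simp]: "subdirect_closed fin_sgrps"
  by (simp add: subdirect_closed_def)

lemma subdirect_closed_pseudovariety:
  assumes V: "pseudovariety V"
  shows "subdirect_closed V"
  unfolding subdirect_closed_def
proof (intro conjI ballI allI impI)
  show Vf: "V \<subseteq> fin_sgrps" using V by (simp add: pseudovariety_def)
  fix Q H
  assume Q: "Q \<in> fin_sgrps" and "finite H \<and> (\<forall>(T, h)\<in>H. T \<in> V \<and> mult_map Q T h) \<and>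
        (\<forall>x\<in>carrier Q. \<forall>y\<in>carrier Q. (\<forall>(T, h)\<in>H. h x = h y) \<longrightarrow> x = y)"
  then have H: "finite H" "\<And>p. p \<in> H \<Longrightarrow> fst p \<in> V \<and> mult_map Q (fst p) (snd p)"
    and inj: "\<And>x y. x \<in> carrier Q \<Longrightarrow> y \<in> carrier Q \<Longrightarrow> (\<forall>p\<in>H. snd p x = snd p y) \<Longrightarrow> x = y"
    by (auto simp: case_prod_unfold)
  obtain p where p: "H = p ` {..<card H}" 
    using ex_bij_betw_nat_finite[OF H(1)] by (metis atLeast0LessThan bij_betw_imp_surj_on)
  define I where "I = {..<card H}"
  define S where "S i = fst (p i)" for i
  define h where "h i = snd (p i)" for i
  have Sh: "S i \<in> V" "mult_map Q (S i) (h i)" "is_sgrp (S i)" "finite (carrier (S i))" if "i \<in> I" for i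
    using H(2)[of "p i"] p that Vf by (auto simp: S_def h_def I_def fin_sgrps_def)
  have inj': "x = y" if "x \<in> carrier Q" "y \<in> carrier Q" "\<And>i. i \<in> I \<Longrightarrow> h i x = h i y" for x y
    proof (rule inj[OF that(1,2)])
    show "\<forall>q\<in>H. snd q x = snd q y" using p that(3) unfolding h_def I_def by (metis imageE)
  qed
  define P where "P = prod_sgrp I S"
  have cP: "carrier P = (\<Pi>\<^sub>E i\<in>I. carrier (S i))" by (simp add: P_def prod_sgrp_def)
  have mP: "smult P f g = (\<lambda>i\<in>I. smult (S i) (f i) (g i))" for f g by (simp add: P_def prod_sgrp_def)
  have P: "is_sgrp P"
    unfolding is_sgrp_def
  proof (intro conjI ballI)
    show "carrier P \<noteq> {}" using Sh(3) by (auto simp: cP PiE_eq_empty_iff is_sgrp_def)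
  qed (use Sh(3) in \<open>auto simp: cP mP PiE_mem intro!: restrict_ext sgrp_closed sgrp_assoc\<close>)
  have "finite (carrier P)" unfolding cP by (rule finite_PiE) (use Sh(4) in \<open>auto simp: I_def\<close>)
  from transport_to_nat[OF P this] obtain T where T: "T \<in> fin_sgrps" "sg_iso P T" .
  have TV: "T \<in> V"
  proof -
    have "finite I \<and> (\<forall>i\<in>I. S i \<in> V) \<and> sg_iso (prod_sgrp I S) T"
      using T(2) Sh(1) by (simp add: I_def P_def)
    with V[unfolded pseudovariety_def, THEN conjunct2, THEN conjunct2, THEN conjunct2] T(1)
    show ?thesis by blast
  qed
  obtain g where g: "g \<in> sg_hom P T" "bij_betw g (carrier P) (carrier T)"
    using T(2) by (auto simp: sg_iso_def)
  define j where "j q = (\<lambda>i\<in>I. h i q)" for q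
  have j: "j q \<in> carrier P" if "q \<in> carrier Q" for q
    using Sh(2) that by (auto simp: j_def cP mult_map_def)
  have jm: "j (smult Q x y) = smult P (j x) (j y)" if "x \<in> carrier Q" "y \<in> carrier Q" for x y
    unfolding j_def mP by (rule restrict_ext) (use Sh(2) that in \<open>simp add: mult_map_def\<close>)
  define k where "k q = g (j q)" for q
  have k: "k q \<in> carrier T" if "q \<in> carrier Q" for q
    using g(1) j[OF that] by (auto simp: k_def sg_hom_def)
  have km: "k (smult Q x y) = smult T (k x) (k y)" if "x \<in> carrier Q" "y \<in> carrier Q" for x y
    using g(1) j that jm by (auto simp: k_def sg_hom_def)
  have kinj: "inj_on k (carrier Q)"
  proof (rule inj_onI)
    fix x y assume xy: "x \<in> carrier Q" "y \<in> carrier Q" "k x = k y"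
    then have "j x = j y" using g(2) j by (auto simp: k_def bij_betw_def dest: inj_onD)
    then show "x = y" using inj'[OF xy(1,2)] unfolding j_def by (metis restrict_apply')
  qed
  have Qs: "is_sgrp Q" using Q by (rule fin_sgrpsD)
  \<comment> \<open>\<open>R\<close> is the copy of \<open>Q\<close> inside the copy
    \<open>T\<close> of the product; \<open>Q\<close> returns as its image under the inverse of
    \<open>k\<close>, since closure under isomorphism is only available through
    \<open>hom_image\<close>.\<close>
  define R where "R = \<lparr>carrier = k ` carrier Q, smult = smult T\<rparr>"
  have kmm: "smult T (k x) (k y) \<in> k ` carrier Q" if "x \<in> carrier Q" "y \<in> carrier Q" for x y
    unfolding km[OF that, symmetric] using that Qs by (intro imageI sgrp_closed)
  have Rs: "subsemigroup R T"
    using Qs fin_sgrpsD(1)[OF T(1)] k kmm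
    by (auto simp: R_def subsemigroup_def is_sgrp_def)
  then have RV: "R \<in> V" using V TV unfolding pseudovariety_def by blast
  define k' where "k' = restrict (inv_into (carrier Q) k) (carrier R)"
  have k': "k' (k x) = x" if "x \<in> carrier Q" for x
    using that kinj by (simp add: k'_def R_def)
  have "k' \<in> sg_hom R Q"
    using k' km Qs kmm by (auto simp: sg_hom_def R_def k'_def km[symmetric] sgrp_closed kinj)
  moreover have "k' ` carrier R = carrier Q"
    using k' by (force simp: R_def image_image)
  ultimately have "hom_image R Q" by (auto simp: hom_image_def)
  then show "Q \<in> V" using V RV Q unfolding pseudovariety_def by blast
qed

text \<open>Lying in a subgroup is an equation between powers, hence can be checked in the
  separating images; the maximum of their thresholds serves for \<open>Q\<close>.\<close>

lemma subdirect_closed_DS: "subdirect_closed DS"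
  unfolding subdirect_closed_def
proof (intro conjI ballI allI impI)
  show "DS \<subseteq> fin_sgrps" by (auto simp: DS_def)
  fix Q H
  assume Q: "Q \<in> fin_sgrps" and "finite H \<and> (\<forall>(T, h)\<in>H. T \<in> DS \<and> mult_map Q T h) \<and>
        (\<forall>x\<in>carrier Q. \<forall>y\<in>carrier Q. (\<forall>(T, h)\<in>H. h x = h y) \<longrightarrow> x = y)"
  then have H: "finite H" "\<And>p. p \<in> H \<Longrightarrow> fst p \<in> DS \<and> mult_map Q (fst p) (snd p)"
    and inj: "\<And>x y. x \<in> carrier Q \<Longrightarrow> y \<in> carrier Q \<Longrightarrow> (\<forall>p\<in>H. snd p x = snd p y) \<Longrightarrow> x = y"
    by (auto simp: case_prod_unfold)
  have Qs: "is_sgrp Q" using Q by (rule fin_sgrpsD)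
  have id: "(\<lambda>x. x) \<in> carrier Q \<rightarrow> carrier Q" by simp
  show "Q \<in> DS"
  proof (rule DS_I[OF Q])
    fix s t assume s: "s \<in> carrier Q" and t: "t \<in> carrier Q" and st: "smult Q (smult Q s t) s = s"
    define N where "N = Max (insert 0 ((\<lambda>p. stab (fst p)) ` H))"
    have "mev Q (\<lambda>x. x) (wpow [s] (fact n) @ [s]) = Some s" if n: "n \<ge> N" for n
    proof -
      let ?w = "wpow [s] (fact n) @ [s]"
      have w: "?w \<in> lists (carrier Q)" "?w \<noteq> []" using s wpow_lists[of "[s]" "carrier Q"] by auto
      have "ev Q (\<lambda>x. x) ?w = s"
      proof (rule inj)
        show "ev Q (\<lambda>x. x) ?w \<in> carrier Q" by (rule ev_in[OF Qs id w])
        show "\<forall>p\<in>H. snd p (ev Q (\<lambda>x. x) ?w) = snd p s"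
        proof
          fix p assume p: "p \<in> H"
          define T h where "T = fst p" and "h = snd p"
          have T: "T \<in> DS" "mult_map Q T h" using H(2)[OF p] by (simp_all add: T_def h_def)
          have "stab T \<le> n" using n p H(1) by (auto simp: N_def T_def)
          moreover have "smult T (smult T (h s) (h t)) (h s) = h s"
            using T(2) s t st Qs by (metis mult_map_def sgrp_closed)
          moreover have "h s \<in> carrier T" "h t \<in> carrier T" using T(2) s t by (auto simp: mult_map_def)
          ultimately have "mev T (\<lambda>x. x) (wpow [h s] (fact n) @ [h s]) = Some (h s)"
            using DS_group_eval_id[OF T(1)] by blast
          moreover have "wpow [h s] (fact n) @ [h s] = map h ?w" by (simp add: wpow_def map_concat)
          ultimately have "mev T h ?w = Some (h s)" by (simp only: mev_map)
          then have "ev T h ?w = h s" by (simp add: ev_def)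
          then show "snd p (ev Q (\<lambda>x. x) ?w) = snd p s"
            using ev_hom[OF Qs id w, of h T] T(2) by (auto simp: mult_map_def h_def)
        qed
      qed (rule s)
      then show ?thesis using w mev_eq_Some by metis
    qed
    then show "\<exists>N. \<forall>n\<ge>N. mev Q (\<lambda>x. x) (wpow [s] (fact n) @ [s]) = Some s" by blast
  qed
qed


section \<open>The approximating congruences\<close>

text \<open>A descending sequence of congruences that defines the topology of the free
  pro-\<open>W\<close> semigroup: carriers are finite sets of naturals, so each member of
  \<open>W\<close> is taken into account from some \<open>k\<close> on.\<close>

definition teq :: "nat sgrp set \<Rightarrow> 'a set \<Rightarrow> nat \<Rightarrow> 'a list \<Rightarrow> 'a list \<Rightarrow> bool" where
  "teq W A k u v \<longleftrightarrow>
     (\<forall>T\<in>W. carrier T \<subseteq> {..<k} \<longrightarrow> (\<forall>f\<in>A \<rightarrow> carrier T. mev T f u = mev T f v))"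

lemma teq_mono: "teq W A k u v \<Longrightarrow> j \<le> k \<Longrightarrow> teq W A j u v"
  unfolding teq_def by (meson lessThan_subset_iff subset_trans)

lemma teq_refl [simp]: "teq W A k u u"
  by (simp add: teq_def)

lemma teq_sym: "teq W A k u v \<Longrightarrow> teq W A k v u"
  by (simp add: teq_def eq_commute)

lemma teq_trans: "teq W A k u v \<Longrightarrow> teq W A k v w \<Longrightarrow> teq W A k u w"
  by (simp add: teq_def)

text \<open>Multiplications are only relevant on the carrier, where they are determined by a finite table.\<close>

lemma teq_finite_family:
  assumes W: "subdirect_closed W" and A: "finite A"
  obtains P where "finite P" "\<forall>(T, f)\<in>P. T \<in> W \<and> f \<in> A \<rightarrow> carrier T"
    "\<forall>u\<in>lists A. \<forall>v\<in>lists A. teq W A k u v \<longleftrightarrow> (\<forall>(T, f)\<in>P. mev T f u = mev T f v)"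
proof -
  define D where "D = Pow {..<k} \<times> ((({..<k} \<times> {..<k}) \<rightarrow>\<^sub>E {..<k}) \<times> (A \<rightarrow>\<^sub>E {..<k}))"
  define tab where "tab = (\<lambda>C g. \<lparr>carrier = C, smult = (\<lambda>x y. g (x, y))\<rparr> :: nat sgrp)"
  define P where "P = {(T, f) \<in> (\<lambda>(C, g, f). (tab C g, f)) ` D. T \<in> W \<and> f \<in> A \<rightarrow> carrier T}"
  have "finite D" unfolding D_def using A by (intro finite_cartesian_product finite_PiE) auto
  then have Pfin: "finite P" unfolding P_def by (rule finite_subset[rotated, OF finite_imageI]) blast
  have PW: "\<forall>(T, f)\<in>P. T \<in> W \<and> f \<in> A \<rightarrow> carrier T"
    by (auto simp: P_def)
  have key: "teq W A k u v \<longleftrightarrow> (\<forall>(T, f)\<in>P. mev T f u = mev T f v)"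
    if u: "u \<in> lists A" and v: "v \<in> lists A" for u v
  proof
    assume "teq W A k u v"
    then show "\<forall>(T, f)\<in>P. mev T f u = mev T f v"
      by (fastforce simp: P_def teq_def D_def tab_def)
  next
    assume P: "\<forall>(T, f)\<in>P. mev T f u = mev T f v"
    show "teq W A k u v"
      unfolding teq_def
    proof (intro ballI impI)
      fix T f assume T: "T \<in> W" "carrier T \<subseteq> {..<k}" and f: "f \<in> A \<rightarrow> carrier T"
      have Tf: "T \<in> fin_sgrps" using W T by (auto simp: subdirect_closed_def)
      note Ts = fin_sgrpsD(1)[OF Tf]
      \<comment> \<open>Outside the carrier the table repeats the first coordinate, merely to keep
        its values below \<open>k\<close>.\<close>
      define g where "g = (\<lambda>p\<in>{..<k} \<times> {..<k}. if p \<in> carrier T \<times> carrier T then smult T (fst p) (snd p) else fst p)"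
      define T' where "T' = tab (carrier T) g"
      have cT': "carrier T' = carrier T" by (simp add: T'_def tab_def)
      have mT': "smult T' x y = smult T x y" if "x \<in> carrier T" "y \<in> carrier T" for x y
      proof -
        have "(x, y) \<in> {..<k} \<times> {..<k}" using that T(2) by blast
        then show ?thesis using that by (simp add: T'_def tab_def g_def)
      qed
      have T's: "is_sgrp T'" using Ts by (auto simp: is_sgrp_def cT' mT')
      have "T' \<in> W"
      proof (rule subdirect_closedD[OF W, of T' "{(T, \<lambda>x. x)}"])
        show "T' \<in> fin_sgrps" using T's Tf by (simp add: fin_sgrps_def cT')
      qed (use T in \<open>auto simp: mult_map_def cT' mT'\<close>)
      define f' where "f' = restrict f A"
      have g: "g \<in> ({..<k} \<times> {..<k}) \<rightarrow>\<^sub>E {..<k}"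
        using T(2) Ts by (auto simp: g_def sgrp_closed subset_iff)
      have f': "f' \<in> A \<rightarrow>\<^sub>E {..<k}" using f T(2) by (auto simp: f'_def)
      have "(T', f') \<in> P"
        unfolding P_def
        using \<open>T' \<in> W\<close> f f' g T(2)
        by (auto simp: T'_def D_def f'_def image_iff cT'[unfolded T'_def]
            intro!: bexI[of _ "(carrier T, g, f')"])
      then have "mev T' f' u = mev T' f' v" using P by auto
      moreover have "mev T' f' w = mev T f w" if "w \<in> lists A" for w
      proof -
        have fT': "f' \<in> A \<rightarrow> carrier T'" using f by (auto simp: f'_def cT')
        have "mev T f' w = mev T' f' w"
          using mev_hom[OF T's fT' that, of "\<lambda>x. x" T] by (simp add: cT' mT' option.map_ident)
        moreover have "mev T f' w = mev T f w"
          by (rule mev_cong_fun) (use that in \<open>auto simp: f'_def\<close>)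
        ultimately show ?thesis by simp
      qed
      ultimately show "mev T f u = mev T f v" using u v by simp
    qed
  qed
  show thesis by (rule that[OF Pfin PW]) (intro ballI key)
qed

text \<open>The quotient is separated by the finitely many evaluations that define the congruence,
  so it is a subdirect product of members of \<open>W\<close> and therefore belongs to
  \<open>W\<close>.\<close>

lemma teq_quotient:
  assumes W: "subdirect_closed W" and A: "finite A" "A \<noteq> {}"
  obtains Q \<psi> where "Q \<in> W" "\<psi> \<in> A \<rightarrow>\<^sub>E carrier Q" "carrier Q = finite_products Q (\<psi> ` A)"
    "\<forall>u\<in>plus_words A. \<forall>v\<in>plus_words A. ev Q \<psi> u = ev Q \<psi> v \<longleftrightarrow> teq W A k u v"
proof -
  obtain P where P: "finite P" "\<forall>(T, f)\<in>P. T \<in> W \<and> f \<in> A \<rightarrow> carrier T"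
    and teq: "\<forall>u\<in>lists A. \<forall>v\<in>lists A. teq W A k u v \<longleftrightarrow> (\<forall>(T, f)\<in>P. mev T f u = mev T f v)"
    using teq_finite_family[OF W A(1), where k = k] .
  have Wf: "W \<subseteq> fin_sgrps" using W by (simp add: subdirect_closed_def)
  have P': "is_sgrp (fst p)" "finite (carrier (fst p))" "snd p \<in> A \<rightarrow> carrier (fst p)" if "p \<in> P" for p
    using P(2) that Wf fin_sgrpsD by (auto simp: case_prod_unfold)
  define F where "F w = (\<lambda>p\<in>P. mev (fst p) (snd p) w)" for w
  have F: "F u = F v \<longleftrightarrow> (\<forall>(T, f)\<in>P. mev T f u = mev T f v)" for u v
    by (auto simp: F_def fun_eq_iff restrict_def split: if_splits)
  have "F ` plus_words A \<subseteq> (\<Pi>\<^sub>E p\<in>P. mcar (fst p))"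
    unfolding F_def
    by (intro image_subsetI restrict_PiE_iff[THEN iffD2] ballI mev_in[OF P'(1,3)]) auto
  moreover have "finite (\<Pi>\<^sub>E p\<in>P. mcar (fst p))"
    using P(1) P'(2) by (intro finite_PiE) (auto simp: mcar_def)
  ultimately have fin: "finite (F ` plus_words A)" by (rule finite_subset)
  have cong: "F (x @ u @ y) = F (x @ v @ y)"
    if "u \<in> plus_words A" "v \<in> plus_words A" "F u = F v" "x \<in> lists A" "y \<in> lists A" for u v x y
    unfolding F
  proof (clarsimp, goal_cases)
    case (1 T f)
    then have "mev T f u = mev T f v" using that F by auto
    then show ?case using mev_congr[OF P'(1,3)[OF 1], of u v x y] that by simp
  qed
  obtain Q \<psi> where Q: "Q \<in> fin_sgrps" "\<psi> \<in> A \<rightarrow>\<^sub>E carrier Q" "carrier Q = finite_products Q (\<psi> ` A)"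
    "\<forall>u\<in>plus_words A. \<forall>v\<in>plus_words A. ev Q \<psi> u = ev Q \<psi> v \<longleftrightarrow> F u = F v"
    using quotient_sgrp[OF A(2) fin cong] .
  have Qs: "is_sgrp Q" and \<psi>: "\<psi> \<in> A \<rightarrow> carrier Q" using Q fin_sgrpsD by auto
  have "\<exists>h. h \<in> sg_hom Q (fst p) \<and> (\<forall>w\<in>plus_words A. h (ev Q \<psi> w) = ev (fst p) (snd p) w)"
    if p: "p \<in> P" for p
  proof -
    have "ev (fst p) (snd p) u = ev (fst p) (snd p) v"
      if "u \<in> plus_words A" "v \<in> plus_words A" "ev Q \<psi> u = ev Q \<psi> v" for u v
      using Q(4)[rule_format, OF that(1,2)] that(3) p unfolding F by (auto simp: ev_def)
    from hom_from_kernel[OF Qs \<psi> Q(3) P'(1,3)[OF p] this] show ?thesis by metis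
  qed
  then obtain h where h: "\<And>p. p \<in> P \<Longrightarrow> h p \<in> sg_hom Q (fst p)"
    "\<And>p w. p \<in> P \<Longrightarrow> w \<in> plus_words A \<Longrightarrow> h p (ev Q \<psi> w) = ev (fst p) (snd p) w" by metis
  have "Q \<in> W"
  proof (rule subdirect_closedD[OF W Q(1), of "(\<lambda>p. (fst p, h p)) ` P"])
    show "finite ((\<lambda>p. (fst p, h p)) ` P)" using P(1) by simp
    show "T \<in> W \<and> mult_map Q T g" if "(T, g) \<in> (\<lambda>p. (fst p, h p)) ` P" for T g
      using that P(2) h(1) sg_hom_mult_map by fastforce
    fix x y assume xy: "x \<in> carrier Q" "y \<in> carrier Q"
      and eq: "\<And>T g. (T, g) \<in> (\<lambda>p. (fst p, h p)) ` P \<Longrightarrow> g x = g y"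
    obtain u v where uv: "u \<in> plus_words A" "v \<in> plus_words A" "x = ev Q \<psi> u" "y = ev Q \<psi> v"
      using xy Q(3) finite_products_eq[OF Qs \<psi>] by auto
    have "ev (fst p) (snd p) u = ev (fst p) (snd p) v" if "p \<in> P" for p
      using eq[of "fst p" "h p"] that uv h(2) by auto
    then have "F u = F v" unfolding F using uv by (auto simp: mev_eq_ev_iff)
    then show "x = y" using Q(4) uv by simp
  qed
  moreover have "\<forall>u\<in>plus_words A. \<forall>v\<in>plus_words A. ev Q \<psi> u = ev Q \<psi> v \<longleftrightarrow> teq W A k u v"
    using Q(4) F teq by auto
  ultimately show thesis using that Q(2,3) by blast
qed

lemma teq_nil:
  assumes "subdirect_closed W" "k \<ge> 1" "teq W A k u v"
  shows "u = [] \<longleftrightarrow> v = []"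
proof -
  \<comment> \<open>The one-element semigroup already separates the empty word, whose value is
    \<open>None\<close>, from all others.\<close>
  define T :: "nat sgrp" where "T = \<lparr>carrier = {0}, smult = (\<lambda>_ _. 0)\<rparr>"
  have "T \<in> fin_sgrps" by (auto simp: T_def fin_sgrps_def is_sgrp_def)
  then have "T \<in> W" by (rule subdirect_closedD[OF assms(1), of _ "{}"]) (auto simp: T_def)
  moreover have "carrier T \<subseteq> {..<k}" "(\<lambda>_. 0) \<in> A \<rightarrow> carrier T" using assms by (auto simp: T_def)
  ultimately have "mev T (\<lambda>_. 0) u = mev T (\<lambda>_. 0) v" using assms(3) by (auto simp: teq_def)
  then show ?thesis by (metis mev_None_iff)
qed

lemma weq_iff_teq:
  assumes W: "subdirect_closed W" and A: "finite A" and l: "u \<in> seqs A" "v \<in> seqs A"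
  shows "weq W A u v \<longleftrightarrow> (\<forall>k. \<forall>\<^sub>F n in uf. teq W A k (u n) (v n))"
proof
  assume uv: "weq W A u v"
  show "\<forall>k. \<forall>\<^sub>F n in uf. teq W A k (u n) (v n)"
  proof
    fix k
    obtain P where P: "finite P" "\<forall>(T, f)\<in>P. T \<in> W \<and> f \<in> A \<rightarrow> carrier T"
      and teq: "\<forall>u\<in>lists A. \<forall>v\<in>lists A. teq W A k u v \<longleftrightarrow> (\<forall>(T, f)\<in>P. mev T f u = mev T f v)"
      using teq_finite_family[OF W A, where k = k] .
    have "\<forall>p\<in>P. \<forall>\<^sub>F n in uf. mev (fst p) (snd p) (u n) = mev (fst p) (snd p) (v n)"
      using uv P(2) by (auto simp: weq_def)
    then have "\<forall>\<^sub>F n in uf. \<forall>p\<in>P. mev (fst p) (snd p) (u n) = mev (fst p) (snd p) (v n)"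
      using P(1) by (simp add: eventually_ball_finite)
    then show "\<forall>\<^sub>F n in uf. teq W A k (u n) (v n)"
    proof eventually_elim
      case (elim n)
      have "u n \<in> lists A" "v n \<in> lists A" using l by auto
      with elim teq show ?case by auto
    qed
  qed
next
  assume t: "\<forall>k. \<forall>\<^sub>F n in uf. teq W A k (u n) (v n)"
  show "weq W A u v"
    unfolding weq_def
  proof (intro ballI)
    fix T f assume T: "T \<in> W" and f: "f \<in> A \<rightarrow> carrier T"
    then have "finite (carrier T)" using W fin_sgrpsD by (auto simp: subdirect_closed_def)
    then obtain k where "carrier T \<subseteq> {..<k}" using finite_nat_iff_bounded by blast
    with T f have imp: "teq W A k (u n) (v n) \<Longrightarrow> mev T f (u n) = mev T f (v n)" for n
      by (auto simp: teq_def)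
    show "\<forall>\<^sub>F n in uf. mev T f (u n) = mev T f (v n)"
      by (rule eventually_mono[OF spec[OF t, of k]]) (rule imp)
  qed
qed

text \<open>Compactness: the congruence has finitely many classes, and the ultrafilter selects
  one.\<close>

lemma teq_class:
  assumes W: "subdirect_closed W" and A: "finite A" and l: "u \<in> seqs A"
  obtains w where "w \<in> lists A" "\<forall>\<^sub>F n in uf. teq W A k (u n) w"
proof -
  obtain P where P: "finite P" "\<forall>(T, f)\<in>P. T \<in> W \<and> f \<in> A \<rightarrow> carrier T"
    and teq: "\<forall>u\<in>lists A. \<forall>v\<in>lists A. teq W A k u v \<longleftrightarrow> (\<forall>(T, f)\<in>P. mev T f u = mev T f v)"
    using teq_finite_family[OF W A, where k = k] .
  have Wf: "W \<subseteq> fin_sgrps" using W by (simp add: subdirect_closed_def)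
  have P': "is_sgrp (fst p)" "finite (carrier (fst p))" "snd p \<in> A \<rightarrow> carrier (fst p)" if "p \<in> P" for p
    using P(2) that Wf fin_sgrpsD by (auto simp: case_prod_unfold)
  define F where "F w = (\<lambda>p\<in>P. mev (fst p) (snd p) w)" for w
  have "F ` lists A \<subseteq> (\<Pi>\<^sub>E p\<in>P. mcar (fst p))"
    unfolding F_def
    by (intro image_subsetI restrict_PiE_iff[THEN iffD2] ballI mev_in[OF P'(1,3)]) auto
  moreover have "finite (\<Pi>\<^sub>E p\<in>P. mcar (fst p))"
    using P(1) P'(2) by (intro finite_PiE) (auto simp: mcar_def)
  ultimately have fin: "finite (F ` lists A)" by (rule finite_subset)
  have "\<forall>\<^sub>F n in uf. \<exists>c\<in>F ` lists A. F (u n) = c" using l by (auto intro!: always_eventually)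
  from ae_bex_finite[OF fin this] obtain w where w: "w \<in> lists A" "\<forall>\<^sub>F n in uf. F (u n) = F w" by blast
  have "\<forall>\<^sub>F n in uf. teq W A k (u n) w"
    using w(2)
  proof eventually_elim
    case (elim n)
    have "mev (fst p) (snd p) (u n) = mev (fst p) (snd p) w" if "p \<in> P" for p
      using fun_cong[OF elim, of p] that by (simp add: F_def)
    moreover have "u n \<in> lists A" using l by auto
    ultimately show ?case using teq w(1) by auto
  qed
  then show thesis using that[OF w(1)] by simp
qed


section \<open>Recognizable languages\<close>

definition saturated :: "nat sgrp set \<Rightarrow> 'a set \<Rightarrow> 'a list set \<Rightarrow> bool" where
  "saturated W A L \<longleftrightarrow> L \<subseteq> lists A \<and> (\<exists>T\<in>W. \<exists>f\<in>A \<rightarrow> carrier T.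
     \<forall>u\<in>lists A. \<forall>v\<in>lists A. mev T f u = mev T f v \<longrightarrow> (u \<in> L \<longleftrightarrow> v \<in> L))"

lemma recognizable_saturated:
  assumes W: "W \<subseteq> fin_sgrps" and r: "recognizable W A L"
  shows "saturated W A L"
proof -
  obtain S \<phi> where S: "S \<in> W" "\<phi> \<in> sg_hom (free_sgrp A) S" "L = {w \<in> plus_words A. \<phi> w \<in> \<phi> ` L}"
    and L: "L \<subseteq> plus_words A" using r by (auto simp: recognizable_def)
  have Ss: "is_sgrp S" using S W fin_sgrpsD by auto
  define f where "f a = \<phi> [a]" for a
  have \<phi>: "\<phi> w \<in> carrier S" if "w \<in> plus_words A" for w
    using S(2) that by (auto simp: sg_hom_def free_sgrp_def)
  have \<phi>m: "\<phi> (u @ v) = smult S (\<phi> u) (\<phi> v)" if "u \<in> plus_words A" "v \<in> plus_words A" for u v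
    using S(2) that by (auto simp: sg_hom_def free_sgrp_def)
  have f: "f \<in> A \<rightarrow> carrier S" using \<phi> by (auto simp: f_def)
  have ev: "ev S f w = \<phi> w" if "w \<in> plus_words A" for w
    using that
  proof (induction w)
    case (Cons a w)
    show ?case
    proof (cases "w = []")
      case True
      then show ?thesis by (simp add: f_def)
    next
      case False
      then have w: "w \<in> plus_words A" "[a] \<in> plus_words A" using Cons by auto
      then show ?thesis using ev_append[OF Ss f, of "[a]" w] \<phi>m[of "[a]" w] Cons.IH[OF w(1)] by (simp add: f_def[of a])
    qed
  qed simp
  have "u \<in> L \<longleftrightarrow> v \<in> L" if uv: "u \<in> lists A" "v \<in> lists A" "mev S f u = mev S f v" for u v
  proof (cases "u = [] \<or> v = []")
    case True
    then show ?thesis using uv(3) L by (metis mev_None_iff)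
  next
    case False
    then have p: "u \<in> plus_words A" "v \<in> plus_words A" using uv by auto
    then have "\<phi> u = \<phi> v" using uv(3) False ev[of u] ev[of v] by (simp add: mev_eq_Some)
    then have "\<phi> u \<in> \<phi> ` L \<longleftrightarrow> \<phi> v \<in> \<phi> ` L" by simp
    moreover have "w \<in> L \<longleftrightarrow> \<phi> w \<in> \<phi> ` L" if "w \<in> plus_words A" for w
      using S(3) that by (metis (mono_tags, lifting) mem_Collect_eq imageI)
    ultimately show ?thesis using p by metis
  qed
  moreover have "L \<subseteq> lists A" using L by auto
  ultimately show ?thesis using S(1) f unfolding saturated_def by metis
qed

lemma saturated_nil:
  assumes W: "subdirect_closed W"
  shows "saturated W A {[]}"
proof -
  define T :: "nat sgrp" where "T = \<lparr>carrier = {0}, smult = (\<lambda>_ _. 0)\<rparr>"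
  have "T \<in> fin_sgrps" by (auto simp: T_def fin_sgrps_def is_sgrp_def)
  then have "T \<in> W" by (rule subdirect_closedD[OF assms(1), of _ "{}"]) (auto simp: T_def)
  moreover have "(\<lambda>_. 0) \<in> A \<rightarrow> carrier T" by (auto simp: T_def)
  moreover have "\<forall>u\<in>lists A. \<forall>v\<in>lists A. mev T (\<lambda>_. 0) u = mev T (\<lambda>_. 0) v \<longrightarrow> (u \<in> {[]} \<longleftrightarrow> v \<in> {[]})"
    by (metis mev_None_iff singleton_iff)
  moreover have "{[]} \<subseteq> lists A" by simp
  ultimately show ?thesis unfolding saturated_def by (intro conjI) (assumption, rule bexI, rule bexI)
qed

lemma saturated_recognizable:
  assumes W: "W \<subseteq> fin_sgrps" and s: "S \<in> W" "f \<in> A \<rightarrow> carrier S" and L: "L \<subseteq> plus_words A"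
    and sat: "\<And>u v. u \<in> L \<Longrightarrow> v \<in> plus_words A \<Longrightarrow> ev S f u = ev S f v \<Longrightarrow> v \<in> L"
  shows "recognizable W A L"
proof -
  have Ss: "is_sgrp S" using s W fin_sgrpsD by auto
  define \<phi> where "\<phi> = (\<lambda>w\<in>plus_words A. ev S f w)"
  have "\<phi> \<in> sg_hom (free_sgrp A) S"
    using ev_in[OF Ss s(2)] ev_append[OF Ss s(2)] by (auto simp: \<phi>_def sg_hom_def free_sgrp_def)
  moreover have "L = {w \<in> plus_words A. \<phi> w \<in> \<phi> ` L}"
  proof (intro equalityI subsetI)
    fix w assume "w \<in> {w \<in> plus_words A. \<phi> w \<in> \<phi> ` L}"
    then obtain u where w: "w \<in> plus_words A" "u \<in> L" "\<phi> w = \<phi> u" by blast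
    then have "ev S f u = ev S f w" using L by (auto simp: \<phi>_def)
    then show "w \<in> L" using w sat by blast
  qed (use L in blast)
  ultimately show ?thesis using s L unfolding recognizable_def by blast
qed

text \<open>Recognisable languages have clopen closures: membership almost everywhere depends on the
  pseudoword and not on the words chosen to represent it.\<close>

lemma saturated_ae:
  assumes L: "saturated W A L" and uv: "weq W A u v" "u \<in> seqs A" "v \<in> seqs A"
    and u: "\<forall>\<^sub>F n in uf. u n \<in> L"
  shows "\<forall>\<^sub>F n in uf. v n \<in> L"
proof -
  obtain T f where T: "T \<in> W" "f \<in> A \<rightarrow> carrier T"
    and sat: "\<And>u v. u\<in>lists A \<Longrightarrow> v\<in>lists A \<Longrightarrow> mev T f u = mev T f v \<Longrightarrow> (u \<in> L \<longleftrightarrow> v \<in> L)"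
    using L unfolding saturated_def by blast
  have "\<forall>\<^sub>F n in uf. mev T f (u n) = mev T f (v n)" using uv(1) T by (auto simp: weq_def)
  with u show ?thesis
  proof eventually_elim
    case (elim n)
    then show ?case using sat[of "u n" "v n"] uv by blast
  qed
qed


section \<open>Bideterministic products of pseudowords\<close>

lemma wpow_Nil [simp]: "wpow [] n = []"
  by (simp add: wpow_def)

lemma Rabsorb_weq:
  assumes "W \<subseteq> fin_sgrps" "Rabsorb W A t a" "weq W A x t" "t \<in> seqs A" "x \<in> seqs A" "a \<in> A"
  shows "Rabsorb W A x a"
  using Rabsorb_prepend[OF assms(1,2), of x "\<lambda>n. []"] assms by simp

lemma Labsorb_weq:
  assumes "W \<subseteq> fin_sgrps" "Labsorb W A a t" "weq W A x t" "t \<in> seqs A" "x \<in> seqs A" "a \<in> A"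
  shows "Labsorb W A a x"
  using Labsorb_append[OF assms(1,2), of x "\<lambda>n. []"] assms by simp

text \<open>The words in the \<open>k\<close>-th basic neighbourhood of the pseudoword given by
  \<open>x\<close>.\<close>

definition limit_class :: "nat sgrp set \<Rightarrow> 'a set \<Rightarrow> nat \<Rightarrow> (nat \<Rightarrow> 'a list) \<Rightarrow> 'a list set" where
  "limit_class V A k x = {w \<in> lists A. \<forall>\<^sub>F n in uf. teq V A k (x n) w}"

lemma limit_class_antimono: "j \<le> k \<Longrightarrow> limit_class V A k x \<subseteq> limit_class V A j x"
  by (auto simp: limit_class_def elim: eventually_mono intro: teq_mono)

context
  fixes V :: "nat sgrp set" and A :: "'a set"
  assumes V: "subdirect_closed V" and A: "finite A"
begin

lemma limit_class_eq:
  assumes "x \<in> seqs A"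
  obtains w where "w \<in> lists A" "limit_class V A k x = {v \<in> lists A. teq V A k w v}"
    "\<forall>\<^sub>F n in uf. teq V A k (x n) w"
proof -
  obtain w where w: "w \<in> lists A" "\<forall>\<^sub>F n in uf. teq V A k (x n) w"
    using teq_class[OF V A assms] .
  have "(\<forall>\<^sub>F n in uf. teq V A k (x n) v) \<longleftrightarrow> teq V A k w v" for v
  proof
    assume "\<forall>\<^sub>F n in uf. teq V A k (x n) v"
    with w(2) have "\<forall>\<^sub>F n in uf. teq V A k w v"
      by eventually_elim (blast intro: teq_sym teq_trans)
    then show "teq V A k w v" by simp
  next
    assume "teq V A k w v"
    with w(2) show "\<forall>\<^sub>F n in uf. teq V A k (x n) v"
      by (auto elim!: eventually_mono intro: teq_trans)
  qed
  then show thesis using that[OF w(1) _ w(2)] by (simp add: limit_class_def)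
qed

lemma limit_class_self:
  assumes "x \<in> seqs A"
  shows "\<forall>\<^sub>F n in uf. x n \<in> limit_class V A k x"
proof -
  obtain w where w: "w \<in> lists A" "limit_class V A k x = {v \<in> lists A. teq V A k w v}"
    "\<forall>\<^sub>F n in uf. teq V A k (x n) w" using limit_class_eq[OF assms] .
  from w(3) show ?thesis
    by (rule eventually_mono) (use w(2) assms teq_sym in auto)
qed

text \<open>Convergence along varying neighbourhoods: the level \<kappa> may depend on n as long as
  it exceeds every bound almost everywhere. All diagonal arguments end here.\<close>

lemma limit_class_weq:
  assumes l: "x \<in> seqs A" "u \<in> seqs A" and u: "\<forall>\<^sub>F n in uf. u n \<in> limit_class V A (\<kappa> n) x"
    and \<kappa>: "\<And>k. \<forall>\<^sub>F n in uf. k \<le> \<kappa> n"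
  shows "weq V A u x"
  unfolding weq_iff_teq[OF V A l(2,1)]
proof
  fix k
  obtain w where w: "w \<in> lists A" "limit_class V A k x = {v \<in> lists A. teq V A k w v}"
    "\<forall>\<^sub>F n in uf. teq V A k (x n) w" using limit_class_eq[OF l(1)] .
  from u \<kappa>[of k] w(3) show "\<forall>\<^sub>F n in uf. teq V A k (u n) (x n)"
  proof eventually_elim
    case (elim n)
    then have "u n \<in> limit_class V A k x" using limit_class_antimono by blast
    then show ?case using w(2) elim(3) by (auto intro: teq_sym teq_trans)
  qed
qed

lemma limit_class_recognizable:
  assumes x: "x \<in> seqs A" and k: "k \<ge> 1" and ne: "A \<noteq> {}"
  shows "recognizable V A (limit_class V A k x) \<or> limit_class V A k x = {[]}"
proof -
  obtain w where w: "w \<in> lists A" "limit_class V A k x = {v \<in> lists A. teq V A k w v}"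
    "\<forall>\<^sub>F n in uf. teq V A k (x n) w" using limit_class_eq[OF x] .
  show ?thesis
  proof (cases "w = []")
    case True
    then have "limit_class V A k x = {[]}"
      using w teq_nil[OF V k, of A w] by auto
    then show ?thesis ..
  next
    case False
    then have L: "limit_class V A k x \<subseteq> plus_words A"
      using w teq_nil[OF V k, of A w] by auto
    obtain Q \<psi> where Q: "Q \<in> V" "\<psi> \<in> A \<rightarrow>\<^sub>E carrier Q" "carrier Q = finite_products Q (\<psi> ` A)"
      "\<forall>u\<in>plus_words A. \<forall>v\<in>plus_words A. ev Q \<psi> u = ev Q \<psi> v \<longleftrightarrow> teq V A k u v"
      using teq_quotient[OF V A ne] .
    have "recognizable V A (limit_class V A k x)"
    proof (rule saturated_recognizable[OF _ Q(1) _ L])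
      show "V \<subseteq> fin_sgrps" using V by (simp add: subdirect_closed_def)
      show "\<psi> \<in> A \<rightarrow> carrier Q" using Q(2) by auto
      fix u v assume u: "u \<in> limit_class V A k x" and v: "v \<in> plus_words A" and e: "ev Q \<psi> u = ev Q \<psi> v"
      have "u \<in> plus_words A" using u L by blast
      then have "teq V A k u v" using Q(4) v e by blast
      then show "v \<in> limit_class V A k x" using u v w(2) by (auto intro: teq_trans)
    qed
    then show ?thesis ..
  qed
qed

text \<open>If the code property failed at arbitrarily high levels, there would be u and u a z in
  the k-th neighbourhood of x for every k. In the limit x = x a z modulo \<open>V\<close>, which is
  absorption. The suffix version is dual.\<close>

lemma limit_class_prefix_code:
  assumes x: "x \<in> seqs A" and a: "a \<in> A" and R: "\<not> Rabsorb V A x a"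
  shows "\<exists>k0. \<forall>k\<ge>k0. prefix_code A {u @ [a] |u. u \<in> limit_class V A k x}"
proof (rule ccontr)
  assume neg: "\<not> ?thesis"
  have Vf: "V \<subseteq> fin_sgrps" using V by (simp add: subdirect_closed_def)
  have "\<exists>u\<in>lists A. \<exists>z\<in>lists A. u \<in> limit_class V A k x \<and> u @ a # z \<in> limit_class V A k x" for k
  proof -
    obtain j where j: "j \<ge> k" "\<not> prefix_code A {u @ [a] |u. u \<in> limit_class V A j x}"
      using neg by blast
    have "{u @ [a] |u. u \<in> limit_class V A j x} \<subseteq> lists A" using a by (auto simp: limit_class_def)
    then obtain u v t where uv: "u \<in> limit_class V A j x" "v \<in> limit_class V A j x" "t \<in> lists A" "t \<noteq> []"
      "(u @ [a]) @ t = v @ [a]"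
      using j(2) unfolding prefix_code_def by blast
    then obtain z where "t = z @ [a]" "v = u @ a # z" by (cases t rule: rev_cases) auto
    then have "u @ a # z \<in> limit_class V A k x" "u \<in> limit_class V A k x"
      using uv limit_class_antimono[OF j(1), of V A x] by auto
    moreover from this have "u \<in> lists A" "z \<in> lists A" by (auto simp: limit_class_def)
    ultimately show ?thesis by blast
  qed
  then obtain u z where uz: "\<And>k. u k \<in> lists A" "\<And>k. z k \<in> lists A"
    "\<And>k. u k \<in> limit_class V A k x" "\<And>k. u k @ a # z k \<in> limit_class V A k x" by metis
  have l: "u \<in> seqs A" "z \<in> seqs A" using uz by (auto simp: seqs_def)
  have k: "\<forall>\<^sub>F n in uf. k \<le> n" for k by (rule ae_ge)
  have "weq V A u x" by (rule limit_class_weq[OF x l(1) _ k]) (simp add: uz)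
  moreover have "weq V A (\<lambda>n. u n @ a # z n) x"
    by (rule limit_class_weq[OF x _ _ k]) (use l a uz in simp_all)
  moreover have "weq V A (\<lambda>n. u n @ a # z n) (\<lambda>n. x n @ a # z n)"
    by (rule weq_congl[OF Vf \<open>weq V A u x\<close>]) (use l x a in simp_all)
  ultimately have "weq V A x (\<lambda>n. x n @ a # z n)" using weq_sym weq_trans by blast
  then show False using R l by (auto simp: Rabsorb_def)
qed

lemma limit_class_suffix_code:
  assumes y: "y \<in> seqs A" and a: "a \<in> A" and L: "\<not> Labsorb V A a y"
  shows "\<exists>k0. \<forall>k\<ge>k0. suffix_code A {[a] @ v |v. v \<in> limit_class V A k y}"
proof (rule ccontr)
  assume neg: "\<not> ?thesis"
  have Vf: "V \<subseteq> fin_sgrps" using V by (simp add: subdirect_closed_def)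
  have "\<exists>u\<in>lists A. \<exists>z\<in>lists A. u \<in> limit_class V A k y \<and> z @ a # u \<in> limit_class V A k y" for k
  proof -
    obtain j where j: "j \<ge> k" "\<not> suffix_code A {[a] @ u |u. u \<in> limit_class V A j y}"
      using neg by blast
    have "{[a] @ u |u. u \<in> limit_class V A j y} \<subseteq> lists A" using a by (auto simp: limit_class_def)
    then obtain u v t where uv: "u \<in> limit_class V A j y" "v \<in> limit_class V A j y" "t \<in> lists A" "t \<noteq> []"
      "t @ ([a] @ u) = [a] @ v"
      using j(2) unfolding suffix_code_def by blast
    then obtain z where "t = a # z" "v = z @ a # u" by (cases t) auto
    then have "z @ a # u \<in> limit_class V A k y" "u \<in> limit_class V A k y"
      using uv limit_class_antimono[OF j(1), of V A y] by auto
    moreover from this have "u \<in> lists A" "z \<in> lists A" by (auto simp: limit_class_def)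
    ultimately show ?thesis by blast
  qed
  then obtain u z where uz: "\<And>k. u k \<in> lists A" "\<And>k. z k \<in> lists A"
    "\<And>k. u k \<in> limit_class V A k y" "\<And>k. z k @ a # u k \<in> limit_class V A k y" by metis
  have l: "u \<in> seqs A" "z \<in> seqs A" using uz by (auto simp: seqs_def)
  have k: "\<forall>\<^sub>F n in uf. k \<le> n" for k by (rule ae_ge)
  have "weq V A u y" by (rule limit_class_weq[OF y l(1) _ k]) (simp add: uz)
  moreover have "weq V A (\<lambda>n. z n @ a # u n) y"
    by (rule limit_class_weq[OF y _ _ k]) (use l a uz in simp_all)
  moreover have "weq V A (\<lambda>n. z n @ a # u n) (\<lambda>n. z n @ a # y n)"
    using weq_congr[OF Vf \<open>weq V A u y\<close>, of "\<lambda>n. z n @ [a]"] l y a by (simp add: seqs_def)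
  ultimately have "weq V A y (\<lambda>n. z n @ a # y n)" using weq_sym weq_trans by blast
  then show False using L l by (auto simp: Labsorb_def)
qed

end

text \<open>Small neighbourhoods of \<open>x\<close> and \<open>y\<close> satisfy the code conditions, so their bideterministic
  product is a neighbourhood of \<open>x a y\<close>; a diagonal argument over a base of neighbourhoods then
  factorises every pseudoword with the same value.\<close>

lemma bideterministic_factorization:
  fixes A :: "nat set"
  assumes V: "subdirect_closed V" and bd: "closed_under_bideterministic_product V"
    and A: "finite A" "a \<in> A" and l: "x \<in> seqs A" "y \<in> seqs A" "r \<in> seqs A"
    and R: "\<not> Rabsorb V A x a" and L: "\<not> Labsorb V A a y"
    and eq: "weq V A r (\<lambda>n. x n @ a # y n)"
  obtains r0 r1 where "r0 \<in> seqs A" "r1 \<in> seqs A" "\<forall>\<^sub>F n in uf. r n = r0 n @ a # r1 n"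
    "weq V A r0 x" "weq V A r1 y"
proof -
  have Vf: "V \<subseteq> fin_sgrps" using V by (simp add: subdirect_closed_def)
  obtain k1 where k1: "\<forall>k\<ge>k1. prefix_code A {u @ [a] |u. u \<in> limit_class V A k x}"
    using limit_class_prefix_code[OF V A(1) l(1) A(2) R] by blast
  obtain k2 where k2: "\<forall>k\<ge>k2. suffix_code A {[a] @ v |v. v \<in> limit_class V A k y}"
    using limit_class_suffix_code[OF V A(1) l(2) A(2) L] by blast
  \<comment> \<open>Beyond both code thresholds, and positive so that the classes are recognisable
    or \<open>{[]}\<close>.\<close>
  define k0 where "k0 = Suc (k1 + k2)"
  define M where "M k = {u @ [a] @ v |u v. u \<in> limit_class V A k x \<and> v \<in> limit_class V A k y}" for k
  have M: "\<forall>\<^sub>F n in uf. r n \<in> M k" if k: "k \<ge> k0" for k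
  proof -
    have "recognizable V A (M k)"
    proof -
      have "recognizable V A (limit_class V A k x) \<or> limit_class V A k x = {[]}"
        "recognizable V A (limit_class V A k y) \<or> limit_class V A k y = {[]}"
        using limit_class_recognizable[OF V A(1) l(1), of k]
          limit_class_recognizable[OF V A(1) l(2), of k] A k by (auto simp: k0_def)
      moreover have "prefix_code A {u @ [a] |u. u \<in> limit_class V A k x} \<and>
        suffix_code A {[a] @ v |v. v \<in> limit_class V A k y}"
        using k1 k2 k by (auto simp: k0_def)
      ultimately have "finite A \<and> a \<in> A \<and>
          (recognizable V A (limit_class V A k x) \<or> limit_class V A k x = {[]}) \<and>
          (recognizable V A (limit_class V A k y) \<or> limit_class V A k y = {[]}) \<and>
          prefix_code A {u @ [a] |u. u \<in> limit_class V A k x} \<and>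
          suffix_code A {[a] @ v |v. v \<in> limit_class V A k y}" using A by simp
      then show ?thesis
        unfolding M_def by (rule bd[unfolded closed_under_bideterministic_product_def,
              THEN spec, THEN spec, THEN spec, THEN spec, THEN mp])
    qed
    then have sat: "saturated V A (M k)" by (rule recognizable_saturated[OF Vf])
    have "\<forall>\<^sub>F n in uf. x n @ a # y n \<in> M k"
      using limit_class_self[OF V A(1) l(1), of k] limit_class_self[OF V A(1) l(2), of k]
      by eventually_elim (force simp: M_def)
    then show ?thesis using saturated_ae[OF sat weq_sym[OF eq]] l A(2) by simp
  qed
  \<comment> \<open>The finest level up to n at which \<open>r n\<close> factorises as required. The
    value 0 is a default for indices without such a level; almost everywhere \<kappa> is at least 1,
    hence a genuine level.\<close>
  define \<kappa> where "\<kappa> n = Max (insert 0 {k. k0 \<le> k \<and> k \<le> n \<and> r n \<in> M k})" for n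
  have fin: "finite {k. k0 \<le> k \<and> k \<le> n \<and> r n \<in> M k}" for n
    by (rule finite_subset[of _ "{..n}"]) auto
  have \<kappa>: "\<forall>\<^sub>F n in uf. k \<le> \<kappa> n" for k
  proof -
    have "\<forall>\<^sub>F n in uf. r n \<in> M (max k k0)" by (rule M) simp
    moreover have "\<forall>\<^sub>F n in uf. max k k0 \<le> n" by (rule ae_ge)
    ultimately show ?thesis
    proof eventually_elim
      case (elim n)
      then have "max k k0 \<le> \<kappa> n" unfolding \<kappa>_def using fin by (intro Max_ge) auto
      then show ?case by simp
    qed
  qed
  have "\<forall>\<^sub>F n in uf. r n \<in> M (\<kappa> n)"
    using \<kappa>[of 1]
  proof eventually_elim
    case (elim n)
    have "\<kappa> n \<in> insert 0 {k. k0 \<le> k \<and> k \<le> n \<and> r n \<in> M k}"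
      unfolding \<kappa>_def using fin by (intro Max_in) auto
    with elim show ?case by auto
  qed
  then have "\<forall>\<^sub>F n in uf. \<exists>u\<in>lists A. \<exists>v\<in>lists A. r n = u @ a # v \<and>
      u \<in> limit_class V A (\<kappa> n) x \<and> v \<in> limit_class V A (\<kappa> n) y"
    by eventually_elim (force simp: M_def limit_class_def)
  from ae_seqs[OF this] obtain r0 where r0: "r0 \<in> seqs A" "\<forall>\<^sub>F n in uf. \<exists>v\<in>lists A. r n = r0 n @ a # v \<and>
      r0 n \<in> limit_class V A (\<kappa> n) x \<and> v \<in> limit_class V A (\<kappa> n) y" by blast
  from ae_seqs[OF r0(2)] obtain r1 where r1: "r1 \<in> seqs A" "\<forall>\<^sub>F n in uf. r n = r0 n @ a # r1 n \<and>
      r0 n \<in> limit_class V A (\<kappa> n) x \<and> r1 n \<in> limit_class V A (\<kappa> n) y" by blast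
  have *: "\<forall>\<^sub>F n in uf. r n = r0 n @ a # r1 n" "\<forall>\<^sub>F n in uf. r0 n \<in> limit_class V A (\<kappa> n) x"
    "\<forall>\<^sub>F n in uf. r1 n \<in> limit_class V A (\<kappa> n) y"
    using r1(2) by (auto elim: eventually_mono)
  show thesis
    using that[OF r0(1) r1(1) *(1)] limit_class_weq[OF V A(1) l(1) r0(1) *(2) \<kappa>]
      limit_class_weq[OF V A(1) l(2) r1(1) *(3) \<kappa>] by blast
qed


section \<open>Minimal factorisations\<close>

text \<open>To be applied with \<open>W\<close> = \<open>mreg_models V\<close>; the last assumption
  is the only link by which an equality valid in \<open>V\<close> can be lifted to
  \<open>W\<close>.\<close>

locale multiregular_consequences =
  fixes V W :: "nat sgrp set" and A :: "nat set"
  assumes V: "subdirect_closed V" and bd: "closed_under_bideterministic_product V"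
    and VW: "V \<subseteq> W" and WDS: "W \<subseteq> DS" and A: "finite A"
    and mreg_weq: "\<And>g g'. g \<in> mreg A \<Longrightarrow> g' \<in> mreg A \<Longrightarrow> weq V A g g' \<Longrightarrow> weq W A g g'"
begin

lemma Vf: "V \<subseteq> fin_sgrps" and Wf: "W \<subseteq> fin_sgrps"
  using V WDS by (auto simp: subdirect_closed_def DS_def)

lemmas factor = bideterministic_factorization[OF V bd A]

text \<open>Minimality is measured modulo \<open>W\<close>, where equality has to be proved. An
  absorption found modulo \<open>V\<close> must therefore first be lifted to \<open>W\<close> before
  it contradicts minimality.\<close>

definition kmin :: "nat \<Rightarrow> (nat \<Rightarrow> nat list) \<Rightarrow> bool" where
  "kmin k u \<longleftrightarrow> Fac A k u \<and> (\<forall>k' u'. Fac A k' u' \<and> weq W A u u' \<longrightarrow> k \<le> k')"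

lemma kminD: "kmin k u \<Longrightarrow> Fac A k u" "kmin k u \<Longrightarrow> Fac A k' u' \<Longrightarrow> weq W A u u' \<Longrightarrow> k \<le> k'"
  by (auto simp: kmin_def)

lemma kmin_parts:
  assumes "kmin (Suc (i + j)) (\<lambda>n. x n @ a # y n)" "Fac A i x" "Fac A j y" "a \<in> A"
  shows "kmin i x" "kmin j y"
proof -
  have l: "x \<in> seqs A" "y \<in> seqs A" using assms Fac_seqs by auto
  have "i \<le> k'" if "Fac A k' u" "weq W A x u" for k' u
  proof -
    have "weq W A (\<lambda>n. x n @ a # y n) (\<lambda>n. u n @ a # y n)"
      by (rule weq_congl[OF Wf that(2)]) (use l assms Fac_seqs[OF that(1)] in simp_all)
    from kminD(2)[OF assms(1) Fac_join[OF that(1) assms(4,3)] this] show ?thesis by simp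
  qed
  then show "kmin i x" using assms by (auto simp: kmin_def)
  have "j \<le> k'" if "Fac A k' u" "weq W A y u" for k' u
  proof -
    have "weq W A (\<lambda>n. x n @ a # y n) (\<lambda>n. x n @ a # u n)"
      using weq_congr[OF Wf that(2), of "\<lambda>n. x n @ [a]"] l assms Fac_seqs[OF that(1)]
      by (simp add: seqs_def)
    from kminD(2)[OF assms(1) Fac_join[OF assms(2,4) that(1)] this] show ?thesis by simp
  qed
  then show "kmin j y" using assms by (auto simp: kmin_def)
qed

text \<open>From m = m a z modulo \<open>V\<close> follows m = m (a z)^(\<omega>+1), now an equality
  of two multiregular sequences, so it lifts to \<open>W\<close>. There m a = m (a z)^\<omega> a,
  and the right side is multiregular: the letter has disappeared.\<close>

lemma absorb_right:
  assumes m: "m \<in> mreg A" and a: "a \<in> A" and R: "Rabsorb V A m a"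
  obtains m' where "m' \<in> mreg A" "weq W A (\<lambda>n. m n @ [a]) m'"
proof -
  obtain z where z: "z \<in> seqs A" "weq V A m (\<lambda>n. m n @ a # z n)" using R by (auto simp: Rabsorb_def)
  define t where "t n = a # z n" for n
  have t: "t \<in> seqs A" using z a by (simp add: t_def[abs_def])
  have ml: "m \<in> seqs A" using m by (rule mreg_seqs)
  have l: "m n \<in> lists A" "t n \<in> lists A" for n using ml t by auto
  \<comment> \<open>The bare product m t need not be multiregular; the power of \<open>t\<close>
    makes it so without changing its value modulo \<open>V\<close>.\<close>
  define g where "g n = m n @ (wpow (t n @ []) (fact n) @ t n)" for n
  have g: "g \<in> mreg A"
    unfolding g_def[abs_def]
    by (intro mreg_append[OF m] mreg_single) (use z a in \<open>simp_all add: t_def\<close>)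
  have "weq V A m g"
    unfolding weq_def
  proof (intro ballI)
    fix T f assume T: "T \<in> V" and f: "f \<in> A \<rightarrow> carrier T"
    interpret finite_eval T f A using T f Vf by (intro finite_eval_fin) auto
    have "\<forall>\<^sub>F n in uf. E (m n) = E (m n @ t n)" using z T f by (auto simp: weq_def t_def)
    then show "\<forall>\<^sub>F n in uf. E (m n) = E (g n)"
    proof eventually_elim
      case (elim n)
      then have "E (m n) = E (wpow [] (Suc (fact n)) @ m n @ wpow (t n) (Suc (fact n)))"
        by (intro iterate) (use l in simp_all)
      then show ?case by (simp add: g_def wpow_Suc2)
    qed
  qed
  then have mg: "weq W A m g" by (rule mreg_weq[OF m g])
  have "weq W A (\<lambda>n. m n @ [a]) (\<lambda>n. m n @ (wpow ([a] @ z n) (fact n) @ [a]))"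
    unfolding weq_def
  proof (intro ballI)
    fix T f assume T: "T \<in> W" and f: "f \<in> A \<rightarrow> carrier T"
    interpret finite_eval T f A using T f Wf by (intro finite_eval_fin) auto
    have "\<forall>\<^sub>F n in uf. E (m n) = E (g n)" using mg T f by (auto simp: weq_def)
    moreover have "\<forall>\<^sub>F n in uf. stab T \<le> n" by (rule ae_ge)
    ultimately show "\<forall>\<^sub>F n in uf. E (m n @ [a]) = E (m n @ (wpow ([a] @ z n) (fact n) @ [a]))"
    proof eventually_elim
      case (elim n)
      let ?N = "fact n :: nat"
      have lw: "wpow (t n) k \<in> lists A" for k by (rule wpow_lists[OF l(2)])
      have 1: "E (m n) = E (m n @ wpow (t n) (Suc ?N))"
        using elim(1) by (simp add: g_def wpow_Suc2)
      have "E (m n @ wpow (t n) ?N) = E ((m n @ wpow (t n) (Suc ?N)) @ wpow (t n) ?N)"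
        by (rule rwl[OF 1]) (use l lw in simp_all)
      also have "\<dots> = E (m n @ wpow (t n) (Suc ?N + ?N))" by (simp only: wpow_add append_assoc)
      also have "\<dots> = E (m n @ wpow (t n) (Suc ?N))"
        using l lw elim(2) fact_ge_self[of n] by (intro rwr pow_stable) simp_all
      finally have "E (m n) = E (m n @ wpow (t n) ?N)" using 1 by simp
      then have "E (m n @ [a]) = E ((m n @ wpow (t n) ?N) @ [a])"
        by (rule rwl) (use l lw a in simp_all)
      then show ?case by (simp add: t_def)
    qed
  qed
  moreover have "(\<lambda>n. m n @ (wpow ([a] @ z n) (fact n) @ [a])) \<in> mreg A"
    by (intro mreg_append[OF m] mreg_single) (use z a in \<open>simp_all add: seqs_def\<close>)
  ultimately show thesis using that by blast
qed

lemma absorb_left: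
  assumes m: "m \<in> mreg A" and a: "a \<in> A" and L: "Labsorb V A a m"
  obtains m' where "m' \<in> mreg A" "weq W A (\<lambda>n. a # m n) m'"
proof -
  obtain z where z: "z \<in> seqs A" "weq V A m (\<lambda>n. z n @ a # m n)" using L by (auto simp: Labsorb_def)
  define t where "t n = z n @ [a]" for n
  have t: "t \<in> seqs A" using z a by (simp add: t_def[abs_def])
  have ml: "m \<in> seqs A" using m by (rule mreg_seqs)
  have l: "m n \<in> lists A" "t n \<in> lists A" for n using ml t by auto
  define g where "g n = (wpow (t n @ []) (fact n) @ t n) @ m n" for n
  have g: "g \<in> mreg A"
    unfolding g_def[abs_def]
    by (intro mreg.Cons m) (use z a in \<open>simp_all add: t_def\<close>)
  have "weq V A m g"
    unfolding weq_def
  proof (intro ballI)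
    fix T f assume T: "T \<in> V" and f: "f \<in> A \<rightarrow> carrier T"
    interpret finite_eval T f A using T f Vf by (intro finite_eval_fin) auto
    have "\<forall>\<^sub>F n in uf. E (m n) = E (t n @ m n)" using z T f by (auto simp: weq_def t_def)
    then show "\<forall>\<^sub>F n in uf. E (m n) = E (g n)"
    proof eventually_elim
      case (elim n)
      then have "E (m n) = E (wpow (t n) (Suc (fact n)) @ m n @ wpow [] (Suc (fact n)))"
        by (intro iterate) (use l in simp_all)
      then show ?case by (simp add: g_def wpow_Suc2)
    qed
  qed
  then have mg: "weq W A m g" by (rule mreg_weq[OF m g])
  have "weq W A (\<lambda>n. a # m n) (\<lambda>n. (wpow ([a] @ z n) (fact n) @ [a]) @ m n)"
    unfolding weq_def
  proof (intro ballI)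
    fix T f assume T: "T \<in> W" and f: "f \<in> A \<rightarrow> carrier T"
    interpret finite_eval T f A using T f Wf by (intro finite_eval_fin) auto
    have "\<forall>\<^sub>F n in uf. E (m n) = E (g n)" using mg T f by (auto simp: weq_def)
    moreover have "\<forall>\<^sub>F n in uf. stab T \<le> n" by (rule ae_ge)
    ultimately show "\<forall>\<^sub>F n in uf. E (a # m n) = E ((wpow ([a] @ z n) (fact n) @ [a]) @ m n)"
    proof eventually_elim
      case (elim n)
      let ?N = "fact n :: nat"
      have lw: "wpow (t n) k \<in> lists A" for k by (rule wpow_lists[OF l(2)])
      have 1: "E (m n) = E (wpow (t n) (Suc ?N) @ m n)"
        using elim(1) by (simp add: g_def wpow_Suc2)
      have "E (wpow (t n) ?N @ m n) = E (wpow (t n) ?N @ (wpow (t n) (Suc ?N) @ m n))"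
        by (rule rwr[OF 1]) (use l lw in simp_all)
      also have "\<dots> = E (wpow (t n) (Suc ?N + ?N) @ m n)"
        by (simp only: wpow_add append_assoc add.commute[of "Suc ?N"])
      also have "\<dots> = E (wpow (t n) (Suc ?N) @ m n)"
        using l lw elim(2) fact_ge_self[of n] by (intro rwl pow_stable) simp_all
      finally have "E (m n) = E (wpow (t n) ?N @ m n)" using 1 by simp
      then have "E ([a] @ m n) = E ([a] @ (wpow (t n) ?N @ m n))"
        by (rule rwr) (use l lw a in simp_all)
      \<comment> \<open>Conjugation moves the letter to the end of the power, giving the shape (r
        z)^\<omega> r required by \<open>mreg\<close>.\<close>
      moreover have "[a] @ wpow (t n) ?N = wpow ([a] @ z n) ?N @ [a]"
        using wpow_conj[of "[a]" "z n" ?N] by (simp add: t_def)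
      ultimately show ?case by (metis append.assoc append_Cons append_Nil)
    qed
  qed
  moreover have "(\<lambda>n. (wpow ([a] @ z n) (fact n) @ [a]) @ m n) \<in> mreg A"
    by (intro mreg.Cons m) (use z a in \<open>simp_all add: seqs_def\<close>)
  ultimately show thesis using that by blast
qed

text \<open>If the two marked letters stood at different places, one prefix would extend the other
  beyond b. The prefixes agree modulo \<open>V\<close>, so x would absorb b.\<close>

lemma factor_unique_right:
  assumes R: "\<not> Rabsorb V A x b" and r: "weq V A r x"
    and eq: "\<forall>\<^sub>F n in uf. x n @ b # w n = r n @ b # v n"
    and l: "x \<in> seqs A" "r \<in> seqs A" "w \<in> seqs A" "v \<in> seqs A" "b \<in> A"
  shows "\<forall>\<^sub>F n in uf. w n = v n"
  using eq l(1,3,2,4)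
proof (cases rule: ae_compare)
  case (less s)
  have "weq V A x r" using r by (rule weq_sym)
  also have "weq V A r (\<lambda>n. x n @ b # s n)" by (rule weq_ae) fact
  finally show ?thesis using R less by (auto simp: Rabsorb_def)
next
  case (greater s)
  have "weq V A x (\<lambda>n. r n @ b # s n)" by (rule weq_ae) fact
  also have "weq V A \<dots> (\<lambda>n. x n @ b # s n)"
    by (rule weq_congl[OF Vf r]) (use l greater in simp_all)
  finally show ?thesis using R greater by (auto simp: Rabsorb_def)
qed

lemma factor_unique_left:
  assumes L: "\<not> Labsorb V A b y" and r: "weq V A r y"
    and eq: "\<forall>\<^sub>F n in uf. w n @ b # y n = v n @ b # r n"
    and l: "y \<in> seqs A" "r \<in> seqs A" "w \<in> seqs A" "v \<in> seqs A" "b \<in> A"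
  shows "\<forall>\<^sub>F n in uf. w n = v n"
  using eq l(3,1,4,2)
proof (cases rule: ae_compare)
  case (less s)
  have "weq V A y (\<lambda>n. s n @ b # r n)" by (rule weq_ae) fact
  also have "weq V A \<dots> (\<lambda>n. s n @ b # y n)"
    using weq_congr[OF Vf r, of "\<lambda>n. s n @ [b]"] l less by (simp add: seqs_def)
  finally show ?thesis using L less by (auto simp: Labsorb_def)
next
  case (greater s)
  have "weq V A y r" using r by (rule weq_sym)
  also have "weq V A r (\<lambda>n. s n @ b # y n)" by (rule weq_ae) fact
  finally show ?thesis using L greater by (auto simp: Labsorb_def)
qed

text \<open>A letter of a minimal factorisation cannot be absorbed modulo \<open>V\<close>: by the factorisation lemma
  an absorption already takes place in the neighbouring multiregular factor, and then holds modulo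
  \<open>W\<close>, so that the letter is superfluous.\<close>

lemma kmin_not_absorb:
  assumes "kmin (Suc (i + j)) (\<lambda>n. x n @ a # y n)" "Fac A i x" "Fac A j y" "a \<in> A"
  shows "\<not> Rabsorb V A x a \<and> \<not> Labsorb V A a y"
  using assms
proof (induction "i + j" arbitrary: i j x a y rule: less_induct)
  case less
  note a = less.prems(4)
  note parts = kmin_parts[OF less.prems]
  have l: "x \<in> seqs A" "y \<in> seqs A" using less.prems Fac_seqs by auto
  have "\<not> Rabsorb V A x a"
  proof
    assume R: "Rabsorb V A x a"
    show False
    proof (cases i)
      case 0
      then have "x \<in> mreg A" using less.prems(2) by (auto elim: Fac.cases)
      from absorb_right[OF this a R] obtain m' where
        m': "m' \<in> mreg A" "weq W A (\<lambda>n. x n @ [a]) m'" .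
      have "weq W A (\<lambda>n. (x n @ [a]) @ y n) (\<lambda>n. m' n @ y n)"
        by (rule weq_congl[OF Wf m'(2)]) (use l a mreg_seqs[OF m'(1)] in simp_all)
      then have "weq W A (\<lambda>n. x n @ a # y n) (\<lambda>n. m' n @ y n)" by simp
      from kminD(2)[OF less.prems(1) Fac_prepend[OF less.prems(3) m'(1)] this] 0 show False by simp
    next
      case (Suc i')
      from Fac_snoc[OF less.prems(2) this] obtain x' b m where
        x': "Fac A i' x'" "b \<in> A" "m \<in> mreg A" "x = (\<lambda>n. x' n @ b # m n)" by blast
      have l': "x' \<in> seqs A" "m \<in> seqs A" using x' Fac_seqs mreg_seqs by auto
      have IH: "\<not> Rabsorb V A x' b \<and> \<not> Labsorb V A b m"
        by (rule less.hyps[of i' 0]) (use Suc x' parts Fac.zero in simp_all)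
      obtain z where z: "z \<in> seqs A" "weq V A x (\<lambda>n. x n @ a # z n)"
        using R by (auto simp: Rabsorb_def)
      have "weq V A (\<lambda>n. x n @ a # z n) (\<lambda>n. x' n @ b # m n)"
        using weq_sym[OF z(2)] x'(4) by simp
      \<comment> \<open>By induction the letter \<open>b\<close> marks a bideterministic product
        with value x, so the equal pseudoword x a z is cut at a corresponding \<open>b\<close>. The
        cut is unique, hence it is the visible one, and m = m a z modulo \<open>V\<close>.\<close>
      from factor[OF x'(2) l' _ _ _ this] IH l z a
      obtain r0 r1 where r: "r0 \<in> seqs A" "r1 \<in> seqs A" "\<forall>\<^sub>F n in uf. x n @ a # z n = r0 n @ b # r1 n"
        "weq V A r0 x'" "weq V A r1 m" by auto
      have "\<forall>\<^sub>F n in uf. m n @ a # z n = r1 n"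
        by (rule factor_unique_right[of x' b r0]) (use IH r x' l' z a in simp_all)
      then have "weq V A m (\<lambda>n. m n @ a # z n)"
        by (intro weq_sym[OF weq_trans[OF weq_ae r(5)]])
      then have "Rabsorb V A m a" using z by (auto simp: Rabsorb_def)
      from absorb_right[OF x'(3) a this] obtain m' where
        m': "m' \<in> mreg A" "weq W A (\<lambda>n. m n @ [a]) m'" .
      have "weq W A (\<lambda>n. (x' n @ [b]) @ (m n @ [a]) @ y n) (\<lambda>n. (x' n @ [b]) @ m' n @ y n)"
        by (rule weq_cong[OF Wf m'(2)]) (use l l' x' a mreg_seqs[OF m'(1)] in \<open>simp_all add: seqs_def\<close>)
      then have "weq W A (\<lambda>n. x n @ a # y n) (\<lambda>n. x' n @ b # (m' n @ y n))" using x'(4) by simp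
      from kminD(2)[OF less.prems(1) Fac_join[OF x'(1,2) Fac_prepend[OF less.prems(3) m'(1)]] this] Suc
      show False by simp
    qed
  qed
  moreover have "\<not> Labsorb V A a y"
  proof
    assume L: "Labsorb V A a y"
    show False
    proof (cases j)
      case 0
      then have "y \<in> mreg A" using less.prems(3) by (auto elim: Fac.cases)
      from absorb_left[OF this a L] obtain m' where
        m': "m' \<in> mreg A" "weq W A (\<lambda>n. a # y n) m'" .
      have "weq W A (\<lambda>n. x n @ a # y n) (\<lambda>n. x n @ m' n)"
        by (rule weq_congr[OF Wf m'(2)]) (use l a mreg_seqs[OF m'(1)] in simp_all)
      from kminD(2)[OF less.prems(1) Fac_append[OF less.prems(2) m'(1)] this] 0 show False by simp
    next
      case (Suc j')
      from less.prems(3)[unfolded Suc] obtain y' b m where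
        y': "Fac A j' y'" "b \<in> A" "m \<in> mreg A" "y = (\<lambda>n. m n @ b # y' n)" by (auto elim: Fac.cases)
      have l': "y' \<in> seqs A" "m \<in> seqs A" using y' Fac_seqs mreg_seqs by auto
      have IH: "\<not> Rabsorb V A m b \<and> \<not> Labsorb V A b y'"
        by (rule less.hyps[of 0 j']) (use Suc y' parts Fac.zero in simp_all)
      obtain z where z: "z \<in> seqs A" "weq V A y (\<lambda>n. z n @ a # y n)"
        using L by (auto simp: Labsorb_def)
      have "weq V A (\<lambda>n. z n @ a # y n) (\<lambda>n. m n @ b # y' n)"
        using weq_sym[OF z(2)] y'(4) by simp
      \<comment> \<open>The mirror image: the cut at \<open>b\<close> leaves m = z a m modulo
        \<open>V\<close>.\<close>
      from factor[OF y'(2) l'(2,1) _ _ _ this] IH l z a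
      obtain r0 r1 where r: "r0 \<in> seqs A" "r1 \<in> seqs A" "\<forall>\<^sub>F n in uf. z n @ a # y n = r0 n @ b # r1 n"
        "weq V A r0 m" "weq V A r1 y'" by auto
      have "\<forall>\<^sub>F n in uf. z n @ a # m n = r0 n"
        by (rule factor_unique_left[of b y' r1]) (use IH r y' l' z a in simp_all)
      then have "weq V A m (\<lambda>n. z n @ a # m n)"
        by (intro weq_sym[OF weq_trans[OF weq_ae r(4)]])
      then have "Labsorb V A a m" using z by (auto simp: Labsorb_def)
      from absorb_left[OF y'(3) a this] obtain m' where
        m': "m' \<in> mreg A" "weq W A (\<lambda>n. a # m n) m'" .
      have "weq W A (\<lambda>n. x n @ (a # m n) @ b # y' n) (\<lambda>n. x n @ m' n @ b # y' n)"
        by (rule weq_cong[OF Wf m'(2)]) (use l l' y' a mreg_seqs[OF m'(1)] in simp_all)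
      then have "weq W A (\<lambda>n. x n @ a # y n) (\<lambda>n. (x n @ m' n) @ b # y' n)" using y'(4) by simp
      from kminD(2)[OF less.prems(1) Fac_join[OF Fac_append[OF less.prems(2) m'(1)] y'(2,1)] this] Suc
      show False by simp
    qed
  qed
  ultimately show ?case ..
qed

text \<open>By pumping, a letter inside \<open>m\<close> is absorbed by \<open>r0\<close> on its
  left or by \<open>s\<close> on its right. As \<open>s\<close> is a prefix of \<open>r1\<close>,
  the absorption passes to x or to y modulo \<open>V\<close>.\<close>

lemma not_inside_mreg:
  assumes m: "m \<in> mreg A" and R: "\<not> Rabsorb V A x a" and L: "\<not> Labsorb V A a y"
    and r: "weq V A r0 x" "weq V A r1 y"
    and eq: "\<forall>\<^sub>F n in uf. m n = r0 n @ a # s n" "\<forall>\<^sub>F n in uf. r1 n = s n @ w n"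
    and l: "x \<in> seqs A" "y \<in> seqs A" "r0 \<in> seqs A" "r1 \<in> seqs A" "s \<in> seqs A" "w \<in> seqs A" "a \<in> A"
  shows False
  using position_in_mreg[OF m eq(1) l(3,5,7)]
proof
  assume "Rabsorb fin_sgrps A r0 a"
  then have "Rabsorb V A r0 a" by (rule Rabsorb_mono[OF _ Vf])
  then have "Rabsorb V A x a"
    by (rule Rabsorb_weq[OF Vf _ weq_sym[OF r(1)]]) (use l in simp_all)
  then show False using R by simp
next
  assume "Labsorb fin_sgrps A a s"
  then have "Labsorb V A a s" by (rule Labsorb_mono[OF _ Vf])
  then have "Labsorb V A a r1"
    by (rule Labsorb_append[OF Vf _ weq_ae[OF eq(2)]]) (use l in simp_all)
  then have "Labsorb V A a y"
    by (rule Labsorb_weq[OF Vf _ weq_sym[OF r(2)]]) (use l in simp_all)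
  then show False using L by simp
qed

lemma kmin_mreg_Suc:
  assumes m: "m \<in> mreg A" and k: "kmin (Suc k) v" and eq: "weq V A m v"
  shows False
proof -
  from kminD(1)[OF k] obtain m' a x where
    x: "m' \<in> mreg A" "a \<in> A" "Fac A k x" "v = (\<lambda>n. m' n @ a # x n)" by (auto elim: Fac.cases)
  have ns: "\<not> Rabsorb V A m' a \<and> \<not> Labsorb V A a x"
    by (rule kmin_not_absorb[of 0 k]) (use k x Fac.zero in simp_all)
  have l: "m \<in> seqs A" "m' \<in> seqs A" "x \<in> seqs A" using m x mreg_seqs Fac_seqs by auto
  from factor[OF x(2) l(2,3,1) _ _ eq[unfolded x(4)]] ns
  obtain r0 r1 where r: "r0 \<in> seqs A" "r1 \<in> seqs A" "\<forall>\<^sub>F n in uf. m n = r0 n @ a # r1 n"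
    "weq V A r0 m'" "weq V A r1 x" by auto
  show False
    by (rule not_inside_mreg[OF m, of m' a x r0 r1 r1 "\<lambda>n. []"]) (use ns r l x in simp_all)
qed

text \<open>Each sequence is cut as the other one is at its first letter. If the first letters
  coincide in position, the multiregular factors agree modulo \<open>V\<close>, hence modulo
  \<open>W\<close>, and induction handles the rest. Any other relative position puts a marked letter
  inside a multiregular factor or makes m absorb its letter.\<close>

lemma kmin_weq:
  assumes "kmin k u" "kmin k' v" "weq V A u v"
  shows "weq W A u v"
  using assms
proof (induction k arbitrary: k' u v)
  case 0
  then have u: "u \<in> mreg A" by (auto dest!: kminD(1) elim: Fac.cases)
  show ?case
  proof (cases k')
    case 0
    then have "v \<in> mreg A" using \<open>kmin k' v\<close> by (auto dest!: kminD(1) elim: Fac.cases)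
    then show ?thesis using u \<open>weq V A u v\<close> by (intro mreg_weq)
  next
    case (Suc k'')
    then show ?thesis using kmin_mreg_Suc[OF u] "0.prems" by blast
  qed
next
  case (Suc k)
  from kminD(1)[OF Suc.prems(1)] obtain m a x where
    x: "m \<in> mreg A" "a \<in> A" "Fac A k x" "u = (\<lambda>n. m n @ a # x n)" by (auto elim: Fac.cases)
  show ?case
  proof (cases k')
    case 0
    then have "v \<in> mreg A" using Suc.prems(2) by (auto dest!: kminD(1) elim: Fac.cases)
    then show ?thesis using kmin_mreg_Suc[OF _ Suc.prems(1) weq_sym[OF Suc.prems(3)]] by blast
  next
    case (Suc k1)
    from kminD(1)[OF Suc.prems(2)] obtain m' a' x' where
      x': "m' \<in> mreg A" "a' \<in> A" "Fac A k1 x'" "v = (\<lambda>n. m' n @ a' # x' n)"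
      unfolding Suc by (auto elim: Fac.cases)
    have km: "kmin (Suc (0 + k)) (\<lambda>n. m n @ a # x n)" "kmin (Suc (0 + k1)) (\<lambda>n. m' n @ a' # x' n)"
      using Suc.prems Suc x x' by simp_all
    have ns: "\<not> Rabsorb V A m a" "\<not> Labsorb V A a x"
      using kmin_not_absorb[OF km(1)] x Fac.zero by auto
    have ns': "\<not> Rabsorb V A m' a'" "\<not> Labsorb V A a' x'"
      using kmin_not_absorb[OF km(2)] x' Fac.zero by auto
    have l: "m \<in> seqs A" "x \<in> seqs A" "m' \<in> seqs A" "x' \<in> seqs A" "u \<in> seqs A" "v \<in> seqs A"
      using x x' mreg_seqs Fac_seqs Suc.prems kminD(1) by auto
    have uv: "weq V A u (\<lambda>n. m' n @ a' # x' n)" "weq V A v (\<lambda>n. m n @ a # x n)"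
      using Suc.prems(3) weq_sym x(4) x'(4) by auto
    obtain r0 r1 where r: "r0 \<in> seqs A" "r1 \<in> seqs A" "\<forall>\<^sub>F n in uf. u n = r0 n @ a' # r1 n"
      "weq V A r0 m'" "weq V A r1 x'" using factor[OF x'(2) l(3,4,5) ns' uv(1)] .
    obtain q0 q1 where q: "q0 \<in> seqs A" "q1 \<in> seqs A" "\<forall>\<^sub>F n in uf. v n = q0 n @ a # q1 n"
      "weq V A q0 m" "weq V A q1 x" using factor[OF x(2) l(1,2,6) ns uv(2)] .
    have "\<forall>\<^sub>F n in uf. m n @ a # x n = r0 n @ a' # r1 n" using r(3) x(4) by simp
    then show ?thesis using l(1,2) r(1,2)
    proof (cases rule: ae_compare)
      case same
      have "weq V A m m'" using weq_trans[OF weq_ae[OF same(2)] r(4)] .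
      then have mm: "weq W A m m'" by (rule mreg_weq[OF x(1) x'(1)])
      have "weq V A x x'" using weq_trans[OF weq_ae[OF same(3)] r(5)] .
      then have xx: "weq W A x x'"
        using Suc.IH[of x k1 x'] kmin_parts(2)[OF km(1)] kmin_parts(2)[OF km(2)] x x' Fac.zero by auto
      have "weq W A (\<lambda>n. a # x n) (\<lambda>n. a # x' n)"
        using weq_congr[OF Wf xx, of "\<lambda>n. [a]"] l x by (simp add: seqs_def)
      then have "weq W A (\<lambda>n. m n @ a # x n) (\<lambda>n. m' n @ a # x' n)"
        by (intro weq_cong2[OF Wf mm]) (use l x in simp_all)
      then show ?thesis using same(1) x(4) x'(4) by simp
    next
      case (greater s)
      then show ?thesis
        using not_inside_mreg[OF x(1) ns' r(4,5) greater(2), of "\<lambda>n. a # x n"] l r x x' by simp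
    next
      case (less s)
      \<comment> \<open>The first factor of v now extends that of u past \<open>a\<close>. Cutting v
        at its own copy of \<open>a\<close> yields the comparison in the other direction, and the
        two together are contradictory.\<close>
      have m': "weq V A m' (\<lambda>n. m n @ a # s n)" using weq_trans[OF weq_sym[OF r(4)] weq_ae[OF less(2)]] .
      have "\<forall>\<^sub>F n in uf. m' n @ a' # x' n = q0 n @ a # q1 n" using q(3) x'(4) by simp
      then show ?thesis using l(3,4) q(1,2)
      proof (cases rule: ae_compare)
        case same
        have "weq V A m m'" using weq_sym[OF weq_trans[OF weq_ae[OF same(2)] q(4)]] .
        also note m'
        finally show ?thesis using ns(1) less(1) by (auto simp: Rabsorb_def)
      next
        case (greater t)
        then show ?thesis
          using not_inside_mreg[OF x'(1) ns q(4,5) greater(2), of "\<lambda>n. a' # x' n"] l q x x' by simp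
      next
        case less': (less t)
        have "weq V A m q0" using q(4) by (rule weq_sym)
        also have "weq V A q0 (\<lambda>n. m' n @ a' # t n)" using less'(2) by (rule weq_ae)
        also have "weq V A \<dots> (\<lambda>n. (m n @ a # s n) @ a' # t n)"
          by (rule weq_congl[OF Vf m']) (use l less(1) less'(1) x(2) x'(2) in simp_all)
        finally have "weq V A m (\<lambda>n. m n @ a # (s n @ a' # t n))" by simp
        then have "Rabsorb V A m a"
          unfolding Rabsorb_def
          by - (rule bexI[of _ "\<lambda>n. s n @ a' # t n"], use less(1) less'(1) x'(2) in simp_all)
        then show ?thesis using ns(1) by simp
      qed
    qed
  qed
qed

lemma kmin_exists:
  assumes "u \<in> seqs A"
  obtains k v where "kmin k v" "weq W A u v"
proof -
  let ?P = "\<lambda>k. \<exists>v. Fac A k v \<and> weq W A u v"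
  obtain k where "?P k"
    using DS_factorization[OF A order_refl assms] weq_mono[OF _ WDS] by blast
  then have P: "?P (LEAST k. ?P k)" by (rule LeastI)
  then obtain v where v: "Fac A (LEAST k. ?P k) v" "weq W A u v" by blast
  have "kmin (LEAST k. ?P k) v"
    unfolding kmin_def
  proof (intro conjI allI impI v(1))
    fix k' u' assume "Fac A k' u' \<and> weq W A v u'"
    then have "?P k'" using v(2) weq_trans by blast
    then show "(LEAST k. ?P k) \<le> k'" by (rule Least_le)
  qed
  then show thesis using that v(2) by blast
qed

theorem weq_V_imp_weq_W:
  assumes "u \<in> seqs A" "v \<in> seqs A" "weq V A u v"
  shows "weq W A u v"
proof -
  obtain k u' where u': "kmin k u'" "weq W A u u'" using kmin_exists[OF assms(1)] .
  obtain k' v' where v': "kmin k' v'" "weq W A v v'" using kmin_exists[OF assms(2)] .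
  have "weq V A u' v'"
    using assms(3) weq_mono[OF u'(2) VW] weq_mono[OF v'(2) VW] by (blast intro: weq_sym weq_trans)
  from kmin_weq[OF u'(1) v'(1) this] show ?thesis
    using u'(2) v'(2) by (blast intro: weq_sym weq_trans)
qed

end


section \<open>Free profinite semigroups as limits of words\<close>

definition pseqs :: "'a set \<Rightarrow> (nat \<Rightarrow> 'a list) set" where
  "pseqs A = {u. \<forall>n. u n \<in> plus_words A}"

lemma pseqs_iff: "u \<in> pseqs A \<longleftrightarrow> u \<in> seqs A \<and> (\<forall>n. u n \<noteq> [])"
  by (auto simp: pseqs_def seqs_def)

lemma pseqsD: "u \<in> pseqs A \<Longrightarrow> u n \<in> lists A" "u \<in> pseqs A \<Longrightarrow> u n \<noteq> []"
  by (auto simp: pseqs_def)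

lemma pseqs_append: "u \<in> pseqs A \<Longrightarrow> v \<in> pseqs A \<Longrightarrow> (\<lambda>n. u n @ v n) \<in> pseqs A"
  by (auto simp: pseqs_iff)

text \<open>The limit along \<open>uf\<close>, coordinate by coordinate: a finite coordinate is
  constant almost everywhere, and \<open>SOME\<close> names that constant.\<close>

definition limw :: "nat sgrp set \<Rightarrow> 'a set \<Rightarrow> (nat \<Rightarrow> 'a list) \<Rightarrow> 'a pseudoword" where
  "limw W A u = (\<lambda>p\<in>gen_index W A. SOME x. \<forall>\<^sub>F n in uf. ev (fst p) (snd p) (u n) = x)"

lemma limw_eqI:
  assumes "p \<in> gen_index W A" "\<forall>\<^sub>F n in uf. ev (fst p) (snd p) (u n) = x"
  shows "limw W A u p = x"
proof -
  have "\<forall>\<^sub>F n in uf. ev (fst p) (snd p) (u n) = (SOME x. \<forall>\<^sub>F n in uf. ev (fst p) (snd p) (u n) = x)"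
    by (rule someI[of "\<lambda>x. \<forall>\<^sub>F n in uf. ev (fst p) (snd p) (u n) = x"]) (rule assms(2))
  with assms(2) have "\<forall>\<^sub>F n in uf. (SOME x. \<forall>\<^sub>F n in uf. ev (fst p) (snd p) (u n) = x) = x"
    by eventually_elim simp
  then show ?thesis using assms(1) by (simp add: limw_def)
qed

locale free_pro_words =
  fixes W :: "nat sgrp set" and A :: "'a set"
  assumes W: "subdirect_closed W" and A: "finite A" "A \<noteq> {}"
begin

lemma Wf: "W \<subseteq> fin_sgrps"
  using W by (simp add: subdirect_closed_def)

lemma gen_indexD:
  assumes "p \<in> gen_index W A"
  shows "fst p \<in> W" "is_sgrp (fst p)" "finite (carrier (fst p))" "snd p \<in> A \<rightarrow> carrier (fst p)"
    "snd p \<in> A \<rightarrow>\<^sub>E carrier (fst p)" "carrier (fst p) = finite_products (fst p) (snd p ` A)"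
proof -
  show "fst p \<in> W" "snd p \<in> A \<rightarrow>\<^sub>E carrier (fst p)"
    and "carrier (fst p) = finite_products (fst p) (snd p ` A)"
    using assms unfolding gen_index_def case_prod_unfold by blast+
  then show "is_sgrp (fst p)" "finite (carrier (fst p))" "snd p \<in> A \<rightarrow> carrier (fst p)"
    using Wf fin_sgrpsD by blast+
qed

lemma limw_ae:
  assumes p: "p \<in> gen_index W A" and u: "u \<in> pseqs A"
  shows "\<forall>\<^sub>F n in uf. ev (fst p) (snd p) (u n) = limw W A u p"
proof -
  have "\<forall>\<^sub>F n in uf. \<exists>x\<in>carrier (fst p). ev (fst p) (snd p) (u n) = x"
    using ev_in[OF gen_indexD(2,4)[OF p] pseqsD[OF u]] by simp
  then obtain x where x: "\<forall>\<^sub>F n in uf. ev (fst p) (snd p) (u n) = x"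
    using ae_bex_finite[OF gen_indexD(3)[OF p], of "\<lambda>x n. ev (fst p) (snd p) (u n) = x"] by blast
  with limw_eqI[OF p x] show ?thesis by simp
qed

lemma limw_in_carrier:
  assumes p: "p \<in> gen_index W A" and u: "u \<in> pseqs A"
  shows "limw W A u p \<in> carrier (fst p)"
proof -
  have "\<forall>\<^sub>F n in uf. limw W A u p \<in> carrier (fst p)"
    using limw_ae[OF p u]
    by eventually_elim (use ev_in[OF gen_indexD(2,4)[OF p] pseqsD[OF u]] in metis)
  then show ?thesis by simp
qed

lemma carrier_free_pro:
  "carrier (free_pro W A) = {u \<in> (\<Pi>\<^sub>E p\<in>gen_index W A. carrier (fst p)).
     \<forall>p\<in>gen_index W A. \<forall>q\<in>gen_index W A. \<forall>h\<in>sg_hom (fst p) (fst q).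
       (\<forall>a\<in>A. h (snd p a) = snd q a) \<longrightarrow> h (u p) = u q}"
  by (auto simp: free_pro_def prod_sgrp_def case_prod_unfold)

lemma smult_free_pro:
  "smult (free_pro W A) u v = (\<lambda>p\<in>gen_index W A. smult (fst p) (u p) (v p))"
  by (simp add: free_pro_def prod_sgrp_def)

lemma limw_in:
  assumes u: "u \<in> pseqs A"
  shows "limw W A u \<in> carrier (free_pro W A)"
  unfolding carrier_free_pro
proof (intro CollectI conjI ballI impI)
  show "limw W A u \<in> (\<Pi>\<^sub>E p\<in>gen_index W A. carrier (fst p))"
    using limw_in_carrier[OF _ u] by (auto simp: limw_def)
  fix p q h assume p: "p \<in> gen_index W A" and q: "q \<in> gen_index W A" and h: "h \<in> sg_hom (fst p) (fst q)"
    and hg: "\<forall>a\<in>A. h (snd p a) = snd q a"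
  have "ev (fst q) (snd q) (u n) = h (ev (fst p) (snd p) (u n))" for n
  proof -
    have "ev (fst q) (snd q) (u n) = ev (fst q) (\<lambda>a. h (snd p a)) (u n)"
      by (rule ev_cong_fun) (use hg pseqsD[OF u, of n] in auto)
    also have "\<dots> = h (ev (fst p) (snd p) (u n))"
      using h by (intro ev_hom[OF gen_indexD(2,4)[OF p] pseqsD[OF u]]) (auto simp: sg_hom_def)
    finally show ?thesis .
  qed
  then have "\<forall>\<^sub>F n in uf. ev (fst q) (snd q) (u n) = h (limw W A u p)"
    using limw_ae[OF p u] by (auto elim: eventually_mono)
  from limw_eqI[OF q this] show "h (limw W A u p) = limw W A u q" by simp
qed

lemma limw_append:
  assumes u: "u \<in> pseqs A" and v: "v \<in> pseqs A"
  shows "smult (free_pro W A) (limw W A u) (limw W A v) = limw W A (\<lambda>n. u n @ v n)"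
proof
  fix p
  show "smult (free_pro W A) (limw W A u) (limw W A v) p = limw W A (\<lambda>n. u n @ v n) p"
  proof (cases "p \<in> gen_index W A")
    case True
    have "\<forall>\<^sub>F n in uf. ev (fst p) (snd p) (u n @ v n) = smult (fst p) (limw W A u p) (limw W A v p)"
      using limw_ae[OF True u] limw_ae[OF True v]
      by eventually_elim
        (use ev_append[OF gen_indexD(2,4)[OF True] pseqsD(1)[OF u] pseqsD(1)[OF v] pseqsD(2)[OF u] pseqsD(2)[OF v]] in metis)
    from limw_eqI[OF True this] show ?thesis using True by (simp add: smult_free_pro)
  qed (simp add: smult_free_pro limw_def)
qed

text \<open>The projective limit is indexed by generated semigroups, whereas \<open>weq\<close>
  quantifies over all evaluations; the subsemigroup generated by the values of the letters
  mediates.\<close>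

lemma generated_index:
  assumes T: "T \<in> W" and f: "f \<in> A \<rightarrow> carrier T"
  obtains p where "p \<in> gen_index W A" "\<And>w. w \<in> plus_words A \<Longrightarrow> ev (fst p) (snd p) w = ev T f w"
    "carrier (fst p) \<subseteq> carrier T" "smult (fst p) = smult T"
proof -
  have Ts: "is_sgrp T" "finite (carrier T)" using T Wf fin_sgrpsD by auto
  define T0 where "T0 = \<lparr>carrier = finite_products T (f ` A), smult = smult T\<rparr>"
  have fp: "finite_products T (f ` A) = {ev T f w |w. w \<in> plus_words A}"
    by (rule finite_products_eq[OF Ts(1) f])
  have sub: "finite_products T (f ` A) \<subseteq> carrier T"
    using finite_products_closed[OF Ts(1)] f by blast
  have cl: "smult T (ev T f u) (ev T f v) \<in> finite_products T (f ` A)"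
    if "u \<in> plus_words A" "v \<in> plus_words A" for u v
  proof -
    have "smult T (ev T f u) (ev T f v) = ev T f (u @ v)" "u @ v \<in> plus_words A"
      using ev_append[OF Ts(1) f, of u v] that by auto
    then show ?thesis unfolding fp by blast
  qed
  have T0: "is_sgrp T0"
    unfolding is_sgrp_def
  proof (intro conjI ballI)
    obtain a where "a \<in> A" using A by blast
    then have "f a \<in> finite_products T (f ` A)" by (intro finite_products.single) auto
    then show "carrier T0 \<noteq> {}" by (auto simp: T0_def)
  next
    fix x y assume "x \<in> carrier T0" "y \<in> carrier T0"
    then obtain u v where "u \<in> plus_words A" "v \<in> plus_words A" "x = ev T f u" "y = ev T f v"
      by (auto simp: T0_def fp)
    then show "smult T0 x y \<in> carrier T0" using cl by (simp add: T0_def)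
  next
    fix x y z assume "x \<in> carrier T0" "y \<in> carrier T0" "z \<in> carrier T0"
    then show "smult T0 (smult T0 x y) z = smult T0 x (smult T0 y z)"
      using sub Ts(1) by (auto simp: T0_def intro!: sgrp_assoc)
  qed
  have T0W: "T0 \<in> W"
  proof (rule subdirect_closedD[OF W, of _ "{(T, \<lambda>x. x)}"])
    show "T0 \<in> fin_sgrps"
      using T0 finite_subset[OF sub Ts(2)] by (simp add: fin_sgrps_def T0_def)
  qed (use T sub in \<open>auto simp: mult_map_def T0_def\<close>)
  define f0 where "f0 = restrict f A"
  have ff: "f0 \<in> A \<rightarrow> carrier T0" by (auto simp: f0_def T0_def intro: finite_products.single)
  have ev0: "ev T0 f0 w = ev T f w" if "w \<in> plus_words A" for w
  proof -
    have "ev T0 f0 w = ev T (\<lambda>a. f0 a) w"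
      using ev_hom[OF T0 ff, of w "\<lambda>x. x" T] that by (simp add: T0_def)
    also have "\<dots> = ev T f w" by (rule ev_cong_fun) (use that in \<open>auto simp: f0_def\<close>)
    finally show ?thesis .
  qed
  have "carrier T0 = finite_products T0 (f0 ` A)"
    unfolding finite_products_eq[OF T0 ff] using ev0 by (force simp: T0_def fp)
  moreover have "f0 \<in> A \<rightarrow>\<^sub>E carrier T0" using ff by (simp add: f0_def PiE_iff Pi_iff)
  ultimately have "(T0, f0) \<in> gen_index W A"
    using T0W by (simp add: gen_index_def)
  then show thesis using that[of "(T0, f0)"] ev0 sub by (simp add: T0_def)
qed

lemma limw_eq_iff:
  assumes u: "u \<in> pseqs A" and v: "v \<in> pseqs A"
  shows "limw W A u = limw W A v \<longleftrightarrow> weq W A u v"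
proof
  assume eq: "limw W A u = limw W A v"
  show "weq W A u v"
    unfolding weq_def
  proof (intro ballI)
    fix T f assume "T \<in> W" "f \<in> A \<rightarrow> carrier T"
    from generated_index[OF this] obtain p where p: "p \<in> gen_index W A"
      "\<And>w. w \<in> plus_words A \<Longrightarrow> ev (fst p) (snd p) w = ev T f w" by metis
    from limw_ae[OF p(1) u] limw_ae[OF p(1) v] show "\<forall>\<^sub>F n in uf. mev T f (u n) = mev T f (v n)"
    proof eventually_elim
      case (elim n)
      then have "ev T f (u n) = ev T f (v n)"
        using p(2)[of "u n"] p(2)[of "v n"] pseqsD[OF u, of n] pseqsD[OF v, of n] eq by simp
      then show ?case using pseqsD[OF u] pseqsD[OF v] by (simp add: mev_eq_ev_iff)
    qed
  qed
next
  assume eq: "weq W A u v"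
  show "limw W A u = limw W A v"
  proof
    fix p
    show "limw W A u p = limw W A v p"
    proof (cases "p \<in> gen_index W A")
      case True
      have "\<forall>\<^sub>F n in uf. mev (fst p) (snd p) (u n) = mev (fst p) (snd p) (v n)"
        using eq gen_indexD[OF True] by (auto simp: weq_def)
      with limw_ae[OF True v] have "\<forall>\<^sub>F n in uf. ev (fst p) (snd p) (u n) = limw W A v p"
        by eventually_elim (simp add: ev_def)
      then show ?thesis by (rule limw_eqI[OF True])
    qed (simp add: limw_def)
  qed
qed

text \<open>The coordinate of x at the level-k quotient determines every coordinate with carrier in
  \<open>{..<k}\<close>. A word with the right value in that quotient therefore matches all of
  these, and a sequence of such words converges to x.\<close>

lemma limw_surj:
  assumes x: "x \<in> carrier (free_pro W A)"
  obtains u where "u \<in> pseqs A" "x = limw W A u"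
proof -
  have xp: "x p \<in> carrier (fst p)" if "p \<in> gen_index W A" for p
    using x that by (auto simp: carrier_free_pro)
  have compat: "h (x p) = x q"
    if "p \<in> gen_index W A" "q \<in> gen_index W A" "h \<in> sg_hom (fst p) (fst q)"
      "\<And>a. a \<in> A \<Longrightarrow> h (snd p a) = snd q a" for p q h
    using x that unfolding carrier_free_pro by blast
  have "\<exists>w\<in>plus_words A. \<forall>q\<in>gen_index W A. carrier (fst q) \<subseteq> {..<k} \<longrightarrow> x q = ev (fst q) (snd q) w" for k
  proof -
    obtain Q \<psi> where Q: "Q \<in> W" "\<psi> \<in> A \<rightarrow>\<^sub>E carrier Q" "carrier Q = finite_products Q (\<psi> ` A)"
      "\<forall>u\<in>plus_words A. \<forall>v\<in>plus_words A. ev Q \<psi> u = ev Q \<psi> v \<longleftrightarrow> teq W A k u v"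
      using teq_quotient[OF W A, where k = k] .
    have p: "(Q, \<psi>) \<in> gen_index W A" using Q by (simp add: gen_index_def)
    note Qs = gen_indexD(2,4)[OF p, simplified]
    obtain w where w: "w \<in> plus_words A" "x (Q, \<psi>) = ev Q \<psi> w"
      using xp[OF p] Q(3) finite_products_eq[OF Qs] by auto
    have "x q = ev (fst q) (snd q) w" if q: "q \<in> gen_index W A" "carrier (fst q) \<subseteq> {..<k}" for q
    proof -
      have "ev (fst q) (snd q) u = ev (fst q) (snd q) v"
        if uv: "u \<in> plus_words A" "v \<in> plus_words A" "ev Q \<psi> u = ev Q \<psi> v" for u v
      proof -
        have "teq W A k u v" using Q(4) uv by blast
        then have "mev (fst q) (snd q) u = mev (fst q) (snd q) v"
          using q gen_indexD[OF q(1)] by (auto simp: teq_def)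
        then show ?thesis by (simp add: ev_def)
      qed
      from hom_from_kernel[OF Qs Q(3) gen_indexD(2,4)[OF q(1)] this] obtain h where
        h: "h \<in> sg_hom Q (fst q)" "\<And>w. w \<in> plus_words A \<Longrightarrow> h (ev Q \<psi> w) = ev (fst q) (snd q) w" by metis
      have "h (\<psi> a) = snd q a" if "a \<in> A" for a using h(2)[of "[a]"] that by simp
      then have "h (x (Q, \<psi>)) = x q" using compat[OF p q(1)] h(1) by simp
      then show ?thesis using w h(2) by simp
    qed
    then show ?thesis using w(1) by blast
  qed
  then obtain u where u: "\<And>k. u k \<in> plus_words A"
    "\<And>k q. q \<in> gen_index W A \<Longrightarrow> carrier (fst q) \<subseteq> {..<k} \<Longrightarrow> x q = ev (fst q) (snd q) (u k)" by metis
  have "x = limw W A u"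
  proof
    fix q
    show "x q = limw W A u q"
    proof (cases "q \<in> gen_index W A")
      case True
      obtain k where "carrier (fst q) \<subseteq> {..<k}"
        using gen_indexD(3)[OF True] finite_nat_iff_bounded by blast
      then have "carrier (fst q) \<subseteq> {..<n}" if "n \<ge> k" for n using that by fastforce
      then have "\<forall>\<^sub>F n in uf. ev (fst q) (snd q) (u n) = x q"
        using u(2)[OF True] by (intro ae_ge[of k]) metis
      then show ?thesis using limw_eqI[OF True] by simp
    next
      case False
      have "x \<in> (\<Pi>\<^sub>E p\<in>gen_index W A. carrier (fst p))" using x by (simp add: carrier_free_pro)
      from PiE_arb[OF this False] show ?thesis using False by (simp add: limw_def)
    qed
  qed
  moreover have "u \<in> pseqs A" using u(1) by (simp add: pseqs_def)
  ultimately show thesis using that by blast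
qed

abbreviation word :: "'a list \<Rightarrow> 'a pseudoword" where
  "word w \<equiv> limw W A (\<lambda>_. w)"

lemma letter_word: "a \<in> A \<Longrightarrow> letter W A a = word [a]"
  by (rule ext) (auto simp: letter_def limw_def intro!: limw_eqI[symmetric, unfolded limw_def])

lemma hom_word:
  assumes h: "h \<in> sg_hom (free_pro W A) S" and w: "w \<in> plus_words A"
  shows "h (word w) = ev S (\<lambda>a. h (letter W A a)) w"
  using w
proof (induction w)
  case (Cons a w)
  have a: "a \<in> A" "[a] \<in> plus_words A" using Cons by auto
  show ?case
  proof (cases "w = []")
    case True
    then show ?thesis using a by (simp add: letter_word)
  next
    case False
    then have w: "w \<in> plus_words A" using Cons by auto
    have l: "(\<lambda>_. [a]) \<in> pseqs A" "(\<lambda>_. w) \<in> pseqs A" using a w by (auto simp: pseqs_def)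
    have "word (a # w) = smult (free_pro W A) (word [a]) (word w)"
      using limw_append[OF l] by simp
    then have "h (word (a # w)) = smult S (h (word [a])) (h (word w))"
      using h limw_in[OF l(1)] limw_in[OF l(2)] by (simp add: sg_hom_def)
    moreover obtain c where "mev S (\<lambda>a. h (letter W A a)) w = Some c"
      using mev_eq_Some[OF False] by metis
    ultimately show ?thesis using Cons.IH[OF w] a by (simp add: ev_def letter_word)
  qed
qed simp

section \<open>Continuity and satisfaction of pseudoidentities\<close>

lemma limitin_words:
  assumes u: "u \<in> pseqs A"
  shows "limitin (free_pro_topology W A) (\<lambda>n. word (u n)) (limw W A u) uf"
proof -
  have wd: "(\<lambda>_. u n) \<in> pseqs A" for n using u by (simp add: pseqs_def)
  have "limitin (discrete_topology (carrier (fst p))) (\<lambda>n. word (u n) p) (limw W A u p) uf"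
    if p: "p \<in> gen_index W A" for p
  proof (rule limitin_eventually)
    show "limw W A u p \<in> topspace (discrete_topology (carrier (fst p)))"
      using limw_in_carrier[OF p u] by simp
    have "word (u n) p = ev (fst p) (snd p) (u n)" for n by (rule limw_eqI[OF p]) simp
    then show "\<forall>\<^sub>F n in uf. word (u n) p = limw W A u p" using limw_ae[OF p u] by simp
  qed
  moreover have "y \<in> (\<Pi>\<^sub>E p\<in>gen_index W A. carrier (fst p))" if "y \<in> carrier (free_pro W A)" for y
    using that by (simp add: carrier_free_pro)
  ultimately show ?thesis
    unfolding free_pro_topology_def limitin_subtopology limitin_componentwise
    using limw_in[OF u] limw_in[OF wd] by (auto simp: PiE_def)
qed

lemma topspace_free_pro: "topspace (free_pro_topology W A) = carrier (free_pro W A)"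
  by (auto simp: free_pro_topology_def carrier_free_pro)

lemma continuous_coordinate:
  "p \<in> gen_index W A \<Longrightarrow>
   continuous_map (free_pro_topology W A) (discrete_topology (carrier (fst p))) (\<lambda>x. x p)"
  unfolding free_pro_topology_def
  by (intro continuous_map_from_subtopology continuous_map_product_projection)

text \<open>Words converge to the pseudoword they represent, so a continuous homomorphism into a
  discrete semigroup is constant on them almost everywhere. Its values at the letters thus determine
  it.\<close>

lemma cont_hom_value:
  assumes h: "h \<in> cont_hom (free_pro W A) (free_pro_topology W A) S (discrete_topology (carrier S))"
    and u: "u \<in> pseqs A"
  shows "\<forall>\<^sub>F n in uf. ev S (\<lambda>a. h (letter W A a)) (u n) = h (limw W A u)"
proof -
  have c: "continuous_map (free_pro_topology W A) (discrete_topology (carrier S)) h"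
    and hh: "h \<in> sg_hom (free_pro W A) S" using h by (auto simp: cont_hom_def)
  have l: "limitin (discrete_topology (carrier S)) (h \<circ> (\<lambda>n. word (u n))) (h (limw W A u)) uf"
    by (rule continuous_map_limit[OF c limitin_words[OF u]])
  then have "h (limw W A u) \<in> carrier S" using limitin_topspace by force
  then have "\<forall>\<^sub>F n in uf. (h \<circ> (\<lambda>n. word (u n))) n \<in> {h (limw W A u)}"
    by (intro limitinD[OF l]) simp_all
  then show ?thesis
    by eventually_elim (use hom_word[OF hh] u in \<open>simp add: pseqs_def\<close>)
qed

end

lemma satisfies_iff:
  assumes S: "S \<in> fin_sgrps" and A: "finite A" "A \<noteq> {}" and u: "u \<in> pseqs A" and v: "v \<in> pseqs A"
  shows "satisfies S (A, limw fin_sgrps A u, limw fin_sgrps A v) \<longleftrightarrow> weq {S} A u v"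
proof -
  interpret free_pro_words fin_sgrps A by unfold_locales (use A in simp_all)
  show ?thesis
  proof
    assume sat: "satisfies S (A, limw fin_sgrps A u, limw fin_sgrps A v)"
    show "weq {S} A u v"
      unfolding weq_def
    proof (intro ballI)
      fix T f assume "T \<in> {S}" and f: "f \<in> A \<rightarrow> carrier T"
      then have TS: "T = S" by simp
      obtain p where p: "p \<in> gen_index fin_sgrps A" "\<And>w. w \<in> plus_words A \<Longrightarrow> ev (fst p) (snd p) w = ev S f w"
        "carrier (fst p) \<subseteq> carrier S" "smult (fst p) = smult S"
        using generated_index[OF S] f TS by metis
      \<comment> \<open>The evaluation \<open>f\<close> is realised by the projection to the
        coordinate that it generates.\<close>
      define h where "h = (\<lambda>x\<in>carrier (free_pro fin_sgrps A). x p)"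
      have "h \<in> sg_hom (free_pro fin_sgrps A) S"
        unfolding sg_hom_def
      proof (intro CollectI conjI ballI)
        show "h \<in> carrier (free_pro fin_sgrps A) \<rightarrow>\<^sub>E carrier S"
          using p(1,3) by (auto simp: h_def carrier_free_pro)
        fix x y assume xy: "x \<in> carrier (free_pro fin_sgrps A)" "y \<in> carrier (free_pro fin_sgrps A)"
        obtain u v where uv: "u \<in> pseqs A" "v \<in> pseqs A" "x = limw fin_sgrps A u" "y = limw fin_sgrps A v"
          using xy limw_surj by metis
        then have "smult (free_pro fin_sgrps A) x y \<in> carrier (free_pro fin_sgrps A)"
          using limw_append limw_in pseqs_append by metis
        then show "h (smult (free_pro fin_sgrps A) x y) = smult S (h x) (h y)"
          using xy p(1,4) by (simp add: h_def smult_free_pro)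
      qed
      moreover have "continuous_map (free_pro_topology fin_sgrps A) (discrete_topology (carrier S)) h"
      proof (rule continuous_map_eq)
        have "continuous_map (free_pro_topology fin_sgrps A)
            (subtopology (discrete_topology (carrier S)) (carrier (fst p))) (\<lambda>x. x p)"
          using continuous_coordinate[OF p(1)] p(3) by (simp add: subtopology_discrete_topology Int_absorb1)
        then show "continuous_map (free_pro_topology fin_sgrps A) (discrete_topology (carrier S)) (\<lambda>x. x p)"
          by (rule continuous_map_into_fulltopology)
      qed (simp add: h_def topspace_free_pro)
      ultimately have "h (limw fin_sgrps A u) = h (limw fin_sgrps A v)"
        using sat by (simp add: cont_hom_def)
      then have eq: "limw fin_sgrps A u p = limw fin_sgrps A v p"
        using limw_in[OF u] limw_in[OF v] by (simp add: h_def)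
      from limw_ae[OF p(1) u] limw_ae[OF p(1) v] show "\<forall>\<^sub>F n in uf. mev T f (u n) = mev T f (v n)"
      proof eventually_elim
        case (elim n)
        then have "ev S f (u n) = ev S f (v n)"
          using eq p(2)[of "u n"] p(2)[of "v n"] u v by (simp add: pseqs_def)
        then show ?case using pseqsD[OF u] pseqsD[OF v] TS by (simp add: mev_eq_ev_iff)
      qed
    qed
  next
    assume eq: "weq {S} A u v"
    show "satisfies S (A, limw fin_sgrps A u, limw fin_sgrps A v)"
      unfolding satisfies.simps
    proof
      fix h assume h: "h \<in> cont_hom (free_pro fin_sgrps A) (free_pro_topology fin_sgrps A) S
        (discrete_topology (carrier S))"
      define f where "f a = h (letter fin_sgrps A a)" for a
      have "letter fin_sgrps A a \<in> carrier (free_pro fin_sgrps A)" if "a \<in> A" for a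
        unfolding letter_word[OF that] by (rule limw_in) (use that in \<open>simp add: pseqs_def\<close>)
      then have f: "f \<in> A \<rightarrow> carrier S" using h by (auto simp: f_def cont_hom_def sg_hom_def)
      have "\<forall>\<^sub>F n in uf. mev S f (u n) = mev S f (v n)" using eq f by (simp add: weq_def)
      with cont_hom_value[OF h u] cont_hom_value[OF h v]
      have "\<forall>\<^sub>F n in uf. h (limw fin_sgrps A u) = h (limw fin_sgrps A v)"
        unfolding f_def[symmetric] by eventually_elim (simp add: ev_def)
      then show "h (limw fin_sgrps A u) = h (limw fin_sgrps A v)" by simp
    qed
  qed
qed

text \<open>Restricting the index set gives one continuous homomorphism that fixes the letters. The
  description by \<open>THE\<close> also needs uniqueness, which follows in each finite coordinate
  from convergence of words.\<close>

lemma canonical_proj_limw: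
  assumes W: "subdirect_closed W" and A: "finite A" "A \<noteq> {}" and u: "u \<in> pseqs A"
  shows "canonical_proj W A (limw fin_sgrps A u) = limw W A u"
proof -
  interpret F: free_pro_words fin_sgrps A by unfold_locales (use A in simp_all)
  interpret R: free_pro_words W A by unfold_locales (use W A in simp_all)
  let ?P = "\<lambda>h. h \<in> cont_hom (free_pro fin_sgrps A) (free_pro_topology fin_sgrps A)
        (free_pro W A) (free_pro_topology W A) \<and> (\<forall>a\<in>A. h (letter fin_sgrps A a) = letter W A a)"
  have sub: "gen_index W A \<subseteq> gen_index fin_sgrps A" using R.Wf by (auto simp: gen_index_def)
  define h0 where "h0 = (\<lambda>x\<in>carrier (free_pro fin_sgrps A). restrict x (gen_index W A))"
  have h0: "h0 (limw fin_sgrps A u) = limw W A u" if u: "u \<in> pseqs A" for u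
  proof -
    have "restrict (limw fin_sgrps A u) (gen_index W A) = limw W A u"
      by (intro ext) (use sub in \<open>auto simp: limw_def restrict_def\<close>)
    then show ?thesis using F.limw_in[OF u] by (simp add: h0_def)
  qed
  have "?P h0"
  proof (intro conjI ballI)
    have hom: "h0 \<in> sg_hom (free_pro fin_sgrps A) (free_pro W A)"
      unfolding sg_hom_def
    proof (intro CollectI conjI ballI)
      show "h0 \<in> carrier (free_pro fin_sgrps A) \<rightarrow>\<^sub>E carrier (free_pro W A)"
      proof (rule PiE_I)
        fix x assume "x \<in> carrier (free_pro fin_sgrps A)"
        then obtain u where "u \<in> pseqs A" "x = limw fin_sgrps A u" by (rule F.limw_surj)
        then show "h0 x \<in> carrier (free_pro W A)" using h0 R.limw_in by simp
      qed (simp add: h0_def)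
      fix x y assume xy: "x \<in> carrier (free_pro fin_sgrps A)" "y \<in> carrier (free_pro fin_sgrps A)"
      obtain u v where uv: "u \<in> pseqs A" "v \<in> pseqs A" "x = limw fin_sgrps A u" "y = limw fin_sgrps A v"
        using xy F.limw_surj by metis
      show "h0 (smult (free_pro fin_sgrps A) x y) = smult (free_pro W A) (h0 x) (h0 y)"
        using uv h0 by (simp add: F.limw_append R.limw_append pseqs_append)
    qed
    have "continuous_map (free_pro_topology fin_sgrps A)
        (product_topology (\<lambda>p. discrete_topology (carrier (fst p))) (gen_index W A)) h0"
      unfolding continuous_map_componentwise
    proof (intro conjI ballI)
      show "h0 ` topspace (free_pro_topology fin_sgrps A) \<subseteq> extensional (gen_index W A)"
        by (auto simp: h0_def F.topspace_free_pro)
      fix p assume p: "p \<in> gen_index W A"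
      show "continuous_map (free_pro_topology fin_sgrps A) (discrete_topology (carrier (fst p))) (\<lambda>x. h0 x p)"
        by (rule continuous_map_eq[OF F.continuous_coordinate])
          (use p sub in \<open>auto simp: h0_def F.topspace_free_pro\<close>)
    qed
    then have "continuous_map (free_pro_topology fin_sgrps A) (free_pro_topology W A) h0"
      unfolding free_pro_topology_def[of W] continuous_map_in_subtopology
      using hom by (auto simp: F.topspace_free_pro sg_hom_def)
    then show "h0 \<in> cont_hom (free_pro fin_sgrps A) (free_pro_topology fin_sgrps A)
        (free_pro W A) (free_pro_topology W A)" using hom by (simp add: cont_hom_def)
    fix a assume a: "a \<in> A"
    then have "(\<lambda>_. [a]) \<in> pseqs A" by (simp add: pseqs_def)
    then show "h0 (letter fin_sgrps A a) = letter W A a"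
      unfolding F.letter_word[OF a] R.letter_word[OF a] by (rule h0)
  qed
  moreover have "h = h0" if h: "?P h" for h
  proof
    fix x
    show "h x = h0 x"
    proof (cases "x \<in> carrier (free_pro fin_sgrps A)")
      case False
      then show ?thesis using h by (auto simp: h0_def cont_hom_def sg_hom_def PiE_def extensional_def)
    next
      case True
      then obtain u where u: "u \<in> pseqs A" "x = limw fin_sgrps A u" by (rule F.limw_surj)
      have hx: "h x \<in> carrier (free_pro W A)" using h True by (auto simp: cont_hom_def sg_hom_def)
      have "h x = limw W A u"
      proof
        fix p
        show "h x p = limw W A u p"
        proof (cases "p \<in> gen_index W A")
          case False
          have "h x \<in> (\<Pi>\<^sub>E p\<in>gen_index W A. carrier (fst p))" using hx by (simp add: R.carrier_free_pro)
          from PiE_arb[OF this False] show ?thesis using False by (simp add: limw_def)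
        next
          case p: True
          define g where "g = (\<lambda>y\<in>carrier (free_pro fin_sgrps A). h y p)"
          have hc: "h y \<in> carrier (free_pro W A)" if "y \<in> carrier (free_pro fin_sgrps A)" for y
            using h that by (auto simp: cont_hom_def sg_hom_def)
          have cl: "smult (free_pro fin_sgrps A) y z \<in> carrier (free_pro fin_sgrps A)"
            if yz: "y \<in> carrier (free_pro fin_sgrps A)" "z \<in> carrier (free_pro fin_sgrps A)" for y z
          proof -
            obtain v w where "v \<in> pseqs A" "y = limw fin_sgrps A v" "w \<in> pseqs A" "z = limw fin_sgrps A w"
              using F.limw_surj[OF yz(1)] F.limw_surj[OF yz(2)] by metis
            then show ?thesis using F.limw_append F.limw_in pseqs_append by metis
          qed
          have "g \<in> sg_hom (free_pro fin_sgrps A) (fst p)"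
            unfolding sg_hom_def
          proof (intro CollectI conjI ballI)
            show "g \<in> carrier (free_pro fin_sgrps A) \<rightarrow>\<^sub>E carrier (fst p)"
              using hc p by (fastforce simp: g_def R.carrier_free_pro)
            fix y z assume yz: "y \<in> carrier (free_pro fin_sgrps A)" "z \<in> carrier (free_pro fin_sgrps A)"
            then have "h (smult (free_pro fin_sgrps A) y z) = smult (free_pro W A) (h y) (h z)"
              using h by (auto simp: cont_hom_def sg_hom_def)
            then show "g (smult (free_pro fin_sgrps A) y z) = smult (fst p) (g y) (g z)"
              using yz cl p by (simp add: g_def R.smult_free_pro)
          qed
          moreover have "continuous_map (free_pro_topology fin_sgrps A) (discrete_topology (carrier (fst p))) g"
          proof (rule continuous_map_eq)
            show "continuous_map (free_pro_topology fin_sgrps A) (discrete_topology (carrier (fst p)))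
                ((\<lambda>y. y p) \<circ> h)"
              using h by (intro continuous_map_compose[OF _ R.continuous_coordinate[OF p]]) (simp add: cont_hom_def)
          qed (simp add: g_def F.topspace_free_pro)
          ultimately have "g \<in> cont_hom (free_pro fin_sgrps A) (free_pro_topology fin_sgrps A)
              (fst p) (discrete_topology (carrier (fst p)))" by (simp add: cont_hom_def)
          from F.cont_hom_value[OF this u(1)]
          have *: "\<forall>\<^sub>F n in uf. ev (fst p) (\<lambda>a. g (letter fin_sgrps A a)) (u n) = g x" using u(2) by simp
          have "g (letter fin_sgrps A a) = snd p a" if a: "a \<in> A" for a
          proof -
            have "(\<lambda>_. [a]) \<in> pseqs A" using a by (simp add: pseqs_def)
            then have "letter fin_sgrps A a \<in> carrier (free_pro fin_sgrps A)"
              unfolding F.letter_word[OF a] by (rule F.limw_in)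
            then show ?thesis using h a p by (simp add: g_def letter_def[of W])
          qed
          then have "ev (fst p) (\<lambda>a. g (letter fin_sgrps A a)) (u n) = ev (fst p) (snd p) (u n)" for n
            by (intro ev_cong_fun) (use pseqsD(1)[OF u(1), of n] in auto)
          with * have "\<forall>\<^sub>F n in uf. ev (fst p) (snd p) (u n) = g x" by simp
          from limw_eqI[OF p this] show ?thesis using True by (simp add: g_def)
        qed
      qed
      then show ?thesis using h0[OF u(1)] u(2) by simp
    qed
  qed
  ultimately have "canonical_proj W A = h0"
    unfolding canonical_proj_def by (rule the_equality) 
  then show ?thesis using h0[OF u] by simp
qed


section \<open>Multiregularity in terms of sequences\<close>

text \<open>The inverse is made long enough that the product B X B has 4 n! periods in place of n!;
  a difference of 3 n! is invisible in \<open>T\<close>.\<close>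

lemma (in finite_eval) block_regular:
  assumes l: "r \<in> lists A" "z \<in> lists A" and n: "n \<ge> stab T"
  defines "B \<equiv> wpow (r @ z) (fact n) @ r"
  shows "E B = E (B @ (z @ wpow (r @ z) (2 * fact n - 1)) @ B)"
proof -
  let ?N = "fact n :: nat"
  let ?s = "r @ z"
  have s: "?s \<in> lists A" using l by simp
  have N: "?N \<ge> 1" by simp
  have "B @ (z @ wpow ?s (2 * ?N - 1)) @ B = wpow ?s ?N @ (?s @ wpow ?s (2 * ?N - 1)) @ wpow ?s ?N @ r"
    by (simp add: B_def)
  also have "?s @ wpow ?s (2 * ?N - 1) = wpow ?s (2 * ?N)"
    using wpow_Suc[of ?s "2 * ?N - 1"] N by simp
  also have "wpow ?s ?N @ wpow ?s (2 * ?N) @ wpow ?s ?N @ r = wpow ?s (?N + ?N + ?N + ?N) @ r"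
    by (simp add: wpow_add mult_2)
  finally have eq: "B @ (z @ wpow ?s (2 * ?N - 1)) @ B = wpow ?s (?N + ?N + ?N + ?N) @ r" .
  have j: "stab T \<le> ?N" using n fact_ge_self[of n] by linarith
  have "E (wpow ?s (?N + ?N + ?N + ?N)) = E (wpow ?s ?N)"
    using pow_stable[OF s n, of "?N + ?N + ?N"] pow_stable[OF s n, of "?N + ?N"] pow_stable[OF s n j] j
    by simp
  then have "E (wpow ?s (?N + ?N + ?N + ?N) @ r) = E (wpow ?s ?N @ r)"
    by (rule rwl) (use l wpow_lists[OF s] in simp_all)
  then show ?thesis unfolding eq by (simp add: B_def)
qed

context free_pro_words
begin

lemma mreg_imp_finite_product:
  assumes "g \<in> mreg A" "\<forall>n. g n \<noteq> []"
  shows "limw W A g \<in> finite_products (free_pro W A) {s. regular_elem (free_pro W A) s}"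
  using assms
proof (induction rule: mreg.induct)
  case (Cons r z m)
  let ?B = "\<lambda>n. wpow (r n @ z n) (fact n) @ r n"
  let ?X = "\<lambda>n. z n @ wpow (r n @ z n) (2 * fact n - 1)"
  have B: "?B \<in> pseqs A" using Cons by (simp add: pseqs_iff)
  have "2 * fact n - 1 \<noteq> (0 :: nat)" for n
  proof -
    have "(fact n :: nat) \<ge> 1" by simp
    then show ?thesis by linarith
  qed
  then have X: "?X \<in> pseqs A" using Cons by (simp add: pseqs_iff)
  have "weq W A ?B (\<lambda>n. (?B n @ ?X n) @ ?B n)"
    unfolding weq_def
  proof (intro ballI)
    fix T f assume T: "T \<in> W" and f: "f \<in> A \<rightarrow> carrier T"
    interpret finite_eval T f A using T f Wf by (intro finite_eval_fin) auto
    show "\<forall>\<^sub>F n in uf. E (?B n) = E ((?B n @ ?X n) @ ?B n)"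
      by (rule ae_ge[of "stab T"]) (use block_regular Cons in \<open>simp add: seqsD del: in_lists_conv_set\<close>)
  qed
  then have "limw W A ?B = smult (free_pro W A) (smult (free_pro W A) (limw W A ?B) (limw W A ?X)) (limw W A ?B)"
    unfolding limw_append[OF B X] limw_append[OF pseqs_append[OF B X] B]
    by (simp only: limw_eq_iff[OF B pseqs_append[OF pseqs_append[OF B X] B]])
  then have reg: "regular_elem (free_pro W A) (limw W A ?B)"
    using limw_in[OF B] limw_in[OF X] unfolding regular_elem_def by blast
  from mreg_cases[OF Cons.hyps(4)] show ?case
  proof
    assume "m = (\<lambda>n. [])"
    then show ?thesis using reg by (auto intro: finite_products.single)
  next
    assume m: "\<forall>n. m n \<noteq> []"
    then have "m \<in> pseqs A" using mreg_seqs[OF Cons.hyps(4)] by (simp add: pseqs_iff)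
    then have "limw W A (\<lambda>n. ?B n @ m n) = smult (free_pro W A) (limw W A ?B) (limw W A m)"
      using limw_append[OF B] by simp
    then show ?thesis using Cons.IH[OF m] reg by (auto intro: finite_products.times)
  qed
qed simp

text \<open>An equation x = x y x iterates to x = (x y)^\<omega> x, so words representing a regular
  element may be replaced by words of the shape (r z)^(n!) r.\<close>

lemma finite_product_imp_mreg:
  assumes "x \<in> finite_products (free_pro W A) {s. regular_elem (free_pro W A) s}"
  shows "\<exists>g\<in>mreg A. (\<forall>n. g n \<noteq> []) \<and> x = limw W A g"
proof -
  have reg: "\<exists>r\<in>seqs A. \<exists>z\<in>seqs A. (\<forall>n. r n \<noteq> []) \<and> x = limw W A (\<lambda>n. wpow (r n @ z n) (fact n) @ r n)"
    if "regular_elem (free_pro W A) x" for x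
  proof -
    obtain y where y: "y \<in> carrier (free_pro W A)" "x \<in> carrier (free_pro W A)"
      "x = smult (free_pro W A) (smult (free_pro W A) x y) x"
      using \<open>regular_elem (free_pro W A) x\<close> by (auto simp: regular_elem_def)
    obtain r where r: "r \<in> pseqs A" "x = limw W A r" using limw_surj[OF y(2)] .
    obtain z where z: "z \<in> pseqs A" "y = limw W A z" using limw_surj[OF y(1)] .
    have w: "weq W A r (\<lambda>n. (r n @ z n) @ r n)"
      using y(3) r z by (simp add: limw_append limw_eq_iff pseqs_append)
    have "weq W A r (\<lambda>n. wpow (r n @ z n) (fact n) @ r n)"
      unfolding weq_def
    proof (intro ballI)
      fix T f assume T: "T \<in> W" and f: "f \<in> A \<rightarrow> carrier T"
      interpret finite_eval T f A using T f Wf by (intro finite_eval_fin) auto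
      have "\<forall>\<^sub>F n in uf. E (r n) = E ((r n @ z n) @ r n)" using w T f by (auto simp: weq_def)
      then show "\<forall>\<^sub>F n in uf. E (r n) = E (wpow (r n @ z n) (fact n) @ r n)"
      proof eventually_elim
        case (elim n)
        then have "E (r n) = E (wpow (r n @ z n) (fact n) @ r n @ wpow [] (fact n))"
          by (intro iterate) (use pseqsD(1)[OF r(1), of n] pseqsD(1)[OF z(1), of n] in simp_all)
        then show ?case by simp
      qed
    qed
    moreover have "(\<lambda>n. wpow (r n @ z n) (fact n) @ r n) \<in> pseqs A"
      using r z by (simp add: pseqs_iff)
    ultimately have "x = limw W A (\<lambda>n. wpow (r n @ z n) (fact n) @ r n)"
      using r limw_eq_iff by simp
    then show ?thesis using r z by (auto simp: pseqs_iff)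
  qed
  from assms show ?thesis
  proof induction
    case (single x)
    then obtain r z where "r \<in> seqs A" "z \<in> seqs A" "\<forall>n. r n \<noteq> []"
      "x = limw W A (\<lambda>n. wpow (r n @ z n) (fact n) @ r n)" using reg by blast
    then show ?case
      by (intro bexI[of _ "\<lambda>n. wpow (r n @ z n) (fact n) @ r n"] mreg_single) auto
  next
    case (times x y)
    then obtain r z where r: "r \<in> seqs A" "z \<in> seqs A" "\<forall>n. r n \<noteq> []"
      "x = limw W A (\<lambda>n. wpow (r n @ z n) (fact n) @ r n)" using reg by blast
    obtain g where g: "g \<in> mreg A" "\<forall>n. g n \<noteq> []" "y = limw W A g" using times by blast
    have "smult (free_pro W A) x y = limw W A (\<lambda>n. (wpow (r n @ z n) (fact n) @ r n) @ g n)"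
      unfolding r(4) g(3) by (rule limw_append) (use r g mreg_seqs in \<open>simp_all add: pseqs_iff\<close>)
    then show ?case
      using mreg.Cons[OF r(1,3,2) g(1)] g(2) by (intro bexI[of _ "\<lambda>n. (wpow (r n @ z n) (fact n) @ r n) @ g n"]) auto
  qed
qed

lemma multiregular_iff:
  assumes u: "u \<in> pseqs A"
  shows "multiregular W A (limw fin_sgrps A u) \<longleftrightarrow> (\<exists>g\<in>mreg A. (\<forall>n. g n \<noteq> []) \<and> weq W A u g)"
proof -
  have *: "g \<in> pseqs A" if "g \<in> mreg A" "\<forall>n. g n \<noteq> []" for g
    using that mreg_seqs by (simp add: pseqs_iff)
  show ?thesis
    unfolding multiregular_def canonical_proj_limw[OF W A u]
    using finite_product_imp_mreg mreg_imp_finite_product limw_eq_iff[OF u *] by metis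
qed

end


section \<open>Multiregular consequences\<close>

text \<open>The pseudovariety defined by all multiregular pseudoidentities of \<open>V\<close>.
  Nonempty words are required because pseudowords exclude the identity.\<close>

definition mreg_models :: "nat sgrp set \<Rightarrow> nat sgrp set" where
  "mreg_models V = {T \<in> fin_sgrps. \<forall>(A :: nat set) g g'. finite A \<and> A \<noteq> {} \<and> g \<in> mreg A \<and> g' \<in> mreg A \<and>
     (\<forall>n. g n \<noteq> []) \<and> (\<forall>n. g' n \<noteq> []) \<and> weq V A g g' \<longrightarrow> weq {T} A g g'}"

lemma mreg_modelsI:
  assumes "T \<in> fin_sgrps" "\<And>(A :: nat set) g g'. finite A \<Longrightarrow> A \<noteq> {} \<Longrightarrow> g \<in> mreg A \<Longrightarrow> g' \<in> mreg A \<Longrightarrow>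
     (\<forall>n. g n \<noteq> []) \<Longrightarrow> (\<forall>n. g' n \<noteq> []) \<Longrightarrow> weq V A g g' \<Longrightarrow> weq {T} A g g'"
  shows "T \<in> mreg_models V"
  using assms by (simp add: mreg_models_def)

lemma mreg_modelsD:
  assumes "T \<in> mreg_models V" "finite (A :: nat set)" "A \<noteq> {}" "g \<in> mreg A" "g' \<in> mreg A"
     "\<forall>n. g n \<noteq> []" "\<forall>n. g' n \<noteq> []" "weq V A g g'"
  shows "weq {T} A g g'"
  using assms unfolding mreg_models_def by blast

lemma mreg_pseqs: "g \<in> mreg A \<Longrightarrow> \<forall>n. g n \<noteq> [] \<Longrightarrow> g \<in> pseqs A"
  using mreg_seqs by (simp add: pseqs_iff)

lemma weq_singletons: "weq W A u v \<longleftrightarrow> (\<forall>T\<in>W. weq {T} A u v)"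
  by (simp add: weq_def)

lemma subset_mreg_models: "V \<subseteq> fin_sgrps \<Longrightarrow> V \<subseteq> mreg_models V"
  by (rule subsetI, rule mreg_modelsI) (blast, erule weq_mono, simp)

lemma free_pro_words_fin: "finite A \<Longrightarrow> A \<noteq> {} \<Longrightarrow> free_pro_words fin_sgrps A"
  by unfold_locales simp_all

lemma pseudoidentity_cases:
  assumes "e \<in> pseudoidentities"
  obtains A u v where "e = (A, limw fin_sgrps A u, limw fin_sgrps A v)" "finite A" "A \<noteq> {}"
    "u \<in> pseqs A" "v \<in> pseqs A"
proof -
  obtain A x y where e: "e = (A, x, y)" "finite A" "A \<noteq> {}" "x \<in> carrier (free_pro fin_sgrps A)"
    "y \<in> carrier (free_pro fin_sgrps A)" using assms by (auto simp: pseudoidentities_def)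
  interpret free_pro_words fin_sgrps A using e by (intro free_pro_words_fin)
  obtain u where "u \<in> pseqs A" "x = limw fin_sgrps A u" using limw_surj[OF e(4)] .
  moreover obtain v where "v \<in> pseqs A" "y = limw fin_sgrps A v" using limw_surj[OF e(5)] .
  ultimately show thesis using that e by blast
qed

lemma multiregularly_basedI:
  assumes V: "V \<subseteq> fin_sgrps" and sub: "mreg_models V \<subseteq> V"
  shows "multiregularly_based V"
proof -
  define P where "P = (\<lambda>(A, g, g'). finite (A :: nat set) \<and> A \<noteq> {} \<and> g \<in> mreg A \<and> g' \<in> mreg A \<and>
     (\<forall>n. g n \<noteq> []) \<and> (\<forall>n. g' n \<noteq> []) \<and> weq V A g g')"
  define \<Sigma> where "\<Sigma> = {(A, limw fin_sgrps A g, limw fin_sgrps A g') |A g g'. P (A, g, g')}"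
  have Pp: "g \<in> pseqs A \<and> g' \<in> pseqs A \<and> finite A \<and> A \<noteq> {}" if "P (A, g, g')" for A g g'
    using that mreg_pseqs by (auto simp: P_def)
  have sat: "satisfies T (A, limw fin_sgrps A g, limw fin_sgrps A g') \<longleftrightarrow> weq {T} A g g'"
    if "T \<in> fin_sgrps" "P (A, g, g')" for T A g g'
    using Pp[OF that(2)] by (intro satisfies_iff[OF that(1)]) auto
  have "\<Sigma> \<subseteq> pseudoidentities"
  proof
    fix e assume "e \<in> \<Sigma>"
    then obtain A g g' where e: "e = (A, limw fin_sgrps A g, limw fin_sgrps A g')" "P (A, g, g')"
      by (auto simp: \<Sigma>_def)
    interpret free_pro_words fin_sgrps A using Pp[OF e(2)] by (intro free_pro_words_fin) auto
    show "e \<in> pseudoidentities"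
      using Pp[OF e(2)] limw_in by (auto simp: e(1) pseudoidentities_def)
  qed
  moreover have "V = {S \<in> fin_sgrps. \<forall>e\<in>\<Sigma>. satisfies S e}"
  proof (intro equalityI subsetI)
    fix T assume T: "T \<in> V"
    then have "weq {T} A g g'" if "P (A, g, g')" for A g g'
      using that by (auto simp: P_def intro: weq_mono)
    then have "\<forall>e\<in>\<Sigma>. satisfies T e" using sat T V by (auto simp: \<Sigma>_def simp del: satisfies.simps)
    then show "T \<in> {S \<in> fin_sgrps. \<forall>e\<in>\<Sigma>. satisfies S e}" using T V by blast
  next
    fix T assume "T \<in> {S \<in> fin_sgrps. \<forall>e\<in>\<Sigma>. satisfies S e}"
    then have T: "T \<in> fin_sgrps" and e: "\<forall>e\<in>\<Sigma>. satisfies T e" by blast+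
    have "weq {T} A g g'" if "P (A, g, g')" for A g g'
    proof -
      have "(A, limw fin_sgrps A g, limw fin_sgrps A g') \<in> \<Sigma>" using that by (auto simp: \<Sigma>_def)
      then show ?thesis using e sat[OF T that] by blast
    qed
    then have "T \<in> mreg_models V" by (intro mreg_modelsI[OF T]) (simp add: P_def)
    then show "T \<in> V" using sub by blast
  qed
  ultimately have "is_basis \<Sigma> V" unfolding is_basis_def by blast
  moreover have "multiregular fin_sgrps A u \<and> multiregular fin_sgrps A v" if "(A, u, v) \<in> \<Sigma>" for A u v
  proof -
    obtain g g' where g: "u = limw fin_sgrps A g" "v = limw fin_sgrps A g'" "P (A, g, g')"
      using \<open>(A, u, v) \<in> \<Sigma>\<close> by (auto simp: \<Sigma>_def)
    interpret free_pro_words fin_sgrps A using Pp[OF g(3)] by (intro free_pro_words_fin) auto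
    have "multiregular fin_sgrps A (limw fin_sgrps A h)" if "h \<in> mreg A" "\<forall>n. h n \<noteq> []" for h
      using that multiregular_iff[OF mreg_pseqs[OF that]] weq_refl by blast
    then show ?thesis using g by (simp add: P_def)
  qed
  ultimately show ?thesis unfolding multiregularly_based_in_def by blast
qed

text \<open>The sides of a basis identity are multiregular modulo \<open>W\<close> only. They can be
  exchanged for \<open>mreg\<close> sequences in \<open>V\<close> because
  \<open>V \<subseteq> W\<close>, and exchanged back in \<open>T\<close> because
  \<open>T \<in> W\<close>.\<close>

lemma multiregularly_based_inD:
  assumes W: "subdirect_closed W" and mb: "multiregularly_based_in W V"
    and VW: "V \<subseteq> W" and T: "T \<in> mreg_models V" "T \<in> W"
  shows "T \<in> V"
proof -
  obtain \<Sigma> where \<Sigma>: "is_basis \<Sigma> V" "\<forall>(A, u, v)\<in>\<Sigma>. multiregular W A u \<and> multiregular W A v"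
    using mb by (auto simp: multiregularly_based_in_def)
  have Tf: "T \<in> fin_sgrps" using T(1) by (simp add: mreg_models_def)
  have "satisfies T e" if e: "e \<in> \<Sigma>" for e
  proof -
    have "e \<in> pseudoidentities" using \<Sigma>(1) e by (auto simp: is_basis_def)
    then obtain A u v where uv: "e = (A, limw fin_sgrps A u, limw fin_sgrps A v)" "finite A" "A \<noteq> {}"
      "u \<in> pseqs A" "v \<in> pseqs A" by (rule pseudoidentity_cases)
    interpret free_pro_words W A by unfold_locales (use W uv in simp_all)
    obtain g where g: "g \<in> mreg A" "\<forall>n. g n \<noteq> []" "weq W A u g"
      using \<Sigma>(2) e uv(1) multiregular_iff[OF uv(4)] by blast
    obtain g' where g': "g' \<in> mreg A" "\<forall>n. g' n \<noteq> []" "weq W A v g'"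
      using \<Sigma>(2) e uv(1) multiregular_iff[OF uv(5)] by blast
    have "weq {S} A u v" if S: "S \<in> V" for S
    proof -
      have "S \<in> fin_sgrps" "satisfies S e" using \<Sigma>(1) S e by (auto simp: is_basis_def simp del: satisfies.simps)
      then show ?thesis using satisfies_iff[OF _ uv(2-5)] uv(1) by simp
    qed
    then have "weq V A u v" using weq_singletons by blast
    then have "weq V A g g'"
      using weq_mono[OF g(3) VW] weq_mono[OF g'(3) VW] weq_sym weq_trans by blast
    then have "weq {T} A g g'"
      by (rule mreg_modelsD[OF T(1) uv(2,3) g(1) g'(1) g(2) g'(2)])
    moreover have "weq {T} A u g" "weq {T} A v g'" using g(3) g'(3) T(2) by (auto intro: weq_mono)
    ultimately have "weq {T} A u v" using weq_sym weq_trans by blast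
    then show ?thesis using satisfies_iff[OF Tf uv(2-5)] uv(1) by simp
  qed
  then show ?thesis using \<Sigma>(1) Tf unfolding is_basis_def by blast
qed

text \<open>The pseudovariety \<open>DS\<close> is defined by \<open>(xy)\<^sup>\<omega> x = ((xy)\<^sup>\<omega> x)\<^sup>\<omega>\<^sup>+\<^sup>1\<close>: regular elements lie in
  subgroups.\<close>

lemma mreg_models_DS:
  assumes VDS: "V \<subseteq> DS"
  shows "mreg_models V \<subseteq> DS"
proof
  fix T assume T: "T \<in> mreg_models V"
  then have Tf: "T \<in> fin_sgrps" by (simp add: mreg_models_def)
  define A where "A = {0, 1 :: nat}"
  define g where "g n = wpow ([0] @ [1]) (fact n) @ [0 :: nat]" for n
  define g' where "g' n = wpow (g n @ []) (fact n) @ g n" for n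
  have A: "[0] \<in> lists A" "[1] \<in> lists A" by (simp_all add: A_def)
  have g: "g \<in> mreg A"
    unfolding g_def[abs_def] by (intro mreg_single) (auto simp: seqs_def A_def)
  then have g': "g' \<in> mreg A"
    using mreg_single[OF mreg_seqs[OF g], of "\<lambda>n. []"] by (simp add: g'_def[abs_def] g_def)
  have gl: "g n \<in> lists A" for n using mreg_seqs[OF g] by (rule seqsD)
  have "weq V A g g'"
    unfolding weq_def
  proof (intro ballI)
    fix S f assume S: "S \<in> V" and f: "f \<in> A \<rightarrow> carrier S"
    interpret group_eval S f A using S f VDS by (intro DS_group_eval) auto
    have "E (g n) = E (g' n)" if n: "n \<ge> stab S" for n
    proof -
      have "E (g n) = E (g n @ ([1] @ wpow ([0] @ [1]) (2 * fact n - 1)) @ g n)"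
        unfolding g_def by (rule block_regular[OF A n])
      from grp[OF gl _ this n] A wpow_lists[of "[0] @ [1]" A "2 * fact n - 1"]
      show ?thesis by (simp add: g'_def)
    qed
    then show "\<forall>\<^sub>F n in uf. E (g n) = E (g' n)" by (rule ae_ge)
  qed
  then have w: "weq {T} A g g'"
    by (intro mreg_modelsD[OF T _ _ g g']) (auto simp: A_def g_def g'_def)
  have Ts: "is_sgrp T" "finite (carrier T)" using Tf by (auto dest: fin_sgrpsD)
  show "T \<in> DS"
  proof (rule DS_I[OF Tf])
    fix s t assume s: "s \<in> carrier T" and t: "t \<in> carrier T" and st: "smult T (smult T s t) s = s"
    define f where "f = (\<lambda>i::nat. if i = 0 then s else t)"
    have f: "f \<in> A \<rightarrow> carrier T" using s t by (auto simp: f_def)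
    interpret finite_eval T f A by (rule finite_eval_fin[OF Tf f])
    have 0: "E [0] = E (([0] @ [1]) @ [0] @ [])"
      using s t st Ts by (simp add: f_def sgrp_assoc)
    have "E [0] = E (wpow ([0] @ [1]) (fact n) @ [0] @ wpow [] (fact n))" for n
      by (rule iterate[OF 0]) (use A in auto)
    \<comment> \<open>Since s t s = s, the word (xy)^(n!) x takes the value s at every index, not
      just in the limit.\<close>
    then have g0: "E (g n) = E [0]" for n by (simp add: g_def)
    have pw: "E (wpow (g n) k) = E (wpow [0] k)" for n k
    proof (induction k)
      case (Suc k)
      have "E (g n @ wpow (g n) k) = E ([0] @ wpow (g n) k)"
        by (rule rwl[OF g0]) (use gl A wpow_lists[OF gl] in simp_all)
      also have "\<dots> = E ([0] @ wpow [0] k)"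
        by (rule rwr[OF Suc]) (use gl A wpow_lists[OF gl] wpow_lists[OF A(1)] in simp_all)
      finally show ?case by (simp add: wpow_Suc)
    qed simp
    have "\<forall>\<^sub>F n in uf. E (g n) = E (g' n)" using w f by (simp add: weq_def)
    then obtain n where n: "E (g n) = E (g' n)" using eventually_happens' uf_neq_bot by blast
    have "E (g' n) = E (wpow (g n) (Suc (fact n)))" by (simp add: g'_def wpow_Suc2)
    then have "E [0] = E (wpow [0] (Suc (fact n)))" using n g0 pw by simp
    also have "wpow [0::nat] (Suc (fact n)) = [] @ ([0] @ [0]) @ wpow [0] (fact n - 1)"
      using wpow_fact[of "[0::nat]" n] by (simp add: wpow_Suc)
    finally have sq: "E [0] = E ([] @ ([0] @ [0]) @ wpow [0] (fact n - 1))" .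
    have "mev T (\<lambda>x. x) (wpow [s] (fact m) @ [s]) = Some s" if m: "m \<ge> stab T" for m
    proof -
      have "E (wpow [0] (fact m) @ [0]) = E [0]"
        by (rule group_power[OF sq _ _ _ m]) (use A wpow_lists[OF A(1)] in simp_all)
      moreover have "map f (wpow [0] (fact m) @ [0]) = wpow [s] (fact m) @ [s]"
        by (simp add: wpow_def map_concat f_def)
      then have "mev T (\<lambda>x. x) (wpow [s] (fact m) @ [s]) = E (wpow [0] (fact m) @ [0])"
        using mev_map[of T "\<lambda>x. x" f "wpow [0] (fact m) @ [0]"] by simp
      ultimately show ?thesis by (simp add: f_def)
    qed
    then show "\<exists>N. \<forall>n\<ge>N. mev T (\<lambda>x. x) (wpow [s] (fact n) @ [s]) = Some s" by blast
  qed
qed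

text \<open>Take S as its own alphabet. If S is not in \<open>V\<close>, it is no image of any
  level-k quotient over \<open>V\<close>, so at each k there are words that this level identifies
  and S separates. Their limits agree in \<open>V\<close>, hence in S by
  \<open>weq_V_imp_weq_W\<close>, a contradiction.\<close>

lemma bideterministic_imp_mreg_models:
  assumes pv: "pseudovariety V" and V: "subdirect_closed V" and bd: "closed_under_bideterministic_product V" and VDS: "V \<subseteq> DS"
  shows "mreg_models V \<subseteq> V"
proof
  have Vf: "V \<subseteq> fin_sgrps" using V by (simp add: subdirect_closed_def)
  fix S assume S: "S \<in> mreg_models V"
  then have Sf: "S \<in> fin_sgrps" by (simp add: mreg_models_def)
  have Ss: "is_sgrp S" "finite (carrier S)" using Sf by (auto dest: fin_sgrpsD)
  define A where "A = carrier S"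
  have fA: "finite A" and neA: "A \<noteq> {}" using Ss by (auto simp: A_def is_sgrp_def)
  have id: "(\<lambda>x. x) \<in> A \<rightarrow> carrier S" by (simp add: A_def)
  interpret multiregular_consequences V "mreg_models V" A
  proof
    show "V \<subseteq> mreg_models V" using Vf by (rule subset_mreg_models)
    show "mreg_models V \<subseteq> DS" using VDS by (rule mreg_models_DS)
    fix g g' assume g: "g \<in> mreg A" "g' \<in> mreg A" and eq: "weq V A g g'"
    have nil: "(\<forall>\<^sub>F n in uf. g n = []) \<longleftrightarrow> (\<forall>\<^sub>F n in uf. g' n = [])"
    proof -
      have "\<forall>\<^sub>F n in uf. teq V A 1 (g n) (g' n)"
        using eq weq_iff_teq[OF V fA mreg_seqs[OF g(1)] mreg_seqs[OF g(2)]] by blast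
      then have "\<forall>\<^sub>F n in uf. (g n = []) = (g' n = [])"
        by (rule eventually_mono) (use teq_nil[OF V] in blast)
      then show ?thesis by (rule eventually_subst)
    qed
    consider "g = (\<lambda>n. [])" "g' = (\<lambda>n. [])" | "\<forall>n. g n \<noteq> []" "\<forall>n. g' n \<noteq> []"
      using mreg_cases[OF g(1)] mreg_cases[OF g(2)] nil by auto
    then show "weq (mreg_models V) A g g'"
    proof cases
      case 2
      then show ?thesis using mreg_modelsD[OF _ fA neA g 2 eq] weq_singletons by blast
    qed simp
  qed (rule V bd fA)+
  show "S \<in> V"
  proof (rule ccontr)
    assume SV: "S \<notin> V"
    have "\<exists>u\<in>plus_words A. \<exists>v\<in>plus_words A. teq V A k u v \<and> ev S (\<lambda>x. x) u \<noteq> ev S (\<lambda>x. x) v" for k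
    proof (rule ccontr)
      assume neg: "\<not> ?thesis"
      obtain Q \<psi> where Q: "Q \<in> V" "\<psi> \<in> A \<rightarrow>\<^sub>E carrier Q" "carrier Q = finite_products Q (\<psi> ` A)"
        "\<forall>u\<in>plus_words A. \<forall>v\<in>plus_words A. ev Q \<psi> u = ev Q \<psi> v \<longleftrightarrow> teq V A k u v"
        using teq_quotient[OF V fA neA, where k = k] .
      have Qs: "is_sgrp Q" "\<psi> \<in> A \<rightarrow> carrier Q" using Q Vf by (auto dest: fin_sgrpsD)
      have "ev S (\<lambda>x. x) u = ev S (\<lambda>x. x) v"
        if "u \<in> plus_words A" "v \<in> plus_words A" "ev Q \<psi> u = ev Q \<psi> v" for u v
        using Q(4) neg that by blast
      from hom_from_kernel[OF Qs Q(3) Ss(1) id this] obtain h where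
        h: "h \<in> sg_hom Q S" "\<And>w. w \<in> plus_words A \<Longrightarrow> h (ev Q \<psi> w) = ev S (\<lambda>x. x) w" by metis
      have "h ` carrier Q = carrier S"
      proof
        show "h ` carrier Q \<subseteq> carrier S" using h(1) by (auto simp: sg_hom_def)
        show "carrier S \<subseteq> h ` carrier Q"
        proof
          fix s assume s: "s \<in> carrier S"
          then have "h (ev Q \<psi> [s]) = s" using h(2)[of "[s]"] by (simp add: A_def)
          moreover have "ev Q \<psi> [s] \<in> carrier Q" by (rule ev_in[OF Qs]) (use s in \<open>simp_all add: A_def\<close>)
          ultimately show "s \<in> h ` carrier Q" by (metis imageI)
        qed
      qed
      then have "hom_image Q S" using h(1) by (auto simp: hom_image_def)
      then show False using pv Q(1) Sf SV unfolding pseudovariety_def by blast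
    qed
    then obtain u v where uv: "\<And>k. u k \<in> plus_words A" "\<And>k. v k \<in> plus_words A"
      "\<And>k. teq V A k (u k) (v k)" "\<And>k. ev S (\<lambda>x. x) (u k) \<noteq> ev S (\<lambda>x. x) (v k)" by metis
    have l: "u \<in> seqs A" "v \<in> seqs A" using uv(1,2) by (auto simp: seqs_def)
    have "weq V A u v"
      unfolding weq_iff_teq[OF V fA l]
      using uv(3) teq_mono by (intro allI ae_ge) blast
    from weq_V_imp_weq_W[OF l this] have "\<forall>\<^sub>F n in uf. mev S (\<lambda>x. x) (u n) = mev S (\<lambda>x. x) (v n)"
      using S id by (auto simp: weq_def)
    then have "\<forall>\<^sub>F n in uf. False"
      by (rule eventually_mono) (use uv(4) in \<open>simp add: ev_def, metis\<close>)
    then show False by simp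
  qed
qed


section \<open>Recognizing bideterministic products\<close>

lemma finite_image_factor:
  assumes "finite (G ` X)" "\<And>x y. x \<in> X \<Longrightarrow> y \<in> X \<Longrightarrow> G x = G y \<Longrightarrow> F x = F y"
  shows "finite (F ` X)"
proof -
  have "F ` X \<subseteq> (\<lambda>g. F (inv_into X G g)) ` (G ` X)"
  proof
    fix z assume "z \<in> F ` X"
    then obtain x where x: "x \<in> X" "z = F x" by blast
    then have "F (inv_into X G (G x)) = F x"
      by (intro assms(2)) (auto intro: inv_into_into f_inv_into_f)
    then show "z \<in> (\<lambda>g. F (inv_into X G g)) ` (G ` X)" using x by force
  qed
  then show ?thesis using assms(1) finite_subset by blast
qed

lemma saturated_recognizable_or_nil:
  "subdirect_closed V \<Longrightarrow> recognizable V A L \<or> L = {[]} \<Longrightarrow> saturated V A L"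
  using recognizable_saturated[of V A L] saturated_nil[of V A] by (metis subdirect_closed_def)

locale code_product =
  fixes V :: "nat sgrp set" and A :: "nat set" and a :: nat and L K :: "nat list set"
  assumes V: "subdirect_closed V" and A: "finite A" "a \<in> A"
    and L: "saturated V A L" and K: "saturated V A K"
    and pre: "prefix_code A {u @ [a] |u. u \<in> L}" and suf: "suffix_code A {[a] @ v |v. v \<in> K}"
begin

definition M where "M = {u @ [a] @ v |u v. u \<in> L \<and> v \<in> K}"

text \<open>The kernel of this map is the syntactic congruence of \<open>M\<close>.\<close>

definition contexts where "contexts w = {(x, y). x \<in> lists A \<and> y \<in> lists A \<and> x @ w @ y \<in> M}"

lemma Vf: "V \<subseteq> fin_sgrps"
  using V by (simp add: subdirect_closed_def)

lemma LK: "L \<subseteq> lists A" "K \<subseteq> lists A"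
  using L K by (auto simp: saturated_def)

text \<open>The product is recognised by a finite semigroup, possibly outside \<open>V\<close>:
  besides its values for L and K, a word is remembered by the pairs of values at its cuts around
  \<open>a\<close>, as in a Schuetzenberger product.\<close>

lemma finite_contexts: "finite (contexts ` plus_words A)"
proof -
  obtain T f where T: "T \<in> V" "f \<in> A \<rightarrow> carrier T"
    and Lsat: "\<forall>u\<in>lists A. \<forall>v\<in>lists A. mev T f u = mev T f v \<longrightarrow> (u \<in> L \<longleftrightarrow> v \<in> L)"
    using L unfolding saturated_def by metis
  obtain T' f' where T': "T' \<in> V" "f' \<in> A \<rightarrow> carrier T'"
    and Ksat: "\<forall>u\<in>lists A. \<forall>v\<in>lists A. mev T' f' u = mev T' f' v \<longrightarrow> (u \<in> K \<longleftrightarrow> v \<in> K)"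
    using K unfolding saturated_def by metis
  have Ts: "is_sgrp T" "finite (carrier T)" "is_sgrp T'" "finite (carrier T')"
    using T(1) T'(1) Vf by (auto dest: fin_sgrpsD)
  define cuts where "cuts w = {(mev T f p, mev T' f' q) |p q. p \<in> lists A \<and> q \<in> lists A \<and> w = p @ a # q}" for w
  define G where "G w = (mev T f w, mev T' f' w, cuts w)" for w
  have "G ` plus_words A \<subseteq> mcar T \<times> mcar T' \<times> Pow (mcar T \<times> mcar T')"
    using mev_in[OF Ts(1) T(2)] mev_in[OF Ts(3) T'(2)] by (fastforce simp: G_def cuts_def)
  moreover have "finite (mcar T \<times> mcar T' \<times> Pow (mcar T \<times> mcar T'))"
    using Ts by (simp add: mcar_def)
  ultimately have Gfin: "finite (G ` plus_words A)" by (rule finite_subset)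
  have sub: "contexts w \<subseteq> contexts w'"
    if w: "w \<in> lists A" "w' \<in> lists A" and G: "G w = G w'" for w w'
  proof clarify
    fix x y assume "(x, y) \<in> contexts w"
    then obtain l k where xy: "x \<in> lists A" "y \<in> lists A" "x @ w @ y = l @ a # k" "l \<in> L" "k \<in> K"
      by (auto simp: contexts_def M_def)
    have lk: "l \<in> lists A" "k \<in> lists A" using xy(4,5) LK by auto
    have Lc: "x @ w' @ s \<in> L" if "x @ w @ s \<in> L" "s \<in> lists A" for s
    proof -
      have "mev T f (x @ w @ s) = mev T f (x @ w' @ s)"
        by (rule mev_congr[OF Ts(1) T(2)]) (use G w xy that in \<open>simp_all add: G_def\<close>)
      then show ?thesis using Lsat[rule_format, of "x @ w @ s" "x @ w' @ s"] that w xy(1) by simp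
    qed
    have Kc: "s @ w' @ y \<in> K" if "s @ w @ y \<in> K" "s \<in> lists A" for s
    proof -
      have "mev T' f' (s @ w @ y) = mev T' f' (s @ w' @ y)"
        by (rule mev_congr[OF Ts(3) T'(2)]) (use G w xy that in \<open>simp_all add: G_def\<close>)
      then show ?thesis using Ksat[rule_format, of "s @ w @ y" "s @ w' @ y"] that w xy(2) by simp
    qed
    \<comment> \<open>The marked letter lies in \<open>x\<close>, in \<open>w\<close> or in
      \<open>y\<close>; only the middle case uses the cuts.\<close>
    consider s where "x = l @ a # s" "k = s @ w @ y"
      | p q where "l = x @ p" "w = p @ a # q" "k = q @ y"
      | s where "l = x @ w @ s" "y = s @ a # k"
      using xy(3) unfolding append_eq_append_Cons by auto
    then have "x @ w' @ y \<in> M"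
    proof cases
      case (1 s)
      then have "s @ w' @ y \<in> K" using Kc[of s] xy by simp
      then show ?thesis using 1 xy(4) unfolding M_def by (intro CollectI exI[of _ l] exI[of _ "s @ w' @ y"]) simp
    next
      case (2 p q)
      then have pq: "p \<in> lists A" "q \<in> lists A" using w(1) by auto
      then have "(mev T f p, mev T' f' q) \<in> cuts w'" using G 2 unfolding G_def cuts_def by blast
      then obtain p' q' where p': "p' \<in> lists A" "q' \<in> lists A" "w' = p' @ a # q'"
        "mev T f p = mev T f p'" "mev T' f' q = mev T' f' q'" unfolding cuts_def by blast
      have "mev T f (x @ p @ []) = mev T f (x @ p' @ [])"
        by (rule mev_congr[OF Ts(1) T(2) p'(4)]) (use pq p' xy in simp_all)
      then have "x @ p' \<in> L" using Lsat[rule_format, of "x @ p" "x @ p'"] 2 xy pq p' by simp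
      moreover have "mev T' f' ([] @ q @ y) = mev T' f' ([] @ q' @ y)"
        by (rule mev_congr[OF Ts(3) T'(2) p'(5)]) (use pq p' xy in simp_all)
      then have "q' @ y \<in> K" using Ksat[rule_format, of "q @ y" "q' @ y"] 2 xy pq p' by simp
      ultimately show ?thesis using p'(3) unfolding M_def
        by (intro CollectI exI[of _ "x @ p'"] exI[of _ "q' @ y"]) simp
    next
      case (3 s)
      then have "x @ w' @ s \<in> L" using Lc[of s] xy by simp
      then show ?thesis using 3 xy(5) unfolding M_def by (intro CollectI exI[of _ "x @ w' @ s"] exI[of _ k]) simp
    qed
    then show "(x, y) \<in> contexts w'" using xy by (simp add: contexts_def)
  qed
  show ?thesis
  proof (rule finite_image_factor[OF Gfin])
    fix w w' assume "w \<in> plus_words A" "w' \<in> plus_words A" "G w = G w'"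
    then show "contexts w = contexts w'" using sub[of w w'] sub[of w' w] by auto
  qed
qed

text \<open>A marked letter inside a multiregular factor would allow pumping, which produces two words of
  \<open>La\<close> that are comparable for the prefix order, or two words of \<open>aK\<close> comparable for the suffix
  order.\<close>

lemma contexts_mono:
  assumes g: "g \<in> mreg A" and g': "g' \<in> seqs A" and eq: "weq V A g g'"
  shows "\<forall>\<^sub>F n in uf. contexts (g n) \<subseteq> contexts (g' n)"
proof (rule ccontr)
  assume "\<not> ?thesis"
  then have "\<forall>\<^sub>F n in uf. \<exists>x\<in>lists A. \<exists>y\<in>lists A. x @ g n @ y \<in> M \<and> x @ g' n @ y \<notin> M"
    unfolding ae_not[symmetric] by (rule eventually_mono) (auto simp: contexts_def)
  from ae_seqs[OF this] obtain x where x: "x \<in> seqs A"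
    "\<forall>\<^sub>F n in uf. \<exists>y\<in>lists A. x n @ g n @ y \<in> M \<and> x n @ g' n @ y \<notin> M" by blast
  from ae_seqs[OF x(2)] obtain y where y: "y \<in> seqs A"
    "\<forall>\<^sub>F n in uf. x n @ g n @ y n \<in> M \<and> x n @ g' n @ y n \<notin> M" by blast
  have out: "\<forall>\<^sub>F n in uf. x n @ g' n @ y n \<notin> M" using y(2) by (rule eventually_mono) simp
  have gl: "g \<in> seqs A" using g by (rule mreg_seqs)
  have "\<forall>\<^sub>F n in uf. \<exists>l\<in>lists A. \<exists>k\<in>lists A. x n @ g n @ y n = l @ a # k \<and> l \<in> L \<and> k \<in> K"
    using y(2) by (rule eventually_mono) (use LK in \<open>fastforce simp: M_def\<close>)
  from ae_seqs[OF this] obtain l where l: "l \<in> seqs A"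
    "\<forall>\<^sub>F n in uf. \<exists>k\<in>lists A. x n @ g n @ y n = l n @ a # k \<and> l n \<in> L \<and> k \<in> K" by blast
  from ae_seqs[OF l(2)] obtain k where k: "k \<in> seqs A"
    "\<forall>\<^sub>F n in uf. x n @ g n @ y n = l n @ a # k n \<and> l n \<in> L \<and> k n \<in> K" by blast
  have eq1: "\<forall>\<^sub>F n in uf. x n @ (g n @ y n) = l n @ a # k n" and lL: "\<forall>\<^sub>F n in uf. l n \<in> L"
    and kK: "\<forall>\<^sub>F n in uf. k n \<in> K"
    using k(2) by (auto elim: eventually_mono)
  have gy: "(\<lambda>n. g n @ y n) \<in> seqs A" using gl y by simp
  have MI: "l' @ a # k' \<in> M" if "l' \<in> L" "k' \<in> K" for l' k' using that by (auto simp: M_def)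
  from eq1 x(1) gy show False
  proof (cases rule: ae_split)
    \<comment> \<open>With the marked letter in x, the factor g lies entirely in the K-part, and K
      is recognised in \<open>V\<close>, where g and g' agree.\<close>
    case (left s)
    have "weq V A k (\<lambda>n. s n @ g n @ y n)" by (rule weq_ae) fact
    also have "weq V A \<dots> (\<lambda>n. s n @ g' n @ y n)"
      by (rule weq_cong[OF Vf eq]) (use gl g' left y in simp_all)
    finally have "\<forall>\<^sub>F n in uf. s n @ g' n @ y n \<in> K"
      by (rule saturated_ae[OF K]) (use k kK left g' y in simp_all)
    with lL left(2) out have "\<forall>\<^sub>F n in uf. False"
      by eventually_elim (use MI in fastforce)
    then show False by simp
  next
    case (right s)
    from right(3) gl y(1) show False
    proof (cases rule: ae_split)
      case (left t)
      from position_in_mreg[OF g left(2) right(1) left(1) A(2)] show False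
      proof
        assume "Rabsorb fin_sgrps A s a"
        then have "Rabsorb V A s a" by (rule Rabsorb_mono[OF _ Vf])
        then have "Rabsorb V A l a"
          by (rule Rabsorb_prepend[OF Vf _ weq_ae[OF right(2)]]) (use right x l A in simp_all)
        then obtain z where z: "z \<in> seqs A" "weq V A l (\<lambda>n. l n @ a # z n)" by (auto simp: Rabsorb_def)
        have "\<forall>\<^sub>F n in uf. l n @ a # z n \<in> L"
          by (rule saturated_ae[OF L z(2) _ _ lL]) (use l z A in simp_all)
        with lL have "\<forall>\<^sub>F n in uf. False"
        proof eventually_elim
          case (elim n)
          let ?u = "l n @ [a]" and ?t = "z n @ [a]"
          have "?u \<in> {u @ [a] |u. u \<in> L}" "?u @ ?t \<in> {u @ [a] |u. u \<in> L}"
            using elim by (blast, intro CollectI exI[of _ "l n @ a # z n"]) simp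
          moreover have "?t \<in> lists A - {[]}" using z(1) A by (simp add: seqsD del: in_lists_conv_set)
          ultimately show False using pre unfolding prefix_code_def by blast
        qed
        then show False by simp
      next
        assume "Labsorb fin_sgrps A a t"
        then have "Labsorb V A a t" by (rule Labsorb_mono[OF _ Vf])
        then have "Labsorb V A a k"
          by (rule Labsorb_append[OF Vf _ weq_ae[OF left(3)]]) (use left y k A in simp_all)
        then obtain z where z: "z \<in> seqs A" "weq V A k (\<lambda>n. z n @ a # k n)" by (auto simp: Labsorb_def)
        have "\<forall>\<^sub>F n in uf. z n @ a # k n \<in> K"
          by (rule saturated_ae[OF K z(2) _ _ kK]) (use k z A in simp_all)
        with kK have "\<forall>\<^sub>F n in uf. False"
        proof eventually_elim
          case (elim n)
          let ?u = "[a] @ k n" and ?t = "[a] @ z n"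
          have "?u \<in> {[a] @ v |v. v \<in> K}" "?t @ ?u \<in> {[a] @ v |v. v \<in> K}"
            using elim by (blast, intro CollectI exI[of _ "z n @ a # k n"]) simp
          moreover have "?t \<in> lists A - {[]}" using z(1) A by (simp add: seqsD del: in_lists_conv_set)
          ultimately show False using suf unfolding suffix_code_def by blast
        qed
        then show False by simp
      qed
    next
      case right': (right s')
      have "\<forall>\<^sub>F n in uf. l n = x n @ g n @ s' n"
        using right(2) right'(2) by eventually_elim simp
      then have "weq V A l (\<lambda>n. x n @ g n @ s' n)" by (rule weq_ae)
      also have "weq V A \<dots> (\<lambda>n. x n @ g' n @ s' n)"
        by (rule weq_cong[OF Vf eq]) (use gl g' right' x in simp_all)
      finally have "\<forall>\<^sub>F n in uf. x n @ g' n @ s' n \<in> L"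
        by (rule saturated_ae[OF L]) (use l lL right' g' x in simp_all)
      with kK right'(3) out have "\<forall>\<^sub>F n in uf. False"
        by eventually_elim (use MI in fastforce)
      then show False by simp
    qed
  qed
qed

text \<open>It suffices that the syntactic semigroup of \<open>M\<close> satisfies the multiregular
  pseudoidentities of \<open>V\<close>. \<open>contexts_mono\<close>, applied in both directions,
  shows that the two sides become syntactically equivalent.\<close>

lemma recognizable_product:
  assumes sub: "mreg_models V \<subseteq> V"
  shows "recognizable V A M"
proof -
  have A': "A \<noteq> {}" using A by blast
  have cong: "contexts (x @ u @ y) = contexts (x @ v @ y)"
    if uv: "contexts u = contexts v" and xy: "x \<in> lists A" "y \<in> lists A" for u v x y
  proof -
    have "(x', y') \<in> contexts (x @ w @ y) \<longleftrightarrow> x' \<in> lists A \<and> y' \<in> lists A \<and> (x' @ x, y @ y') \<in> contexts w"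
      for x' y' w using xy by (auto simp: contexts_def)
    then show ?thesis using uv by auto
  qed
  obtain Q \<psi> where Q: "Q \<in> fin_sgrps" "\<psi> \<in> A \<rightarrow>\<^sub>E carrier Q" "carrier Q = finite_products Q (\<psi> ` A)"
    "\<forall>u\<in>plus_words A. \<forall>v\<in>plus_words A. ev Q \<psi> u = ev Q \<psi> v \<longleftrightarrow> contexts u = contexts v"
    using quotient_sgrp[OF A' finite_contexts cong] .
  have Qs: "is_sgrp Q" "\<psi> \<in> A \<rightarrow> carrier Q" using Q by (auto dest: fin_sgrpsD)
  have "Q \<in> mreg_models V"
  proof (rule mreg_modelsI[OF Q(1)])
    fix B :: "nat set" and g g'
    assume B: "finite B" "B \<noteq> {}" and g: "g \<in> mreg B" "g' \<in> mreg B" "\<forall>n. g n \<noteq> []" "\<forall>n. g' n \<noteq> []"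
      and eq: "weq V B g g'"
    show "weq {Q} B g g'"
      unfolding weq_def
    proof (intro ballI)
      fix T \<eta> assume "T \<in> {Q}" and \<eta>: "\<eta> \<in> B \<rightarrow> carrier T"
      then have TQ: "T = Q" by simp
      have "\<exists>w\<in>plus_words A. ev Q \<psi> w = \<eta> b" if "b \<in> B" for b
      proof -
        have "\<eta> b \<in> carrier Q" using \<eta> that TQ by auto
        then show ?thesis using Q(3) finite_products_eq[OF Qs] by auto
      qed
      \<comment> \<open>An evaluation of B in the syntactic semigroup lifts to a substitution by
        words over A, and substitution preserves \<open>mreg\<close>.\<close>
      then obtain \<sigma> where \<sigma>: "\<And>b. b \<in> B \<Longrightarrow> \<sigma> b \<in> plus_words A" "\<And>b. b \<in> B \<Longrightarrow> ev Q \<psi> (\<sigma> b) = \<eta> b" by metis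
      define \<tau> where "\<tau> w = concat (map \<sigma> w)" for w
      have sub: "mev S f (\<tau> w) = mev S (\<lambda>b. ev S f (\<sigma> b)) w"
        if "is_sgrp S" "f \<in> A \<rightarrow> carrier S" "w \<in> lists B" for S :: "nat sgrp" and f w
        unfolding \<tau>_def by (rule mev_concat_map[OF that(1,2) \<sigma>(1) that(3)])
      have gB: "g n \<in> lists B" "g' n \<in> lists B" for n by (intro seqsD mreg_seqs g)+
      have h: "(\<lambda>n. \<tau> (g n)) \<in> mreg A" "(\<lambda>n. \<tau> (g' n)) \<in> mreg A"
        using mreg_subst[OF g(1) \<sigma>(1)] mreg_subst[OF g(2) \<sigma>(1)] by (simp_all add: \<tau>_def)
      have "weq V A (\<lambda>n. \<tau> (g n)) (\<lambda>n. \<tau> (g' n))"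
        unfolding weq_def
      proof (intro ballI)
        fix S f assume S: "S \<in> V" and f: "f \<in> A \<rightarrow> carrier S"
        have Ss: "is_sgrp S" using S Vf by (auto dest: fin_sgrpsD)
        have "(\<lambda>b. ev S f (\<sigma> b)) \<in> B \<rightarrow> carrier S" using ev_in[OF Ss f] \<sigma>(1) by auto
        then have "\<forall>\<^sub>F n in uf. mev S (\<lambda>b. ev S f (\<sigma> b)) (g n) = mev S (\<lambda>b. ev S f (\<sigma> b)) (g' n)"
          using eq S by (auto simp: weq_def)
        then show "\<forall>\<^sub>F n in uf. mev S f (\<tau> (g n)) = mev S f (\<tau> (g' n))"
          using sub[OF Ss f gB(1)] sub[OF Ss f gB(2)] by simp
      qed
      note c = contexts_mono[OF h(1) mreg_seqs[OF h(2)] this]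
        contexts_mono[OF h(2) mreg_seqs[OF h(1)] weq_sym[OF this]]
      have val: "mev Q \<eta> w = mev Q \<psi> (\<tau> w)" if "w \<in> lists B" for w
      proof -
        have "mev Q \<eta> w = mev Q (\<lambda>b. ev Q \<psi> (\<sigma> b)) w"
          by (rule mev_cong_fun) (use \<sigma>(2) that in auto)
        then show ?thesis using sub[OF Qs that] by simp
      qed
      have ne: "\<tau> w \<noteq> []" if "w \<in> lists B" "w \<noteq> []" for w
        using val[OF that(1)] that(2) by (metis mev_None_iff)
      from c show "\<forall>\<^sub>F n in uf. mev T \<eta> (g n) = mev T \<eta> (g' n)"
      proof eventually_elim
        case (elim n)
        have pl: "\<tau> (g n) \<in> plus_words A" "\<tau> (g' n) \<in> plus_words A"
          using h mreg_seqs ne gB g(3,4) by auto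
        then have "ev Q \<psi> (\<tau> (g n)) = ev Q \<psi> (\<tau> (g' n))" using Q(4) elim by blast
        then show ?case unfolding TQ val[OF gB(1)] val[OF gB(2)] using pl by (simp add: mev_eq_ev_iff)
      qed
    qed
  qed
  then have "Q \<in> V" using sub by blast
  moreover have "M \<subseteq> plus_words A"
  proof
    fix w assume "w \<in> M"
    then obtain u v where w: "w = u @ a # v" "u \<in> L" "v \<in> K" by (auto simp: M_def)
    then have "u \<in> lists A" "v \<in> lists A" using LK by blast+
    then show "w \<in> plus_words A" using w(1) A by simp
  qed
  ultimately show ?thesis
  proof (rule saturated_recognizable[OF Vf _ Qs(2)])
    fix u v assume u: "u \<in> M" and v: "v \<in> plus_words A" and e: "ev Q \<psi> u = ev Q \<psi> v"
    have "u \<in> plus_words A" using u \<open>M \<subseteq> plus_words A\<close> by blast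
    then have "contexts u = contexts v" using Q(4) v e by blast
    moreover have "([], []) \<in> contexts u" using u by (simp add: contexts_def)
    ultimately show "v \<in> M" by (simp add: contexts_def)
  qed
qed

end

section \<open>From the inclusion \<open>mreg_models V \<subseteq> V\<close> to the three
  conditions\<close>

lemma mreg_models_imp_bideterministic:
  assumes V: "subdirect_closed V" and sub: "mreg_models V \<subseteq> V"
  shows "closed_under_bideterministic_product V"
  unfolding closed_under_bideterministic_product_def
proof (intro allI impI, elim conjE)
  fix A :: "nat set" and a L K
  assume "finite A" "a \<in> A" "recognizable V A L \<or> L = {[]}" "recognizable V A K \<or> K = {[]}"
    "prefix_code A {u @ [a] |u. u \<in> L}" "suffix_code A {[a] @ v |v. v \<in> K}"
  then interpret code_product V A a L K
    by unfold_locales (use V saturated_recognizable_or_nil in auto)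
  show "recognizable V A {u @ [a] @ v |u v. u \<in> L \<and> v \<in> K}"
    using recognizable_product[OF sub] by (simp add: M_def)
qed

text \<open>The representing \<open>mreg\<close> sequence does not mention the pseudovariety; only
  its equality with u does, and that weakens from all finite semigroups to \<open>W\<close>.\<close>

lemma multiregular_fin_imp:
  assumes W: "subdirect_closed W" and A: "finite A" "A \<noteq> {}" and u: "u \<in> pseqs A"
    and m: "multiregular fin_sgrps A (limw fin_sgrps A u)"
  shows "multiregular W A (limw fin_sgrps A u)"
proof -
  have Wf: "W \<subseteq> fin_sgrps" using W by (simp add: subdirect_closed_def)
  interpret F: free_pro_words fin_sgrps A using A by (rule free_pro_words_fin)
  interpret free_pro_words W A by unfold_locales (use W A in simp_all)
  show ?thesis using m F.multiregular_iff[OF u] multiregular_iff[OF u] weq_mono[OF _ Wf] by blast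
qed

lemma multiregularly_based_imp_in:
  assumes W: "subdirect_closed W" and m: "multiregularly_based V"
  shows "multiregularly_based_in W V"
proof -
  obtain \<Sigma> where \<Sigma>: "is_basis \<Sigma> V"
    "\<forall>(A, u, v)\<in>\<Sigma>. multiregular fin_sgrps A u \<and> multiregular fin_sgrps A v"
    using m by (auto simp: multiregularly_based_in_def)
  have "multiregular W A x \<and> multiregular W A y" if e: "(A, x, y) \<in> \<Sigma>" for A x y
  proof -
    have "(A, x, y) \<in> pseudoidentities" using e \<Sigma>(1) by (auto simp: is_basis_def)
    then obtain A' u v where uv: "(A, x, y) = (A', limw fin_sgrps A' u, limw fin_sgrps A' v)"
      "finite A'" "A' \<noteq> {}" "u \<in> pseqs A'" "v \<in> pseqs A'" by (rule pseudoidentity_cases)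
    have "multiregular fin_sgrps A x" "multiregular fin_sgrps A y" using \<Sigma>(2) e by auto
    then show ?thesis using multiregular_fin_imp[OF W uv(2,3)] uv by simp
  qed
  then show ?thesis using \<Sigma>(1) unfolding multiregularly_based_in_def by blast
qed

lemma multiregularly_based_iff:
  assumes V: "V \<subseteq> fin_sgrps"
  shows "multiregularly_based V \<longleftrightarrow> mreg_models V \<subseteq> V"
  using multiregularly_basedI[OF V] multiregularly_based_inD[OF subdirect_closed_fin _ V]
  by (auto simp: mreg_models_def)

theorem theorem7p4:
  fixes V :: "nat sgrp set"
  assumes "pseudovariety V"
    and "Sl \<subseteq> V" and "V \<subseteq> DS"
  shows "(closed_under_bideterministic_product V \<longleftrightarrow> multiregularly_based_in DS V) \<and>
         (multiregularly_based_in DS V \<longleftrightarrow> multiregularly_based V)"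
proof -
  have V: "subdirect_closed V" using assms(1) by (rule subdirect_closed_pseudovariety)
  then have Vf: "V \<subseteq> fin_sgrps" by (simp add: subdirect_closed_def)
  have 1: "closed_under_bideterministic_product V \<longleftrightarrow> mreg_models V \<subseteq> V"
    using bideterministic_imp_mreg_models[OF assms(1) V _ assms(3)] mreg_models_imp_bideterministic[OF V] by blast
  \<comment> \<open>A basis that is multiregular over \<open>DS\<close> says something about a model
    only if the model lies in \<open>DS\<close>; \<open>mreg_models_DS\<close> guarantees
    this.\<close>
  have 2: "multiregularly_based_in DS V \<Longrightarrow> mreg_models V \<subseteq> V"
    by (rule subsetI, rule multiregularly_based_inD[OF subdirect_closed_DS _ assms(3)])
      (use mreg_models_DS[OF assms(3)] in auto)
  have 3: "multiregularly_based V \<Longrightarrow> multiregularly_based_in DS V"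
    by (rule multiregularly_based_imp_in[OF subdirect_closed_DS])
  show ?thesis using 1 2 3 multiregularly_based_iff[OF Vf] by satx
qed

end
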